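(* There is no threshold resonance for the Dirichlet problem in $\Omega$; that is, the only bounded function $v$ satisfying $$-\Delta v=2\pi^2 v\ \text{ in }\Omega,\qquad v=0\ \text{ on }\partial\Omega$$ is $v\equiv 0$.
   Context: For $j=1,2,3$ let $L_j:=\{x=(x_1,x_2,x_3)\in\mathbb{R}^3 : |x_k|<1/2 \text{ for } k\in\{1,2,3\}\setminus\{j\}\}$, and let $\Omega:=L_1\cup L_2\cup L_3\subset\mathbb{R}^3$. Consider the spectral problem $-\Delta v=\mu v$ in $\Omega$, $v=0$ on $\partial\Omega$. The threshold $2\pi^2$ is the bottom of the continuous spectrum $[2\pi^2,+\infty)$ of the Dirichlet Laplacian in $\Omega$. One says that there is a threshold resonance if there is a non-zero bounded function $v$ solving this problem with $\mu=2\pi^2$. Solutions are understood in the usual weak sense: $v$ is locally $H^1$ up to the boundary (i.e. $v\in H^1(\Omega\cap B)$ for every ball $B$), has zero trace on $\partial\Omega$, and satisfies the equation in the distributional sense. *)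

theory Defs
  imports "HOL-Analysis.Analysis"
begin

section \<open>The domain\<close>

definition bar :: "3 \<Rightarrow> (real^3) set" where
  "bar j = {x. \<forall>k. k \<noteq> j \<longrightarrow> \<bar>x $ k\<bar> < 1/2}"

definition Omega :: "(real^3) set" where
  "Omega = (\<Union>j. bar j)"


section \<open>Test functions\<close>

text \<open>The derivative of \<open>f\<close> at \<open>x\<close> in direction \<open>b\<close>; for \<open>b \<in> Basis\<close> a partial derivative.\<close>

definition dir_deriv :: "'a::euclidean_space \<Rightarrow> ('a \<Rightarrow> 'b::real_normed_vector) \<Rightarrow> 'a \<Rightarrow> 'b" where
  "dir_deriv b f x = frechet_derivative f (at x) b"

primrec C_diff :: "nat \<Rightarrow> ('a::euclidean_space \<Rightarrow> 'b::real_normed_vector) \<Rightarrow> bool" where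
  "C_diff 0 f \<longleftrightarrow> continuous_on UNIV f"
| "C_diff (Suc n) f \<longleftrightarrow> (\<forall>x. f differentiable (at x)) \<and> (\<forall>h. C_diff n (dir_deriv h f))"

definition test_fun :: "'a::euclidean_space set \<Rightarrow> ('a \<Rightarrow> 'b::real_normed_vector) \<Rightarrow> bool" where
  "test_fun U \<phi> \<longleftrightarrow> (\<forall>n. C_diff n \<phi>) \<and>
     compact (closure {x. \<phi> x \<noteq> 0}) \<and> closure {x. \<phi> x \<noteq> 0} \<subseteq> U"

definition laplacian :: "('a::euclidean_space \<Rightarrow> 'b::real_normed_vector) \<Rightarrow> 'a \<Rightarrow> 'b" where
  "laplacian \<phi> x = (\<Sum>b\<in>Basis. dir_deriv b (dir_deriv b \<phi>) x)"


section \<open>Sobolev spaces\<close>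

text \<open>
  Functions are total; only their values on \<open>U\<close> matter, and only up to Lebesgue null sets.
\<close>

definition L2_on :: "'a::euclidean_space set \<Rightarrow> ('a \<Rightarrow> 'b::euclidean_space) \<Rightarrow> bool" where
  "L2_on U u \<longleftrightarrow> set_borel_measurable lebesgue U u \<and>
     set_integrable lebesgue U (\<lambda>x. (norm (u x))\<^sup>2)"

text \<open>
  \<open>u\<close> belongs to \<open>H\<^sup>1(U)\<close>, its weak partial derivative in direction \<open>b\<close> being \<open>g b\<close>.
\<close>

definition H1_with_gradient ::
    "'a::euclidean_space set \<Rightarrow> ('a \<Rightarrow> 'b::euclidean_space) \<Rightarrow> ('a \<Rightarrow> 'a \<Rightarrow> 'b) \<Rightarrow> bool" where
  "H1_with_gradient U u g \<longleftrightarrow> L2_on U u \<and>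
     (\<forall>b\<in>Basis. L2_on U (g b) \<and>
        (\<forall>\<phi> :: 'a \<Rightarrow> real. test_fun U \<phi> \<longrightarrow>
           (LINT x:U|lebesgue. dir_deriv b \<phi> x *\<^sub>R u x) = - (LINT x:U|lebesgue. \<phi> x *\<^sub>R g b x)))"

definition H1_on :: "'a::euclidean_space set \<Rightarrow> ('a \<Rightarrow> 'b::euclidean_space) \<Rightarrow> bool" where
  "H1_on U u \<longleftrightarrow> (\<exists>g. H1_with_gradient U u g)"

text \<open>
  Convergence in the norm of \<open>H\<^sup>1(U)\<close> of a sequence of smooth functions \<open>f n\<close> to \<open>u\<close>.
  The weak gradient \<open>g\<close> is unique up to null sets, so the choice of \<open>g\<close> is immaterial.
\<close>

definition H1_tendsto ::
    "'a::euclidean_space set \<Rightarrow> (nat \<Rightarrow> 'a \<Rightarrow> 'b::euclidean_space) \<Rightarrow> ('a \<Rightarrow> 'b) \<Rightarrow> bool" where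
  "H1_tendsto U f u \<longleftrightarrow> (\<exists>g. H1_with_gradient U u g \<and>
     (\<lambda>n. (LINT x:U|lebesgue. (norm (f n x - u x))\<^sup>2) +
          (\<Sum>b\<in>Basis. LINT x:U|lebesgue. (norm (dir_deriv b (f n) x - g b x))\<^sup>2)) \<longlonglongrightarrow> 0)"

text \<open>\<open>u\<close> is locally \<open>H\<^sup>1\<close> up to the boundary of \<open>U\<close>.\<close>

definition H1_loc_closure :: "'a::euclidean_space set \<Rightarrow> ('a \<Rightarrow> 'b::euclidean_space) \<Rightarrow> bool" where
  "H1_loc_closure U u \<longleftrightarrow> (\<forall>a r. 0 < r \<longrightarrow> H1_on (U \<inter> ball a r) u)"

text \<open>
  Zero trace on the boundary of \<open>U\<close>, in the sense of \<open>H\<^sup>1\<^sub>0\<close>: on every ball \<open>u\<close> is an \<open>H\<^sup>1\<close> limit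
  of smooth functions with compact support in \<open>U\<close>. The approximants need not vanish on the part
  of the sphere inside \<open>U\<close>, so nothing is imposed on \<open>u\<close> there.
\<close>

definition zero_trace :: "'a::euclidean_space set \<Rightarrow> ('a \<Rightarrow> 'b::euclidean_space) \<Rightarrow> bool" where
  "zero_trace U u \<longleftrightarrow>
     (\<forall>a r. 0 < r \<longrightarrow> (\<exists>f. (\<forall>n. test_fun U (f n)) \<and> H1_tendsto (U \<inter> ball a r) f u))"


section \<open>The spectral problem\<close>

text \<open>\<open>- \<Delta> v = \<mu> v\<close> in the sense of distributions on \<open>U\<close>.\<close>

definition helmholtz_distr :: "'a::euclidean_space set \<Rightarrow> real \<Rightarrow> ('a \<Rightarrow> 'b::euclidean_space) \<Rightarrow> bool" where
  "helmholtz_distr U \<mu> v \<longleftrightarrow> (\<forall>\<phi> :: 'a \<Rightarrow> real. test_fun U \<phi> \<longrightarrow>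
     - (LINT x:U|lebesgue. laplacian \<phi> x *\<^sub>R v x) = \<mu> *\<^sub>R (LINT x:U|lebesgue. \<phi> x *\<^sub>R v x))"

definition dirichlet_solution :: "'a::euclidean_space set \<Rightarrow> real \<Rightarrow> ('a \<Rightarrow> 'b::euclidean_space) \<Rightarrow> bool" where
  "dirichlet_solution U \<mu> v \<longleftrightarrow> H1_loc_closure U v \<and> zero_trace U v \<and> helmholtz_distr U \<mu> v"

definition ess_bounded_on :: "'a::euclidean_space set \<Rightarrow> ('a \<Rightarrow> 'b::real_normed_vector) \<Rightarrow> bool" where
  "ess_bounded_on U v \<longleftrightarrow> (\<exists>C. AE x in lebesgue. x \<in> U \<longrightarrow> norm (v x) \<le> C)"

definition zero_on :: "'a::euclidean_space set \<Rightarrow> ('a \<Rightarrow> 'b::real_normed_vector) \<Rightarrow> bool" where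
  "zero_on U v \<longleftrightarrow> (AE x in lebesgue. x \<in> U \<longrightarrow> v x = 0)"

text \<open>Complex-valued functions are allowed; real-valued ones are a special case.\<close>

definition threshold_resonance :: "(real^3) set \<Rightarrow> real \<Rightarrow> bool" where
  "threshold_resonance U \<mu> \<longleftrightarrow>
     (\<exists>v :: real^3 \<Rightarrow> complex. dirichlet_solution U \<mu> v \<and> ess_bounded_on U v \<and> \<not> zero_on U v)"

end

theory Submission
  imports Defs
begin

text \<open>Write \<open>a(f) = \<integral>|\<nabla>f|\<^sup>2 - 2\<pi>\<^sup>2 \<integral>|f|\<^sup>2\<close>. The domain is the unit cube \<open>Q\<close> with six arms attached to its faces. The
cross section of an arm is the unit square, whose lowest Dirichlet eigenvalue is \<open>2\<pi>\<^sup>2\<close>, so every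
arm contributes a non-negative amount to \<open>a\<close>. The proof rests on two facts about real functions
that vanish outside \<open>\<Omega>\<close> and have bounded support.

\<^item> \<open>energy_coercive\<close>: up to one dimension, \<open>a\<close> is positive, namely
  \<open>k \<integral>\<rho>|f|\<^sup>2 \<le> a(f) + C (\<integral>\<^sub>Q f)\<^sup>2\<close> with \<open>k > 0\<close> and a weight \<open>\<rho> > 0\<close> that decays like \<open>|x|\<^sup>-\<^sup>2\<close>.
\<^item> \<open>negative_energy\<close>: there is a test function \<open>\<phi>\<close> with \<open>a(\<phi>) < 0\<close>.

The two facts exclude a resonance. Let \<open>v\<close> be a bounded solution, real without loss of generality.
By the first fact \<open>\<integral>\<^sub>Q \<phi> \<noteq> 0\<close>, so \<open>v - t\<phi>\<close> has mean zero over \<open>Q\<close> for a suitable \<open>t\<close>. Since \<open>v\<close> solves the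
equation, the bilinear form of \<open>a\<close> vanishes between \<open>v\<close> and every admissible function, and formally
\<open>a(v - t\<phi>) = t\<^sup>2 a(\<phi>)\<close>. As \<open>v\<close> need not be square integrable it is first multiplied by a cutoff at
distance \<open>R\<close>; the gradient of the cutoff is \<open>O(1/R)\<close> on a set of volume \<open>O(R)\<close>, so that boundedness
of \<open>v\<close> makes the error \<open>O(1/R)\<close>. In the limit \<open>k \<integral>\<rho>|v - t\<phi>|\<^sup>2 \<le> t\<^sup>2 a(\<phi>)\<close>. The right-hand side is
negative unless \<open>t = 0\<close>, and then \<open>v = 0\<close>.

Coercivity is proved line by line. A line parallel to an axis either avoids the bar along that axis,
and then \<open>f\<close> satisfies Dirichlet conditions on it at distance one, or it runs through \<open>Q\<close> and two
arms. Reflections split \<open>f\<close> into parts with definite parity, and \<open>a\<close> splits accordingly. If \<open>f\<close> is odd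
in \<open>x\<^sub>j\<close>, the arms in the two other directions carry transversal energy at least \<open>5\<pi>\<^sup>2\<close> instead of \<open>2\<pi>\<^sup>2\<close>;
the surplus \<open>3\<pi>\<^sup>2\<close> acts on \<open>Q\<close> like a Robin condition on four faces and gives more than \<open>\<pi>\<^sup>2/2\<close> for
each of the two directions (\<open>line_robin\<close>), while \<open>x\<^sub>j\<close> itself gives \<open>\<pi>\<^sup>2\<close> by oddness: together more than
\<open>2\<pi>\<^sup>2\<close>. If \<open>f\<close> is even in all variables, the Neumann problem on \<open>Q\<close> restricted to even functions of
mean zero has lowest eigenvalue \<open>4\<pi>\<^sup>2\<close> (\<open>line_even\<close> in each variable, put together by
\<open>efron_stein\<close>). Hardy's inequality supplies the weight on the arms. All one-dimensional inequalities
come from integrating a square \<open>(f' - g f)\<^sup>2 \<ge> 0\<close> (\<open>riccati_interval\<close>).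

For negative energy, superpose two standing waves \<open>cos (\<pi> x\<^sub>k) cos (\<pi> x\<^sub>l)\<close>, each living in one bar.
Cut off far out, each has almost zero energy, but on \<open>Q\<close>, where the bars cross, their interaction is
strictly negative (\<open>energy_two_tensor\<close>).\<close>


section \<open>Smooth functions and cutoffs\<close>

lemma dir_deriv_eqI: "(f has_derivative D) (at x) \<Longrightarrow> dir_deriv b f x = D b"
  unfolding dir_deriv_def by (metis frechet_derivative_at)

lemma dir_deriv_has_derivative:
  "f differentiable (at x) \<Longrightarrow> (f has_derivative (\<lambda>h. dir_deriv h f x)) (at x)"
  unfolding dir_deriv_def using frechet_derivative_works by auto

text \<open>Every closure property below is an induction that uses this rule with the explicit directional
  derivatives \<open>D\<close>.\<close>

lemma C_diff_SucI:
  assumes "\<And>x. (f has_derivative (\<lambda>h. D h x)) (at x)" "\<And>h. C_diff n (D h)"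
  shows "C_diff (Suc n) f"
proof -
  have "dir_deriv h f = D h" for h
    using dir_deriv_eqI[OF assms(1)] by auto
  then show ?thesis using assms by (auto simp: differentiable_def)
qed

lemma C_diff_SucD: "C_diff (Suc n) f \<Longrightarrow> C_diff n f"
proof (induction n arbitrary: f)
  case 0
  then show ?case
    by (simp add: continuous_on_eq_continuous_at differentiable_imp_continuous_within)
next
  case (Suc n)
  have "\<forall>x. f differentiable (at x)" "\<And>h. C_diff (Suc n) (dir_deriv h f)"
    using Suc.prems by auto
  then show ?case using Suc.IH by (subst C_diff.simps) blast
qed

lemma C_diff_mono: "m \<le> n \<Longrightarrow> C_diff n f \<Longrightarrow> C_diff m f"
  by (induction n rule: dec_induct) (auto dest: C_diff_SucD simp del: C_diff.simps)

lemma C_diff_imp_continuous: "C_diff n f \<Longrightarrow> continuous_on UNIV f"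
  using C_diff_mono[of 0 n f] by simp

lemma C_diff_const: "C_diff n (\<lambda>x. c)"
proof (induction n arbitrary: c)
  case 0 then show ?case by simp
next
  case (Suc n)
  show ?case by (rule C_diff_SucI[where D="\<lambda>_ _. 0"]) (auto intro: Suc)
qed

lemma C_diff_add:
  "C_diff n f \<Longrightarrow> C_diff n g \<Longrightarrow> C_diff n (\<lambda>x. f x + g x)"
proof (induction n arbitrary: f g)
  case 0 then show ?case by (auto intro: continuous_intros)
next
  case (Suc n)
  then have "C_diff n (\<lambda>x. dir_deriv h f x + dir_deriv h g x)" for h by simp
  then show ?case using Suc.prems
    by (intro C_diff_SucI[where D="\<lambda>h x. dir_deriv h f x + dir_deriv h g x"])
       (auto intro!: has_derivative_add dir_deriv_has_derivative)
qed

lemma C_diff_mult: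
  fixes f g :: "'a::euclidean_space \<Rightarrow> real"
  shows "C_diff n f \<Longrightarrow> C_diff n g \<Longrightarrow> C_diff n (\<lambda>x. f x * g x)"
proof (induction n arbitrary: f g)
  case 0 then show ?case by (auto intro: continuous_intros)
next
  case (Suc n)
  have "C_diff n (\<lambda>x. f x * dir_deriv h g x + dir_deriv h f x * g x)" for h
    using Suc.prems by (intro C_diff_add Suc.IH) (auto dest: C_diff_SucD simp del: C_diff.simps, auto)
  then show ?case using Suc.prems
    by (intro C_diff_SucI[where D="\<lambda>h x. f x * dir_deriv h g x + dir_deriv h f x * g x"])
       (auto intro!: has_derivative_mult dir_deriv_has_derivative)
qed

lemma C_diff_linear_comp:
  assumes L: "bounded_linear L"
  shows "C_diff n f \<Longrightarrow> C_diff n (\<lambda>x. L (f x))"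
proof (induction n arbitrary: f)
  case 0 then show ?case using L
    by (simp add: bounded_linear.continuous_on)
next
  case (Suc n)
  then show ?case
    by (intro C_diff_SucI[where D="\<lambda>h x. L (dir_deriv h f x)"])
       (auto intro!: bounded_linear.has_derivative[OF L] dir_deriv_has_derivative)
qed

lemma C_diff_comp_affine:
  fixes l :: "'a::euclidean_space \<Rightarrow> 'c::euclidean_space"
  assumes l: "bounded_linear l"
  shows "C_diff n f \<Longrightarrow> C_diff n (\<lambda>x. f (l x + c))"
proof (induction n arbitrary: f)
  case 0
  have "continuous_on UNIV (\<lambda>x. l x + c)"
    by (intro continuous_on_add linear_continuous_on l continuous_on_const)
  with 0 show ?case by (auto intro: continuous_on_compose2)
next
  case (Suc n)
  have "((\<lambda>x. f (l x + c)) has_derivative (\<lambda>h. dir_deriv (l h) f (l x + c))) (at x)" for x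
  proof -
    have "((\<lambda>x. l x + c) has_derivative l) (at x)"
      by (auto intro!: derivative_eq_intros bounded_linear_imp_has_derivative l)
    moreover have "(f has_derivative (\<lambda>h. dir_deriv h f (l x + c))) (at (l x + c))"
      using Suc.prems by (auto intro: dir_deriv_has_derivative)
    ultimately show ?thesis
      by (rule has_derivative_compose)
  qed
  then show ?case using Suc
    by (intro C_diff_SucI[where D="\<lambda>h x. dir_deriv (l h) f (l x + c)"]) auto
qed

text \<open>On the line \<open>C_diff\<close> asks for all directions \<open>h\<close>, but they only rescale the usual derivative.\<close>

lemma C_diff_real_SucI:
  fixes f :: "real \<Rightarrow> real"
  assumes "\<And>x. (f has_real_derivative f' x) (at x)" "C_diff n f'"
  shows "C_diff (Suc n) f"
proof (rule C_diff_SucI[where D="\<lambda>h x. f' x * h"])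
  show "(f has_derivative (\<lambda>h. f' x * h)) (at x)" for x
    using assms(1)[of x] by (simp add: has_field_derivative_def)
  show "C_diff n (\<lambda>x. f' x * h)" for h
    using assms(2) by (intro C_diff_mult C_diff_const)
qed

text \<open>A phase shift by \<open>\<pi>/2\<close> turns the derivative of a cosine into a cosine again, which closes the
  induction.\<close>

lemma C_diff_cos: "C_diff n (\<lambda>x::real. c * cos (k * x + d))"
proof (induction n arbitrary: c d)
  case 0 then show ?case by (auto intro!: continuous_intros)
next
  case (Suc n)
  show ?case
  proof (rule C_diff_real_SucI)
    show "((\<lambda>x. c * cos (k * x + d)) has_real_derivative (c * k) * cos (k * x + (d + pi / 2))) (at x)" for x
    proof -
      have "cos (k * x + (d + pi / 2)) = - sin (k * x + d)"
        using minus_sin_cos_eq[of "k * x + d"] by (simp add: add.assoc)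
      then show ?thesis by (auto intro!: derivative_eq_intros)
    qed
  qed (rule Suc)
qed

text \<open>The standard function \<open>exp (-1/x)\<close>, times a polynomial in \<open>1/x\<close> so that differentiation
  stays inside the family.\<close>

definition flat :: "real poly \<Rightarrow> real \<Rightarrow> real" where
  "flat p x = (if x \<le> 0 then 0 else poly p (1/x) * exp (- (1/x)))"

text \<open>At the origin the derivatives of \<open>flat\<close> vanish because \<open>exp\<close> beats every polynomial.\<close>

lemma poly_exp_tendsto_0: "((\<lambda>y. poly p y * exp (- y)) \<longlongrightarrow> (0::real)) at_top"
proof -
  have "((\<lambda>y. \<Sum>i\<le>degree p. coeff p i * (y ^ i / exp y)) \<longlongrightarrow> (\<Sum>i\<le>degree p. coeff p i * 0)) at_top"
    by (intro tendsto_intros tendsto_power_div_exp_0)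
  then show ?thesis
    by (simp add: poly_altdef sum_distrib_right exp_minus divide_inverse mult.assoc)
qed

lemma flat_tendsto_0: "((\<lambda>x. flat p x) \<longlongrightarrow> 0) (at 0)"
proof -
  have "((\<lambda>x. poly p (1/x) * exp (- (1/x))) \<longlongrightarrow> 0) (at_right 0)"
    using filterlim_compose[OF poly_exp_tendsto_0 filterlim_inverse_at_top_right]
    by (simp add: inverse_eq_divide)
  then have "((\<lambda>x. flat p x) \<longlongrightarrow> 0) (at_right 0)"
    by (rule Lim_transform_eventually) (auto simp: eventually_at_right_less flat_def eventually_at_filter)
  moreover have "((\<lambda>x. flat p x) \<longlongrightarrow> 0) (at_left 0)"
    by (rule Lim_transform_eventually[OF tendsto_const]) (auto simp: flat_def eventually_at_filter)
  ultimately show ?thesis by (simp add: filterlim_split_at)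
qed

lemma flat_has_derivative:
  "(flat p has_real_derivative flat ([:0,0,1:] * (p - pderiv p)) x) (at x)"
proof -
  consider "x < 0" | "x = 0" | "x > 0" by linarith
  then show ?thesis
  proof cases
    case 1
    have "((\<lambda>_. 0) has_real_derivative 0) (at x)" by simp
    then have "(flat p has_real_derivative 0) (at x)"
      by (rule DERIV_cong_ev[THEN iffD1, rotated 3, OF _ refl _ refl])
         (use 1 in \<open>auto simp: flat_def eventually_nhds intro!: exI[of _ "{..<0}"]\<close>)
    then show ?thesis using 1 by (simp add: flat_def)
  next
    case 2
    have "((\<lambda>h. flat (pCons 0 p) h) \<longlongrightarrow> 0) (at 0)" by (rule flat_tendsto_0)
    then have "((\<lambda>h. (flat p (0 + h) - flat p 0) / h) \<longlongrightarrow> 0) (at 0)"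
      by (rule Lim_transform_eventually) (auto simp: flat_def eventually_at_filter)
    then show ?thesis unfolding 2 DERIV_def by (simp add: flat_def)
  next
    case 3
    have "((\<lambda>x. poly p (1/x) * exp (- (1/x))) has_real_derivative
        poly ([:0,0,1:] * (p - pderiv p)) (1/x) * exp (- (1/x))) (at x)"
      using 3 by (auto intro!: derivative_eq_intros DERIV_chain2[where f="poly p"] poly_DERIV
          simp: field_simps power2_eq_square)
    then have "(flat p has_real_derivative poly ([:0,0,1:] * (p - pderiv p)) (1/x) * exp (- (1/x))) (at x)"
      by (rule DERIV_cong_ev[THEN iffD1, rotated 3, OF _ refl _ refl])
         (use 3 in \<open>auto simp: flat_def eventually_nhds intro!: exI[of _ "{0<..}"]\<close>)
    then show ?thesis using 3 by (simp add: flat_def)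
  qed
qed

lemma C_diff_flat: "C_diff n (flat p)"
proof (induction n arbitrary: p)
  case 0
  show ?case using DERIV_isCont[OF flat_has_derivative] by (simp add: continuous_at_imp_continuous_on)
next
  case (Suc n)
  show ?case by (rule C_diff_real_SucI[OF flat_has_derivative Suc])
qed

text \<open>The step is the normalised primitive of a smooth bump on \<open>[0, 1]\<close>, itself the product of two
  flat functions facing each other.\<close>

lemma smooth_step_exists:
  "\<exists>(S :: real \<Rightarrow> real) S' K. (\<forall>n. C_diff n S) \<and> (\<forall>x. (S has_real_derivative S' x) (at x)) \<and>
     (\<forall>x. 0 \<le> S x \<and> S x \<le> 1) \<and> (\<forall>x\<le>0. S x = 0) \<and> (\<forall>x\<ge>1. S x = 1) \<and> K > 0 \<and> (\<forall>x. \<bar>S' x\<bar> \<le> K)"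
proof -
  define b where "b x = flat 1 x * flat 1 (1 - x)" for x
  have smb: "C_diff n b" for n
  proof -
    have "C_diff n (\<lambda>x. flat 1 (- x + 1))"
      by (rule C_diff_comp_affine) (auto intro: C_diff_flat bounded_linear_minus bounded_linear_ident)
    then show ?thesis unfolding b_def[abs_def] using C_diff_flat
      by (intro C_diff_mult) auto
  qed
  have cb: "continuous_on A b" for A
    using C_diff_imp_continuous[OF smb] continuous_on_subset by blast
  have f01: "0 \<le> flat 1 x \<and> flat 1 x \<le> 1" for x by (auto simp: flat_def)
  have b01: "0 \<le> b x" "b x \<le> 1" for x
    unfolding b_def using f01[of x] f01[of "1-x"] by (auto intro: mult_le_one)
  have b0: "b x = 0" if "x \<le> 0 \<or> x \<ge> 1" for x using that by (auto simp: b_def flat_def)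
  define c where "c = integral {0..1} b"
  have bi: "b integrable_on {x..y}" for x y by (rule integrable_continuous_real[OF cb])
  have "c > 0"
  proof -
    have "c \<ge> 0" unfolding c_def by (rule integral_nonneg[OF bi]) (use b01 in auto)
    moreover have "c \<noteq> 0"
    proof
      assume "c = 0"
      then have "b (1/2) = 0"
        using integral_eq_0_iff[of 0 1 b] b01 cb unfolding c_def by auto
      then show False by (simp add: b_def flat_def)
    qed
    ultimately show ?thesis by simp
  qed
  define S where "S x = integral {0..x} b / c" for x
  have S0: "S x = 0" if "x \<le> 0" for x
  proof (cases "x = 0")
    case False
    then show ?thesis using that by (simp add: S_def)
  qed (simp add: S_def)
  have Sd: "(S has_real_derivative b x / c) (at x)" for x
  proof -
    \<comment> \<open>A base point to the left of both \<open>0\<close> and \<open>x\<close>, so that the primitive is differentiated inside an interval.\<close>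
    define a where "a = min x 0 - 1"
    have eq: "S y = (integral {a..y} b - integral {a..0} b) / c" if "y > a" for y
    proof (cases "y \<ge> 0")
      case True
      have "integral {a..0} b + integral {0..y} b = integral {a..y} b"
        by (rule Henstock_Kurzweil_Integration.integral_combine) (use True bi a_def in auto)
      then show ?thesis by (simp add: S_def)
    next
      case False
      have "integral {a..z} b = 0" if "z \<le> 0" for z
      proof -
        have "integral {a..z} b = integral {a..z} (\<lambda>_. 0)"
          by (rule Henstock_Kurzweil_Integration.integral_cong) (use b0 that in auto)
        then show ?thesis by simp
      qed
      then have "integral {a..y} b = 0" "integral {a..0} b = 0"
        using False by auto
      then show ?thesis using S0[of y] False by simp
    qed
    have "((\<lambda>y. integral {a..y} b) has_real_derivative b x) (at x within {a..x+1})"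
      by (rule integral_has_real_derivative[OF cb]) (auto simp: a_def)
    moreover have "at x within {a..x+1} = at x"
      by (rule at_within_Icc_at) (auto simp: a_def)
    ultimately have "((\<lambda>y. integral {a..y} b) has_real_derivative b x) (at x)"
      by simp
    from DERIV_cdivide[OF DERIV_diff[OF this DERIV_const], of "integral {a..0} b" c]
    have "((\<lambda>y. (integral {a..y} b - integral {a..0} b) / c) has_real_derivative b x / c) (at x)"
      by simp
    then show ?thesis
      by (rule DERIV_cong_ev[THEN iffD1, rotated 3, OF _ refl _ refl])
         (use eq in \<open>auto simp: eventually_nhds a_def intro!: exI[of _ "{a<..}"]\<close>)
  qed
  have smS: "C_diff n S" for n
  proof -
    have "C_diff (Suc n) S"
      by (rule C_diff_real_SucI[OF Sd])
         (use C_diff_mult[OF smb C_diff_const[of _ "1/c"]] in simp)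
    then show ?thesis by (rule C_diff_SucD)
  qed
  have S1: "S x = 1" if "x \<ge> 1" for x
  proof -
    have "integral {0..1} b + integral {1..x} b = integral {0..x} b"
      by (rule Henstock_Kurzweil_Integration.integral_combine) (use that bi in auto)
    moreover have "integral {1..x} b = integral {1..x} (\<lambda>_. 0)"
      by (rule Henstock_Kurzweil_Integration.integral_cong) (use b0 in auto)
    ultimately show ?thesis using \<open>c > 0\<close> by (simp add: S_def c_def)
  qed
  have mono: "S x \<le> S y" if "x \<le> y" for x y
    by (rule DERIV_nonneg_imp_nondecreasing[OF that]) (use Sd b01 \<open>c>0\<close> in fastforce)
  have "0 \<le> S x \<and> S x \<le> 1" for x
    using mono[of "min x 0" x] mono[of x "max x 1"] S0[of "min x 0"] S1[of "max x 1"] by auto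
  moreover have "\<bar>b x / c\<bar> \<le> 1 / c" for x
    using b01[of x] \<open>c > 0\<close> by (simp add: divide_right_mono)
  moreover have "1 / c > 0" using \<open>c>0\<close> by simp
  ultimately show ?thesis using smS Sd S0 S1
    by (intro exI[of _ S] exI[of _ "\<lambda>x. b x / c"] exI[of _ "1 / c"] conjI allI) simp_all
qed

text \<open>Cutoffs are constant on open sets, and this is how their derivatives are seen to vanish there.\<close>

lemma DERIV_zero_open:
  fixes p :: "real \<Rightarrow> real"
  assumes "open U" "x \<in> U" "\<And>y. y \<in> U \<Longrightarrow> p y = c" "(p has_real_derivative d) (at x)"
  shows "d = 0"
proof -
  have "((\<lambda>_. c) has_real_derivative d) (at x)"
    using assms(4) by (rule has_field_derivative_transform_within_open[OF _ assms(1,2)]) (use assms(3) in auto)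
  from DERIV_unique[OF this DERIV_const] show ?thesis .
qed

lemma continuous_derivative:
  fixes p :: "real \<Rightarrow> real"
  assumes "C_diff 1 p" "\<And>x. (p has_real_derivative p' x) (at x)"
  shows "continuous_on UNIV p'"
proof -
  have "dir_deriv 1 p = p'"
    using dir_deriv_eqI[OF assms(2)[unfolded has_field_derivative_def], of 1] by (simp add: fun_eq_iff)
  with assms(1) show ?thesis by auto
qed

text \<open>The constant \<open>K\<close> must not depend on \<open>a\<close> and \<open>b\<close>: the same function serves as a far cutoff, with
  a slope tending to zero, and as a cutoff near the walls, with a slope tending to infinity.\<close>

definition plateau :: "real \<Rightarrow> real \<Rightarrow> real \<Rightarrow> (real \<Rightarrow> real) \<Rightarrow> (real \<Rightarrow> real) \<Rightarrow> bool" where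
  "plateau K a b p p' \<longleftrightarrow> (\<forall>n. C_diff n p) \<and> (\<forall>x. (p has_real_derivative p' x) (at x)) \<and>
     (\<forall>x. 0 \<le> p x \<and> p x \<le> 1) \<and> (\<forall>x. \<bar>x\<bar> \<le> a \<longrightarrow> p x = 1) \<and> (\<forall>x. \<bar>x\<bar> \<ge> b \<longrightarrow> p x = 0) \<and>
     (\<forall>x. \<bar>p' x\<bar> \<le> K / (b - a))"

lemma plateauD:
  assumes "plateau K a b p p'"
  shows "C_diff n p" "(p has_real_derivative p' x) (at x)" "0 \<le> p x" "p x \<le> 1"
    "\<bar>x\<bar> \<le> a \<Longrightarrow> p x = 1" "\<bar>x\<bar> \<ge> b \<Longrightarrow> p x = 0" "\<bar>p' x\<bar> \<le> K / (b - a)"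
    "continuous_on UNIV p'" "\<bar>x\<bar> < a \<or> \<bar>x\<bar> > b \<Longrightarrow> p' x = 0"
proof -
  show p: "C_diff n p" "(p has_real_derivative p' x) (at x)" "0 \<le> p x" "p x \<le> 1"
    "\<bar>x\<bar> \<le> a \<Longrightarrow> p x = 1" "\<bar>x\<bar> \<ge> b \<Longrightarrow> p x = 0" "\<bar>p' x\<bar> \<le> K / (b - a)" for n x
    using assms unfolding plateau_def by blast+
  show "continuous_on UNIV p'" by (rule continuous_derivative[OF p(1,2)])
  assume "\<bar>x\<bar> < a \<or> \<bar>x\<bar> > b"
  then show "p' x = 0"
  proof
    assume "\<bar>x\<bar> < a"
    then have "x \<in> {-a<..<a}" by auto
    then show ?thesis
    proof (rule DERIV_zero_open[OF open_greaterThanLessThan _ _ p(2)])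
      show "p y = 1" if "y \<in> {-a<..<a}" for y using that by (intro p(5)) auto
    qed
  next
    assume "\<bar>x\<bar> > b"
    then have x: "x \<in> {x. \<bar>x\<bar> > b}" by simp
    have "open {x::real. \<bar>x\<bar> > b}" by (intro open_Collect_less continuous_intros)
    then show ?thesis
    proof (rule DERIV_zero_open[OF _ x _ p(2)])
      show "p y = 0" if "y \<in> {x. \<bar>x\<bar> > b}" for y using that by (intro p(6)) simp
    qed
  qed
qed

lemma plateau_exists: "\<exists>K>0. \<forall>a b. 0 < a \<longrightarrow> a < b \<longrightarrow> (\<exists>p p'. plateau K a b p p')"
proof -
  obtain S S' :: "real \<Rightarrow> real" and K where S: "\<And>n. C_diff n S"
    "\<And>x. (S has_real_derivative S' x) (at x)"
    "\<And>x. 0 \<le> S x" "\<And>x. S x \<le> 1" "\<And>x. x \<le> 0 \<Longrightarrow> S x = 0" "\<And>x. x \<ge> 1 \<Longrightarrow> S x = 1"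
    "K > 0" "\<And>x. \<bar>S' x\<bar> \<le> K"
    using smooth_step_exists by metis
  have *: "\<exists>p p'. plateau (2 * K) a b p p'" if ab: "0 < a" "a < b" for a b
  proof -
    define d where "d = b - a"
    have d: "d > 0" using ab by (simp add: d_def)
    define u where "u x = (b - x) / d" for x
    define w where "w x = (b + x) / d" for x
    have u': "(u has_real_derivative (- 1 / d)) (at x)" and w': "(w has_real_derivative (1 / d)) (at x)" for x
      unfolding u_def w_def using d by (auto intro!: derivative_eq_intros)
    define p where "p x = S (u x) * S (w x)" for x
    define p' where "p' x = S' (u x) * (- 1 / d) * S (w x) + S' (w x) * (1 / d) * S (u x)" for x
    have "C_diff n (\<lambda>x. S ((- 1/d) * x + b/d) * S ((1/d) * x + b/d))" for n
      by (intro C_diff_mult C_diff_comp_affine S bounded_linear_mult_right)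
    then have sm: "C_diff n p" for n unfolding p_def[abs_def] u_def w_def
      by (simp add: add_divide_distrib diff_divide_distrib add.commute)
    have D: "(p has_real_derivative p' x) (at x)" for x unfolding p_def p'_def
      by (rule DERIV_mult) (rule DERIV_chain2[OF S(2)] u' w')+
    have one: "p x = 1" if "\<bar>x\<bar> \<le> a" for x
    proof -
      have "u x \<ge> 1" "w x \<ge> 1" using that d ab by (auto simp: u_def w_def d_def field_simps)
      then show ?thesis by (simp add: p_def S)
    qed
    have zero: "p x = 0" if "\<bar>x\<bar> \<ge> b" for x
    proof -
      have "u x \<le> 0 \<or> w x \<le> 0" using that d ab by (auto simp: u_def w_def field_simps)
      then show ?thesis by (auto simp add: p_def S)
    qed
    have bnd: "\<bar>p' x\<bar> \<le> 2 * K / d" for x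
    proof -
      have "\<bar>S' (u x) * (- 1 / d) * S (w x)\<bar> \<le> K * (1/d) * 1"
        unfolding abs_mult using S d by (intro mult_mono) auto
      moreover have "\<bar>S' (w x) * (1 / d) * S (u x)\<bar> \<le> K * (1/d) * 1"
        unfolding abs_mult using S d by (intro mult_mono) auto
      ultimately show ?thesis unfolding p'_def
        by (rule order_trans[OF abs_triangle_ineq ord_le_eq_trans[OF add_mono]]) simp
    qed
    show ?thesis
      unfolding plateau_def
    proof (rule exI[of _ p], rule exI[of _ p'], intro conjI allI impI)
      show "C_diff n p" for n by (rule sm)
      show "(p has_real_derivative p' x) (at x)" for x by (rule D)
      show "0 \<le> p x" for x unfolding p_def using S(3) by simp
      show "p x \<le> 1" for x unfolding p_def using S(3,4) by (intro mult_le_one) auto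
      show "p x = 1" if "\<bar>x\<bar> \<le> a" for x using one that .
      show "p x = 0" if "\<bar>x\<bar> \<ge> b" for x using zero that .
      show "\<bar>p' x\<bar> \<le> 2 * K / (b - a)" for x using bnd unfolding d_def .
    qed
  qed
  show ?thesis
  proof (rule exI[of _ "2 * K"], intro conjI allI impI)
    show "2 * K > 0" using S(7) by simp
  qed (rule *)
qed


section \<open>One-dimensional inequalities\<close>

text \<open>The left-hand side is the integral of \<open>(g f\<^sup>2)'\<close>, and the difference of the two sides is \<open>\<integral>(f' -
  g f)\<^sup>2\<close>. A solution \<open>g\<close> of \<open>g' + g\<^sup>2 = - w\<close> thus proves that \<open>w\<close> times the mass is bounded by
  the energy.\<close>

lemma riccati_interval:
  fixes f g :: "real \<Rightarrow> real"
  assumes "a \<le> b"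
    and f: "\<And>x. x \<in> {a..b} \<Longrightarrow> (f has_real_derivative f' x) (at x within {a..b})" "continuous_on {a..b} f'"
    and g: "\<And>x. x \<in> {a..b} \<Longrightarrow> (g has_real_derivative g' x) (at x within {a..b})" "continuous_on {a..b} g'"
  shows "g b * (f b)^2 - g a * (f a)^2
    \<le> integral {a..b} (\<lambda>x. (f' x)^2) + integral {a..b} (\<lambda>x. (g' x + (g x)^2) * (f x)^2)"
proof -
  have cf: "continuous_on {a..b} f" and cg: "continuous_on {a..b} g"
    using f(1) g(1) by (blast intro: DERIV_continuous_on)+
  note cont = cf cg f(2) g(2)
  have "((\<lambda>x. g' x * (f x)^2 + 2 * g x * f x * f' x) has_integral (g b * (f b)^2 - g a * (f a)^2)) {a..b}"
  proof (rule fundamental_theorem_of_calculus[OF \<open>a \<le> b\<close>])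
    fix x assume x: "x \<in> {a..b}"
    have "((\<lambda>x. g x * (f x)^2) has_real_derivative (g' x * (f x)^2 + 2 * g x * f x * f' x)) (at x within {a..b})"
      by (rule derivative_eq_intros f(1)[OF x] g(1)[OF x] refl)+ (simp add: algebra_simps)
    then show "((\<lambda>x. g x * (f x)^2) has_vector_derivative (g' x * (f x)^2 + 2 * g x * f x * f' x)) (at x within {a..b})"
      by (simp add: has_real_derivative_iff_has_vector_derivative)
  qed
  then have "g b * (f b)^2 - g a * (f a)^2 = integral {a..b} (\<lambda>x. g' x * (f x)^2 + 2 * g x * f x * f' x)"
    by (simp add: integral_unique)
  also have "\<dots> \<le> integral {a..b} (\<lambda>x. (f' x)^2 + (g' x + (g x)^2) * (f x)^2)"
  proof (rule integral_le)
    show "(\<lambda>x. g' x * (f x)^2 + 2 * g x * f x * f' x) integrable_on {a..b}"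
      by (intro integrable_continuous_real continuous_intros cont)
    show "(\<lambda>x. (f' x)^2 + (g' x + (g x)^2) * (f x)^2) integrable_on {a..b}"
      by (intro integrable_continuous_real continuous_intros cont)
    show "g' x * (f x)^2 + 2 * g x * f x * f' x \<le> (f' x)^2 + (g' x + (g x)^2) * (f x)^2" for x
      using zero_le_power2[of "f' x - g x * f x"] by (simp add: power2_eq_square algebra_simps)
  qed
  also have "\<dots> = integral {a..b} (\<lambda>x. (f' x)^2) + integral {a..b} (\<lambda>x. (g' x + (g x)^2) * (f x)^2)"
    by (intro Henstock_Kurzweil_Integration.integral_add integrable_continuous_real continuous_intros cont)
  finally show ?thesis .
qed

text \<open>The Riccati solution for the constant weight \<open>k\<^sup>2\<close>, that is the logarithmic derivative of \<open>cos
  (k (x - c))\<close>.\<close>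

lemma tan_riccati:
  assumes "cos (k * (x - c)) \<noteq> 0"
  shows "((\<lambda>x. - k * tan (k * (x - c))) has_real_derivative - (k^2 * (1 + (tan (k * (x - c)))^2))) (at x within S)"
proof -
  have 1: "1 + (tan (k * (x - c)))^2 = inverse ((cos (k * (x - c)))^2)"
    using tan_sec[OF assms] by (simp add: power_inverse)
  show ?thesis unfolding 1
    by (rule derivative_eq_intros assms refl)+ (simp add: field_simps power2_eq_square assms)
qed

text \<open>The Riccati solution for the optimal constant blows up at both ends. It is finite for every
  smaller constant, so the inequality is obtained as a limit.\<close>

lemma poincare_dirichlet:
  fixes f :: "real \<Rightarrow> real"
  assumes "a < b"
    and f: "\<And>x. x \<in> {a..b} \<Longrightarrow> (f has_real_derivative f' x) (at x within {a..b})" "continuous_on {a..b} f'"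
    and z: "f a = 0" "f b = 0"
  shows "(pi / (b - a))^2 * integral {a..b} (\<lambda>x. (f x)^2) \<le> integral {a..b} (\<lambda>x. (f' x)^2)"
proof -
  define I where "I = integral {a..b} (\<lambda>x. (f x)^2)"
  have *: "k^2 * I \<le> integral {a..b} (\<lambda>x. (f' x)^2)" if k: "0 < k" "k < pi / (b - a)" for k
  proof -
    define c where "c = (a + b) / 2"
    have cos: "cos (k * (x - c)) \<noteq> 0" if "x \<in> {a..b}" for x
    proof -
      have "\<bar>x - c\<bar> \<le> (b - a) / 2" using that by (auto simp: c_def abs_if field_simps)
      then have "\<bar>k * (x - c)\<bar> \<le> k * ((b - a) / 2)" using k by (simp add: abs_mult)
      also have "\<dots> < pi / 2" using k \<open>a < b\<close> by (simp add: field_simps)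
      finally have "cos (k * (x - c)) > 0" by (intro cos_gt_zero_pi) auto
      then show ?thesis by simp
    qed
    \<comment> \<open>\<open>\<bar>x - c\<bar> \<le> (b - a) / 2\<close> keeps the argument of the tangent inside its period.\<close>
    have "- k * tan (k * (b - c)) * (f b)^2 - - k * tan (k * (a - c)) * (f a)^2
      \<le> integral {a..b} (\<lambda>x. (f' x)^2)
       + integral {a..b} (\<lambda>x. (- (k^2 * (1 + (tan (k * (x - c)))^2)) + (- k * tan (k * (x - c)))^2) * (f x)^2)"
    proof (rule riccati_interval)
      show "((\<lambda>x. - k * tan (k * (x - c))) has_real_derivative - (k^2 * (1 + (tan (k * (x - c)))^2))) (at x within {a..b})"
        if "x \<in> {a..b}" for x using cos[OF that] by (rule tan_riccati)
      show "continuous_on {a..b} (\<lambda>x. - (k^2 * (1 + (tan (k * (x - c)))^2)))"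
        using cos by (intro continuous_intros) auto
    qed (use \<open>a < b\<close> f in auto)
    moreover have "(\<lambda>x. (- (k^2 * (1 + (tan (k * (x - c)))^2)) + (- k * tan (k * (x - c)))^2) * (f x)^2) = (\<lambda>x. - (k^2) * (f x)^2)"
      by (auto simp: power_mult_distrib algebra_simps)
    moreover have "integral {a..b} (\<lambda>x. - (k^2) * (f x)^2) = - (k^2) * I"
      unfolding I_def by (rule integral_mult_right)
    ultimately show ?thesis using z by (simp add: I_def[symmetric])
  qed
  define K where "K = pi / (b - a)"
  have K: "K > 0" using \<open>a < b\<close> by (simp add: K_def)
  have "((\<lambda>k. k^2 * I) \<longlongrightarrow> K^2 * I) (at_left K)" by (intro tendsto_intros)
  moreover have "eventually (\<lambda>k. k^2 * I \<le> integral {a..b} (\<lambda>x. (f' x)^2)) (at_left K)"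
    using eventually_at_left_real[OF K] by eventually_elim (use * K_def in auto)
  ultimately show ?thesis unfolding I_def[symmetric] K_def[symmetric]
    by (rule tendsto_upperbound) simp
qed

text \<open>Duality reduces this to the Dirichlet case: the primitive \<open>F\<close> of \<open>f - m\<close> vanishes at both ends,
  and expanding \<open>\<integral>(f' + l F)\<^sup>2 \<ge> 0\<close> after an integration by parts gives the same constant \<open>l\<close>.\<close>

lemma poincare_neumann:
  fixes f :: "real \<Rightarrow> real"
  assumes "a < b"
    and f: "\<And>x. x \<in> {a..b} \<Longrightarrow> (f has_real_derivative f' x) (at x within {a..b})" "continuous_on {a..b} f'"
    and m: "integral {a..b} f = m * (b - a)"
  shows "(pi / (b - a))^2 * integral {a..b} (\<lambda>x. (f x - m)^2) \<le> integral {a..b} (\<lambda>x. (f' x)^2)"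
proof -
  define l where "l = (pi / (b - a))^2"
  define F where "F x = integral {a..x} (\<lambda>t. f t - m)" for x
  have cf: "continuous_on {a..b} f"
    using f(1) by (rule DERIV_continuous_on)
  have fm: "continuous_on {a..b} (\<lambda>t. f t - m)" by (intro continuous_intros cf)
  have F': "(F has_real_derivative f x - m) (at x within {a..b})" if "x \<in> {a..b}" for x
    unfolding F_def by (rule integral_has_real_derivative[OF fm that])
  have cF: "continuous_on {a..b} F"
    using F' by (rule DERIV_continuous_on)
  note cont = cf f(2) cF
  have Fa: "F a = 0" by (simp add: F_def)
  have "F b = integral {a..b} f - integral {a..b} (\<lambda>t. m)"
    unfolding F_def by (intro Henstock_Kurzweil_Integration.integral_diff integrable_continuous_real cont continuous_on_const)
  then have Fb: "F b = 0" using m \<open>a < b\<close> by simp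
  define V where "V = integral {a..b} (\<lambda>x. (f x - m)^2)"
  have D: "l * integral {a..b} (\<lambda>x. (F x)^2) \<le> V"
    unfolding l_def V_def by (rule poincare_dirichlet[OF \<open>a < b\<close> F' fm Fa Fb])
  have "((\<lambda>x. f' x * F x + (f x - m)^2) has_integral ((f b - m) * F b - (f a - m) * F a)) {a..b}"
  proof (rule fundamental_theorem_of_calculus)
    fix x assume x: "x \<in> {a..b}"
    have "((\<lambda>x. (f x - m) * F x) has_real_derivative (f' x * F x + (f x - m)^2)) (at x within {a..b})"
      by (rule derivative_eq_intros f(1)[OF x] F'[OF x] refl)+ (simp add: algebra_simps power2_eq_square)
    then show "((\<lambda>x. (f x - m) * F x) has_vector_derivative (f' x * F x + (f x - m)^2)) (at x within {a..b})"
      by (simp add: has_real_derivative_iff_has_vector_derivative)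
  qed (use \<open>a < b\<close> in simp)
  then have "integral {a..b} (\<lambda>x. f' x * F x + (f x - m)^2) = 0"
    using Fa Fb by (simp add: integral_unique)
  moreover have "integral {a..b} (\<lambda>x. f' x * F x + (f x - m)^2) = integral {a..b} (\<lambda>x. f' x * F x) + V"
    unfolding V_def by (intro Henstock_Kurzweil_Integration.integral_add integrable_continuous_real continuous_intros cont)
  ultimately have ibp: "integral {a..b} (\<lambda>x. f' x * F x) = - V" by simp
  have "0 \<le> integral {a..b} (\<lambda>x. (f' x + l * F x)^2)"
    by (intro integral_nonneg integrable_continuous_real continuous_intros cont) auto
  also have "(\<lambda>x. (f' x + l * F x)^2) = (\<lambda>x. ((f' x)^2 + (2 * l) * (f' x * F x)) + l^2 * (F x)^2)"
    by (auto simp: power2_eq_square algebra_simps)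
  also have "integral {a..b} \<dots> = integral {a..b} (\<lambda>x. (f' x)^2) + (2 * l) * integral {a..b} (\<lambda>x. f' x * F x)
       + l^2 * integral {a..b} (\<lambda>x. (F x)^2)"
    by (subst Henstock_Kurzweil_Integration.integral_add integral_mult_right,
      (intro integrable_continuous_real continuous_intros cont)+)+ simp
  finally have "2 * l * V \<le> integral {a..b} (\<lambda>x. (f' x)^2) + l * (l * integral {a..b} (\<lambda>x. (F x)^2))"
    using ibp by (simp add: power2_eq_square algebra_simps)
  moreover have "l * (l * integral {a..b} (\<lambda>x. (F x)^2)) \<le> l * V"
    using D by (intro mult_left_mono) (auto simp: l_def)
  ultimately show ?thesis unfolding V_def[symmetric] l_def[symmetric] by linarith
qed

lemma integrable_continuous_compact_support:
  fixes h :: "'a::euclidean_space \<Rightarrow> real"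
  assumes "continuous_on UNIV h" "\<And>x. norm x > M \<Longrightarrow> h x = 0"
  shows "integrable lborel h"
proof -
  have "integrable lborel (\<lambda>x. indicator (cball 0 M) x *\<^sub>R h x)"
    by (rule borel_integrable_compact) (auto intro: continuous_on_subset[OF assms(1)])
  also have "(\<lambda>x. indicator (cball 0 M) x *\<^sub>R h x) = h"
    using assms(2) by (fastforce simp: indicator_def not_le)
  finally show ?thesis .
qed

lemma integrable_mult_bounded:
  fixes h w :: "'a \<Rightarrow> real"
  assumes h: "integrable M h" and w: "w \<in> borel_measurable M" "\<And>x. \<bar>w x\<bar> \<le> C"
  shows "integrable M (\<lambda>x. w x * h x)"
proof (rule Bochner_Integration.integrable_bound)
  show "integrable M (\<lambda>x. C * h x)" using h by simp
  show "(\<lambda>x. w x * h x) \<in> borel_measurable M" using h w by simp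
  show "AE x in M. norm (w x * h x) \<le> norm (C * h x)"
  proof (rule AE_I2)
    fix x
    have "\<bar>w x\<bar> \<le> \<bar>C\<bar>" using w(2)[of x] by linarith
    then show "norm (w x * h x) \<le> norm (C * h x)" by (simp add: abs_mult mult_right_mono)
  qed
qed

lemma integrable_lborel_Icc:
  fixes h :: "real \<Rightarrow> real"
  assumes "integrable lborel h" shows "h integrable_on {a..b}"
  using integrable_on_lborel[OF assms] integrable_on_subinterval by blast

text \<open>All weights on a line are even, so it suffices to compare integrals over a half line for a
  function and for its reflection.\<close>

lemma lborel_integral_halves:
  fixes h :: "real \<Rightarrow> real"
  assumes h: "integrable lborel h" and M: "0 \<le> M" "\<And>x. \<bar>x\<bar> > M \<Longrightarrow> h x = 0"
  shows "(LBINT x. h x) = integral {0..M} h + integral {0..M} (\<lambda>x. h (- x))"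
proof -
  have "(LBINT x. h x) = integral UNIV h" using integral_lborel[OF h] by simp
  also have "\<dots> = integral {-M..M} h"
  proof (rule integral_spike_set)
    have "{x \<in> UNIV - {- M..M}. h x \<noteq> 0} = {}" using M(2) by (force simp: not_le)
    then show "negligible {x \<in> UNIV - {- M..M}. h x \<noteq> 0}" by (simp only: negligible_empty)
  qed simp
  also have "\<dots> = integral {-M..0} h + integral {0..M} h"
    by (rule Henstock_Kurzweil_Integration.integral_combine[symmetric]) (use M integrable_lborel_Icc[OF h] in auto)
  also have "integral {-M..0} h = integral {0..M} (\<lambda>x. h (- x))"
    using Henstock_Kurzweil_Integration.integral_reflect_real[where f="h" and a="-M" and b=0] by simp
  finally show ?thesis by simp
qed

lemma lborel_integral_halves_mono:
  fixes h k :: "real \<Rightarrow> real"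
  assumes h: "integrable lborel h" "\<And>x. \<bar>x\<bar> > M \<Longrightarrow> h x = 0"
    and k: "integrable lborel k" "\<And>x. \<bar>x\<bar> > M \<Longrightarrow> k x = 0" and "0 \<le> M"
    and "integral {0..M} h \<le> integral {0..M} k"
    and "integral {0..M} (\<lambda>x. h (- x)) \<le> integral {0..M} (\<lambda>x. k (- x))"
  shows "(LBINT x. h x) \<le> (LBINT x. k x)"
  using lborel_integral_halves[of h M] lborel_integral_halves[of k M] assms by simp

text \<open>Two Riccati solutions, \<open>gi\<close> inside the cube and \<open>go\<close> in the arm, may be joined with a downward
  jump; \<open>gi 0 = 0\<close> removes the boundary term in the middle of the cube.\<close>

lemma half_line_riccati:
  fixes f gi go w :: "real \<Rightarrow> real"
  assumes M: "c < M" "0 < c"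
    and f: "\<And>x. (f has_real_derivative f' x) (at x)" "continuous_on UNIV f'" "f M = 0"
    and gi: "\<And>x. x \<in> {0..c} \<Longrightarrow> (gi has_real_derivative gi' x) (at x)" "continuous_on {0..c} gi'" "gi 0 = 0"
    and go: "\<And>x. x \<in> {c..M} \<Longrightarrow> (go has_real_derivative go' x) (at x)" "continuous_on {c..M} go'"
    and jump: "go c \<le> gi c"
    and w: "\<And>x. 0 \<le> x \<Longrightarrow> x < c \<Longrightarrow> w x \<le> - (gi' x + (gi x)^2)"
       "\<And>x. c \<le> x \<Longrightarrow> w x \<le> - (go' x + (go x)^2)"
    and int: "(\<lambda>x. w x * (f x)^2) integrable_on {0..M}"
  shows "integral {0..M} (\<lambda>x. w x * (f x)^2) \<le> integral {0..M} (\<lambda>x. (f' x)^2)"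
proof -
  have f': "(f has_real_derivative f' x) (at x within S)" for x S
    using f(1) by (rule has_field_derivative_at_within)
  have cf: "continuous_on S f" for S
    using f(1) by (intro continuous_at_imp_continuous_on ballI DERIV_isCont)
  have cf': "continuous_on S f'" for S using f(2) by (rule continuous_on_subset) simp
  have cgi: "continuous_on {0..c} gi" using gi(1) by (intro continuous_at_imp_continuous_on ballI DERIV_isCont)
  have cgo: "continuous_on {c..M} go" using go(1) by (intro continuous_at_imp_continuous_on ballI DERIV_isCont)
  have sub: "(\<lambda>x. w x * (f x)^2) integrable_on {a..b}" if "{a..b} \<subseteq> {0..M}" for a b
    using integrable_on_subinterval[OF int that] .
  have sq: "(\<lambda>x. (f' x)^2) integrable_on {a..b}" for a b
    by (intro integrable_continuous_real continuous_intros cf')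
  have neg: "integral {a..b} (\<lambda>x. - (g' x + (g x)^2) * (f x)^2) = - integral {a..b} (\<lambda>x. (g' x + (g x)^2) * (f x)^2)"
    for a b :: real and g g' :: "real \<Rightarrow> real"
    by (simp only: mult_minus_left integral_neg)
  have "gi c * (f c)^2 - gi 0 * (f 0)^2
    \<le> integral {0..c} (\<lambda>x. (f' x)^2) + integral {0..c} (\<lambda>x. (gi' x + (gi x)^2) * (f x)^2)"
    by (rule riccati_interval) (use M f' cf' gi in \<open>auto intro: has_field_derivative_at_within\<close>)
  moreover have "go M * (f M)^2 - go c * (f c)^2
    \<le> integral {c..M} (\<lambda>x. (f' x)^2) + integral {c..M} (\<lambda>x. (go' x + (go x)^2) * (f x)^2)"
    by (rule riccati_interval) (use M f' cf' go in \<open>auto intro: has_field_derivative_at_within\<close>)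
  moreover have "integral {c..M} (\<lambda>x. w x * (f x)^2) \<le> integral {c..M} (\<lambda>x. - (go' x + (go x)^2) * (f x)^2)"
  proof (rule integral_le)
    show "(\<lambda>x. w x * (f x)^2) integrable_on {c..M}" by (rule sub) (use M in auto)
    show "(\<lambda>x. - (go' x + (go x)^2) * (f x)^2) integrable_on {c..M}"
      by (intro integrable_continuous_real continuous_intros go cgo cf)
    show "w x * (f x)^2 \<le> - (go' x + (go x)^2) * (f x)^2" if "x \<in> {c..M}" for x
      using that w(2) by (intro mult_right_mono) auto
  qed
  moreover have "integral {0..c} (\<lambda>x. w x * (f x)^2) \<le> integral {0..c} (\<lambda>x. - (gi' x + (gi x)^2) * (f x)^2)"
  proof -
    have "integral {0..c} (\<lambda>x. w x * (f x)^2) = integral {0..c} (\<lambda>x. (if x = c then - (gi' x + (gi x)^2) else w x) * (f x)^2)"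
      by (rule integral_spike[of "{c}"]) auto
    also have "\<dots> \<le> integral {0..c} (\<lambda>x. - (gi' x + (gi x)^2) * (f x)^2)"
    proof (rule integral_le)
      show "(\<lambda>x. (if x = c then - (gi' x + (gi x)^2) else w x) * (f x)^2) integrable_on {0..c}"
        by (rule integrable_spike[OF sub, of _ _ "{c}"]) (use M in auto)
      show "(\<lambda>x. - (gi' x + (gi x)^2) * (f x)^2) integrable_on {0..c}"
        by (intro integrable_continuous_real continuous_intros gi cgi cf)
      show "(if x = c then - (gi' x + (gi x)^2) else w x) * (f x)^2 \<le> - (gi' x + (gi x)^2) * (f x)^2"
        if "x \<in> {0..c}" for x using that w by (intro mult_right_mono) auto
    qed
    finally show ?thesis .
  qed
  moreover have "integral {0..c} (\<lambda>x. w x * (f x)^2) + integral {c..M} (\<lambda>x. w x * (f x)^2) = integral {0..M} (\<lambda>x. w x * (f x)^2)"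
    by (rule Henstock_Kurzweil_Integration.integral_combine) (use M int in auto)
  moreover have "integral {0..c} (\<lambda>x. (f' x)^2) + integral {c..M} (\<lambda>x. (f' x)^2) = integral {0..M} (\<lambda>x. (f' x)^2)"
    by (rule Henstock_Kurzweil_Integration.integral_combine) (use M sq in auto)
  moreover have "go c * (f c)^2 \<le> gi c * (f c)^2" using jump by (rule mult_right_mono) simp
  ultimately show ?thesis unfolding neg f(3) gi(3) by simp
qed


text \<open>The restrictions of trial functions to lines parallel to the axes. The bound \<open>1 < M\<close> puts the end
  of the support beyond the face of the cube at \<open>1/2\<close>.\<close>

definition line_fun :: "(real \<Rightarrow> real) \<Rightarrow> (real \<Rightarrow> real) \<Rightarrow> real \<Rightarrow> bool" where
  "line_fun f f' M \<longleftrightarrow> 1 < M \<and> (\<forall>x. (f has_real_derivative f' x) (at x)) \<and> continuous_on UNIV f' \<and>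
     (\<forall>x. \<bar>x\<bar> \<ge> M \<longrightarrow> f x = 0 \<and> f' x = 0)"

lemma line_funD:
  assumes "line_fun f f' M"
  shows "1 < M" "(f has_real_derivative f' x) (at x within S)" "continuous_on S f'" "continuous_on S f"
    "\<bar>x\<bar> \<ge> M \<Longrightarrow> f x = 0" "\<bar>x\<bar> \<ge> M \<Longrightarrow> f' x = 0"
proof -
  show "(f has_real_derivative f' x) (at x within S)"
    using assms by (auto simp: line_fun_def intro: has_field_derivative_at_within)
  show "continuous_on S f'"
    using assms by (auto simp: line_fun_def intro: continuous_on_subset)
  show "continuous_on S f"
    using assms by (intro continuous_at_imp_continuous_on ballI DERIV_isCont) (auto simp: line_fun_def)
qed (use assms in \<open>auto simp: line_fun_def\<close>)

lemma line_fun_reflect: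
  assumes "line_fun f f' M" shows "line_fun (\<lambda>x. f (- x)) (\<lambda>x. - f' (- x)) M"
  unfolding line_fun_def
proof (intro conjI allI impI)
  show "((\<lambda>x. f (- x)) has_real_derivative - f' (- x)) (at x)" for x
  proof -
    have "((\<lambda>x. f (- x)) has_real_derivative f' (- x) * - 1) (at x)"
      by (rule DERIV_chain2[OF line_funD(2)[OF assms]]) (auto intro!: derivative_eq_intros)
    then show ?thesis by simp
  qed
  show "continuous_on UNIV (\<lambda>x. - f' (- x))"
    by (intro continuous_on_minus continuous_on_compose2[OF line_funD(3)[OF assms, of UNIV]] continuous_on_id) auto
qed (use assms in \<open>auto simp: line_fun_def\<close>)

lemma line_fun_integrable:
  assumes "line_fun f f' M"
  shows "integrable lborel (\<lambda>x. (f x)^2)" "integrable lborel (\<lambda>x. (f' x)^2)"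
  by (rule integrable_continuous_compact_support[where M=M];
      use line_funD[OF assms] in \<open>auto intro!: continuous_intros\<close>)+

lemma integral_line_Icc:
  fixes h :: "real \<Rightarrow> real"
  assumes "continuous_on UNIV h" "0 \<le> c" "c \<le> M" "\<And>x. c < x \<Longrightarrow> h x = 0"
  shows "integral {0..M} h = integral {0..c} h"
proof -
  have "integral {0..c} h + integral {c..M} h = integral {0..M} h"
    by (rule Henstock_Kurzweil_Integration.integral_combine)
      (use assms in \<open>auto intro!: integrable_continuous_real intro: continuous_on_subset\<close>)
  moreover have "integral {c..M} h = integral {c..M} (\<lambda>_. 0)"
    by (rule integral_spike[of "{c}"]) (use assms in auto)
  ultimately show ?thesis by simp
qed

lemma integral_half_indicator:
  fixes h :: "real \<Rightarrow> real"
  assumes "continuous_on UNIV h" "1/2 < M"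
  shows "integral {0..M} (\<lambda>x. (if \<bar>x\<bar> < 1/2 then 1 else 0) * h x) = integral {0..1/2} h"
proof -
  have c: "continuous_on S h" for S by (rule continuous_on_subset[OF assms(1)]) simp
  have 1: "(h has_integral integral {0..1/2} h) {0..1/2}"
    using integrable_continuous_real[OF c] by (rule integrable_integral)
  have "((\<lambda>x. (if \<bar>x\<bar> < 1/2 then 1 else 0) * h x) has_integral integral {0..1/2} h) {0..1/2}"
    by (rule has_integral_spike[OF _ _ 1, of "{1/2}"]) auto
  moreover have "((\<lambda>x. (if \<bar>x\<bar> < 1/2 then 1 else 0) * h x) has_integral 0) {1/2..M}"
    by (rule has_integral_is_0) auto
  ultimately have "((\<lambda>x. (if \<bar>x\<bar> < 1/2 then 1 else 0) * h x) has_integral (integral {0..1/2} h + 0)) {0..M}"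
    by (rule has_integral_combine[rotated 2]) (use assms in auto)
  then show ?thesis by (simp add: integral_unique)
qed

lemma lborel_integral_half_interval:
  fixes h :: "real \<Rightarrow> real"
  assumes "continuous_on UNIV h"
  shows "(LBINT x. (if \<bar>x\<bar> < 1/2 then 1 else 0) * h x) = integral {-1/2..1/2} h"
proof -
  have c: "continuous_on S h" for S by (rule continuous_on_subset[OF assms(1)]) simp
  have 1: "integrable lborel (\<lambda>x. (if \<bar>x\<bar> < 1/2 then 1 else 0) * (indicator {-1/2..1/2} x *\<^sub>R h x))"
    by (rule integrable_mult_bounded[OF borel_integrable_compact, where C=1]) (use c in auto)
  have "integrable lborel (\<lambda>x. (if \<bar>x\<bar> < 1/2 then 1 else 0) * h x)"
    using 1 by (rule back_subst[of "integrable lborel"]) (auto simp: indicator_def abs_if)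
  note int = has_integral_integral_lborel[OF this]
  have s: "(h has_integral integral {-1/2..1/2} h) {-1/2..1/2}"
    by (intro integrable_integral integrable_continuous_real c)
  have "((\<lambda>x. (if \<bar>x\<bar> < 1/2 then 1 else 0) * h x) has_integral integral {-1/2..1/2} h) {-1/2..1/2}"
    by (rule has_integral_spike[OF _ _ s, of "{-1/2, 1/2}"]) (auto simp: abs_if)
  then have "((\<lambda>x. (if \<bar>x\<bar> < 1/2 then 1 else 0) * h x) has_integral integral {-1/2..1/2} h) UNIV"
    by (rule has_integral_on_superset) (auto simp: abs_if)
  from has_integral_unique[OF int this] show ?thesis .
qed

lemma integral_Icc_le_lborel:
  fixes h :: "real \<Rightarrow> real"
  assumes "integrable lborel h" "\<And>x. h x \<ge> 0"
  shows "integral {a..b} h \<le> (LBINT x. h x)"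
  unfolding integral_lborel[OF assms(1), symmetric]
  by (rule integral_subset_le) (use assms integrable_lborel_Icc[OF assms(1)] integrable_on_lborel in auto)

lemma line_dirichlet:
  assumes f: "line_fun f f' M" and z: "\<And>x. \<bar>x\<bar> \<ge> 1/2 \<Longrightarrow> f x = 0"
  shows "pi^2 * (LBINT x. (f x)^2) \<le> (LBINT x. (f' x)^2)"
proof -
  note fD = line_funD[OF f]
  have "(\<lambda>x. (if \<bar>x\<bar> < 1/2 then 1 else 0) * (f x)^2) = (\<lambda>x. (f x)^2)" using z by (auto simp: fun_eq_iff)
  then have "(LBINT x. (f x)^2) = integral {-1/2..1/2} (\<lambda>x. (f x)^2)"
    using lborel_integral_half_interval[of "\<lambda>x. (f x)^2"] fD(4)[of UNIV] by (simp add: continuous_intros)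
  moreover have "(pi / (1/2 - (-1/2)))^2 * integral {-1/2..1/2} (\<lambda>x. (f x)^2) \<le> integral {-1/2..1/2} (\<lambda>x. (f' x)^2)"
    by (rule poincare_dirichlet) (use fD z in auto)
  moreover have "integral {-1/2..1/2} (\<lambda>x. (f' x)^2) \<le> (LBINT x. (f' x)^2)"
    by (rule integral_Icc_le_lborel) (use line_fun_integrable[OF f] in auto)
  ultimately show ?thesis by simp
qed

text \<open>An odd function vanishes at the midpoint as well, which halves the interval and quadruples the
  constant.\<close>

lemma line_dirichlet_odd:
  assumes f: "line_fun f f' M" and z: "\<And>x. \<bar>x\<bar> \<ge> 1/2 \<Longrightarrow> f x = 0" and odd: "\<And>x. f (- x) = - f x"
  shows "4 * pi^2 * (LBINT x. (f x)^2) \<le> (LBINT x. (f' x)^2)"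
proof -
  have half: "4 * pi^2 * integral {0..M} (\<lambda>x. (f x)^2) \<le> integral {0..M} (\<lambda>x. (f' x)^2)"
    if f: "line_fun f f' M" and z: "\<And>x. \<bar>x\<bar> \<ge> 1/2 \<Longrightarrow> f x = 0" and odd: "\<And>x. f (- x) = - f x" for f f'
  proof -
    note fD = line_funD[OF f]
    have "integral {0..M} (\<lambda>x. (f x)^2) = integral {0..1/2} (\<lambda>x. (f x)^2)"
      by (rule integral_line_Icc) (use fD z in \<open>auto intro!: continuous_intros\<close>)
    moreover have "(pi / (1/2 - 0))^2 * integral {0..1/2} (\<lambda>x. (f x)^2) \<le> integral {0..1/2} (\<lambda>x. (f' x)^2)"
      by (rule poincare_dirichlet) (use fD z odd[of 0] in auto)
    moreover have "\<dots> \<le> integral {0..M} (\<lambda>x. (f' x)^2)"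
      by (rule integral_subset_le) (use fD in \<open>auto intro!: integrable_continuous_real continuous_intros\<close>)
    ultimately show ?thesis by (simp add: power_mult_distrib)
  qed
  have "(LBINT x. 4 * pi^2 * (f x)^2) \<le> (LBINT x. (f' x)^2)"
  proof (rule lborel_integral_halves_mono[where M=M])
    show "integral {0..M} (\<lambda>x. 4 * pi^2 * (f x)^2) \<le> integral {0..M} (\<lambda>x. (f' x)^2)"
      using half[OF f z odd] by (simp add: integral_mult_right)
    show "integral {0..M} (\<lambda>x. 4 * pi^2 * (f (- x))^2) \<le> integral {0..M} (\<lambda>x. (f' (- x))^2)"
      using half[OF line_fun_reflect[OF f]] z odd by (simp add: integral_mult_right)
  qed (use line_fun_integrable[OF f] line_funD[OF f] in auto)
  then show ?thesis by simp
qed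

lemma line_riccati:
  assumes f: "line_fun f f' M"
    and gi: "\<And>x. x \<in> {0..1/2} \<Longrightarrow> (gi has_real_derivative gi' x) (at x)" "continuous_on {0..1/2} gi'" "gi 0 = 0"
    and go: "\<And>x. x \<ge> 1/2 \<Longrightarrow> (go has_real_derivative go' x) (at x)" "continuous_on {1/2..} go'"
    and jump: "go (1/2) \<le> gi (1/2)"
    and w: "\<And>x. 0 \<le> x \<Longrightarrow> x < 1/2 \<Longrightarrow> w x \<le> - (gi' x + (gi x)^2)"
       "\<And>x. 1/2 \<le> x \<Longrightarrow> w x \<le> - (go' x + (go x)^2)"
    and ww: "\<And>x. w (- x) = w x" "w \<in> borel_measurable borel" "\<And>x. \<bar>w x\<bar> \<le> C"
  shows "(LBINT x. w x * (f x)^2) \<le> (LBINT x. (f' x)^2)"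
proof -
  have int: "integrable lborel (\<lambda>x. w x * (f x)^2)" if "line_fun f f' M" for f f'
    by (rule integrable_mult_bounded[OF line_fun_integrable(1)[OF that]]) (use ww in auto)
  have half: "integral {0..M} (\<lambda>x. w x * (f x)^2) \<le> integral {0..M} (\<lambda>x. (f' x)^2)" if f: "line_fun f f' M" for f f'
  proof (rule half_line_riccati[of "1/2" M f f' gi gi' go go' w])
    show "continuous_on {1/2..M} go'" by (rule continuous_on_subset[OF go(2)]) auto
    show "(\<lambda>x. w x * (f x)^2) integrable_on {0..M}" by (rule integrable_lborel_Icc[OF int[OF f]])
  qed (use line_funD[OF f] gi go jump w in auto)
  show ?thesis
  proof (rule lborel_integral_halves_mono[where M=M])
    show "integral {0..M} (\<lambda>x. w (- x) * (f (- x))^2) \<le> integral {0..M} (\<lambda>x. (f' (- x))^2)"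
      using half[OF line_fun_reflect[OF f]] by (simp add: ww)
  qed (use half[OF f] line_fun_integrable[OF f] line_funD[OF f] int[OF f] in auto)
qed

text \<open>The outer Riccati solution is \<open>1 / (2 (x + 1/2))\<close>, the one for Hardy's inequality with
  singularity at \<open>- 1/2\<close>; the inner solution \<open>x\<close> interpolates, at the cost of a negative
  constant weight in the cube.\<close>

lemma line_hardy:
  assumes f: "line_fun f f' M"
  shows "(LBINT x. (if \<bar>x\<bar> < 1/2 then - 5/4 else 1 / (4 * (\<bar>x\<bar> + 1/2)^2)) * (f x)^2) \<le> (LBINT x. (f' x)^2)"
proof (rule line_riccati[OF f, where gi="\<lambda>x. x" and gi'="\<lambda>_. 1" and go="\<lambda>x. 1 / (2 * x + 1)"
      and go'="\<lambda>x. - 2 / (2 * x + 1)^2" and C="5/4"])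
  show "((\<lambda>x. 1 / (2 * x + 1)) has_real_derivative - 2 / (2 * x + 1)^2) (at x)" if "1/2 \<le> x" for x :: real
    using that by (auto intro!: derivative_eq_intros simp: power2_eq_square)
  show "continuous_on {1/2..} (\<lambda>x::real. - 2 / (2 * x + 1)^2)"
    by (intro continuous_intros) auto
  show "(if \<bar>x\<bar> < 1/2 then - 5/4 else 1 / (4 * (\<bar>x\<bar> + 1/2)^2)) \<le> - (1 + x^2)" if "0 \<le> x" "x < 1/2" for x :: real
  proof -
    have "x^2 \<le> (1/2)^2" using that by (intro power_mono) auto
    then show ?thesis using that by (simp add: power2_eq_square)
  qed
  show "(if \<bar>x\<bar> < 1/2 then - 5/4 else 1 / (4 * (\<bar>x\<bar> + 1/2)^2)) \<le> - (- 2 / (2 * x + 1)^2 + (1 / (2 * x + 1))^2)"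
    if "1/2 \<le> x" for x :: real
  proof -
    have "4 * (\<bar>x\<bar> + 1/2)^2 = (2 * x + 1)^2" using that by (simp add: power2_eq_square algebra_simps)
    then show ?thesis using that by (simp add: power_divide)
  qed
  show "(\<lambda>x::real. if \<bar>x\<bar> < 1/2 then - 5/4 else 1 / (4 * (\<bar>x\<bar> + 1/2)^2)) \<in> borel_measurable borel" by measurable
  show "\<bar>if \<bar>x\<bar> < 1/2 then - 5/4 else 1 / (4 * (\<bar>x\<bar> + 1/2)^2)\<bar> \<le> 5/4" for x :: real
  proof (cases "\<bar>x\<bar> < 1/2")
    case False
    then have "1^2 \<le> (\<bar>x\<bar> + 1/2)^2" by (intro power_mono) auto
    then show ?thesis using False by (simp add: field_simps)
  qed simp
qed (auto intro!: derivative_eq_intros)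

text \<open>A value of the tangent that is accurate enough to compare the Robin problem in \<open>line_robin\<close> with
  \<open>\<pi>\<^sup>2/2\<close>.\<close>

lemma tan_3pi_8: "tan (3 * pi / 8) = 1 + sqrt 2"
proof -
  have c: "cos (3 * pi / 8) > 0" by (intro cos_gt_zero_pi) auto
  have s: "sin (3 * pi / 8) > 0" by (intro sin_gt_zero) auto
  define t where "t = tan (3 * pi / 8)"
  have t: "t > 0" unfolding t_def tan_def using c s by simp
  have "cos (2 * (3 * pi / 8)) = - (sqrt 2 / 2)" "sin (2 * (3 * pi / 8)) = sqrt 2 / 2"
    using cos_pi_minus[of "pi/4"] sin_pi_minus[of "pi/4"] by (simp_all add: cos_45 sin_45 field_simps)
  then have "(cos (3 * pi / 8))^2 - (sin (3 * pi / 8))^2 = - (2 * sin (3 * pi / 8) * cos (3 * pi / 8))"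
    unfolding cos_double sin_double by simp
  then have "((cos (3 * pi / 8))^2 - (sin (3 * pi / 8))^2) / (cos (3 * pi / 8))^2 = - (2 * sin (3 * pi / 8) * cos (3 * pi / 8)) / (cos (3 * pi / 8))^2"
    by simp
  then have "1 - t^2 = - (2 * t)"
    using c by (simp add: t_def tan_def power2_eq_square field_simps)
  then have "(t - 1)^2 = 2" by (simp add: power2_eq_square algebra_simps)
  then have "\<bar>t - 1\<bar> = sqrt 2" by (metis real_sqrt_abs)
  moreover have "sqrt 2 > 1" by simp
  ultimately show ?thesis unfolding t_def[symmetric] using t by linarith
qed

text \<open>Outside, the constant Riccati solution \<open>- \<surd>3 \<pi>\<close> uses the surplus \<open>3\<pi>\<^sup>2\<close> of the arms. Inside, \<open>-
  k tan (k x)\<close> may be used as long as \<open>k tan (k/2) \<le> \<surd>3 \<pi>\<close>. The value \<open>k = 0.71 \<pi>\<close> satisfies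
  this and still has \<open>2 k\<^sup>2 > \<pi>\<^sup>2\<close>, which is what coercivity on odd functions requires.\<close>

lemma line_robin:
  assumes f: "line_fun f f' M"
  shows "(LBINT x. (if \<bar>x\<bar> < 1/2 then (71/100 * pi)^2 else - 3 * pi^2) * (f x)^2) \<le> (LBINT x. (f' x)^2)"
proof -
  define k where "k = 71/100 * pi"
  have cos: "cos (k * (x - 0)) \<noteq> 0" if "x \<in> {0..1/2}" for x
  proof -
    have "k * x \<le> k * (1/2)" using that by (intro mult_left_mono) (auto simp: k_def)
    also have "\<dots> < pi / 2" by (simp add: k_def)
    finally have "k * x < pi/2" .
    moreover have "0 \<le> k * x" using that by (simp add: k_def)
    ultimately have "cos (k * x) > 0" by (intro cos_gt_zero_pi) (use pi_gt_zero in linarith)+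
    then show ?thesis by simp
  qed
  show ?thesis
  proof (rule line_riccati[OF f, where gi="\<lambda>x. - k * tan (k * (x - 0))"
      and gi'="\<lambda>x. - (k^2 * (1 + (tan (k * (x - 0)))^2))"
      and go="\<lambda>x. - (sqrt 3 * pi)" and go'="\<lambda>x. 0" and C="3 * pi^2"])
    show "((\<lambda>x. - k * tan (k * (x - 0))) has_real_derivative - (k^2 * (1 + (tan (k * (x - 0)))^2))) (at x)"
      if "x \<in> {0..1/2}" for x using cos[OF that] by (rule tan_riccati)
    show "continuous_on {0..1/2} (\<lambda>x. - (k^2 * (1 + (tan (k * (x - 0)))^2)))"
      using cos by (intro continuous_intros) auto
    show "- (sqrt 3 * pi) \<le> - k * tan (k * (1/2 - 0))"
    proof -
      have "tan (k * (1/2)) < tan (3 * pi / 8)"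
      proof (rule tan_monotone)
        show "- (pi / 2) < k * (1/2)" using pi_gt_zero by (simp add: k_def)
      qed (simp_all add: k_def)
      then have 1: "tan (k * (1/2)) \<le> 1 + sqrt 2" unfolding tan_3pi_8 by simp
      have "sqrt 2 \<le> 142/100" by (rule real_le_lsqrt) (auto simp: power2_eq_square)
      moreover have "1732/1000 \<le> sqrt 3" by (rule real_le_rsqrt) (auto simp: power2_eq_square)
      ultimately have 2: "71/100 * (1 + sqrt 2) \<le> sqrt 3" by simp
      have "k * tan (k * (1/2)) \<le> k * (1 + sqrt 2)" using 1 by (intro mult_left_mono) (auto simp: k_def)
      also have "\<dots> = (71/100 * (1 + sqrt 2)) * pi" by (simp add: k_def)
      also have "\<dots> \<le> sqrt 3 * pi" using 2 by (intro mult_right_mono) auto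
      finally show ?thesis by simp
    qed
    show "(if \<bar>x\<bar> < 1/2 then (71/100 * pi)^2 else - 3 * pi^2)
        \<le> - (- (k^2 * (1 + (tan (k * (x - 0)))^2)) + (- k * tan (k * (x - 0)))^2)" if "0 \<le> x" "x < 1/2" for x
      proof -
      have "(71/100 * pi)^2 = k^2" by (simp only: k_def)
      then show ?thesis using that by (simp add: power_mult_distrib algebra_simps)
    qed
    show "(\<lambda>x::real. if \<bar>x\<bar> < 1/2 then (71/100 * pi)^2 else - 3 * pi^2) \<in> borel_measurable borel" by measurable
  qed (auto simp: power_mult_distrib power2_eq_square)
qed

text \<open>Odd functions have mean zero, so the Neumann inequality on the whole interval applies.\<close>

lemma line_odd:
  assumes f: "line_fun f f' M" and odd: "\<And>x. f (- x) = - f x"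
  shows "(LBINT x. (if \<bar>x\<bar> < 1/2 then pi^2 else 0) * (f x)^2) \<le> (LBINT x. (f' x)^2)"
proof -
  note fD = line_funD[OF f]
  have "integral {-1/2..1/2} (\<lambda>x. f (- x)) = integral {-1/2..1/2} f"
    using Henstock_Kurzweil_Integration.integral_reflect_real[where f=f and a="-1/2" and b="1/2"] by simp
  then have z: "integral {-1/2..1/2} f = 0 * (1/2 - (-1/2))" unfolding odd by simp
  have "(LBINT x. (if \<bar>x\<bar> < 1/2 then 1 else 0) * (pi^2 * (f x)^2)) = pi^2 * integral {-1/2..1/2} (\<lambda>x. (f x)^2)"
    using lborel_integral_half_interval[of "\<lambda>x. pi^2 * (f x)^2"] fD(4)[of UNIV] by (simp add: continuous_intros)
  moreover have "(\<lambda>x. (if \<bar>x\<bar> < 1/2 then 1 else 0) * (pi^2 * (f x)^2)) = (\<lambda>x. (if \<bar>x\<bar> < 1/2 then pi^2 else 0) * (f x)^2)"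
    by auto
  moreover have "(pi / (1/2 - (-1/2)))^2 * integral {-1/2..1/2} (\<lambda>x. (f x - 0)^2) \<le> integral {-1/2..1/2} (\<lambda>x. (f' x)^2)"
    by (rule poincare_neumann[OF _ _ _ z]) (use fD in auto)
  moreover have "integral {-1/2..1/2} (\<lambda>x. (f' x)^2) \<le> (LBINT x. (f' x)^2)"
    by (rule integral_Icc_le_lborel) (use line_fun_integrable[OF f] in auto)
  ultimately show ?thesis by simp
qed

text \<open>Evenness lets the Neumann inequality be used on the half interval, where its constant is \<open>4\<pi>\<^sup>2\<close>;
  on the whole interval it would only be \<open>\<pi>\<^sup>2\<close>, below the threshold.\<close>

lemma line_even:
  assumes f: "line_fun f f' M" and even: "\<And>x. f (- x) = f x" and m: "m = integral {-1/2..1/2} f"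
  shows "4 * pi^2 * (LBINT x. (if \<bar>x\<bar> < 1/2 then 1 else 0) * (f x - m)^2) \<le> (LBINT x. (f' x)^2)"
proof -
  note fD = line_funD[OF f]
  have M: "M > 1/2" using fD(1) by simp
  have cf: "continuous_on S (\<lambda>x. (f x - m)^2)" for S by (intro continuous_intros fD)
  have int: "integrable lborel (\<lambda>x. (if \<bar>x\<bar> < 1/2 then 1 else 0) * (f x - m)^2)"
  proof -
    have "integrable lborel (\<lambda>x. (if \<bar>x\<bar> < 1/2 then 1 else 0) * (indicator {-1/2..1/2} x *\<^sub>R (f x - m)^2))"
      by (rule integrable_mult_bounded[OF borel_integrable_compact, where C=1]) (use cf in auto)
    then show ?thesis by (rule back_subst[of "integrable lborel"]) (auto simp: indicator_def abs_if)
  qed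
  have "integral {-1/2..0} f = integral {0..1/2} f"
    using Henstock_Kurzweil_Integration.integral_reflect_real[where f=f and a="0" and b="1/2"] even by simp
  moreover have "integral {-1/2..0} f + integral {0..1/2} f = integral {-1/2..1/2} f"
    by (rule Henstock_Kurzweil_Integration.integral_combine) (use fD in \<open>auto intro!: integrable_continuous_real\<close>)
  ultimately have m2: "integral {0..1/2} f = m * (1/2 - 0)" using m by simp
  have "(pi / (1/2 - 0))^2 * integral {0..1/2} (\<lambda>x. (f x - m)^2) \<le> integral {0..1/2} (\<lambda>x. (f' x)^2)"
    by (rule poincare_neumann[OF _ _ _ m2]) (use fD in auto)
  also have "\<dots> \<le> integral {0..M} (\<lambda>x. (f' x)^2)"
    by (rule integral_subset_le) (use fD in \<open>auto intro!: integrable_continuous_real continuous_intros\<close>)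
  finally have half: "4 * pi^2 * integral {0..1/2} (\<lambda>x. (f x - m)^2) \<le> integral {0..M} (\<lambda>x. (f' x)^2)"
    by (simp add: power_mult_distrib)
  have feven': "f' (- x) = - f' x" for x
  proof -
    have "(f has_real_derivative - f' (- x)) (at x)"
      using line_funD(2)[OF line_fun_reflect[OF f], of x UNIV] even by simp
    from DERIV_unique[OF fD(2)[of x UNIV] this] show ?thesis by simp
  qed
  have "(LBINT x. 4 * pi^2 * ((if \<bar>x\<bar> < 1/2 then 1 else 0) * (f x - m)^2)) \<le> (LBINT x. (f' x)^2)"
  proof (rule lborel_integral_halves_mono[where M=M])
    show 1: "integral {0..M} (\<lambda>x. 4 * pi^2 * ((if \<bar>x\<bar> < 1/2 then 1 else 0) * (f x - m)^2)) \<le> integral {0..M} (\<lambda>x. (f' x)^2)"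
      using half by (simp only: integral_mult_right integral_half_indicator[OF cf M])
    show "integral {0..M} (\<lambda>x. 4 * pi^2 * ((if \<bar>- x\<bar> < 1/2 then 1 else 0) * (f (- x) - m)^2)) \<le> integral {0..M} (\<lambda>x. (f' (- x))^2)"
      using 1 by (simp only: even feven' abs_minus_cancel power2_minus)
    show "integrable lborel (\<lambda>x. 4 * pi^2 * ((if \<bar>x\<bar> < 1/2 then 1 else 0) * (f x - m)^2))"
      using int by (rule integrable_mult_right)
    show "4 * pi^2 * ((if \<bar>x\<bar> < 1/2 then 1 else 0) * (f x - m)^2) = 0" if "\<bar>x\<bar> > M" for x
      using that M by simp
    show "(f' x)^2 = 0" if "\<bar>x\<bar> > M" for x using fD(6)[of x] that by simp
    show "0 \<le> M" using M by simp
  qed (rule line_fun_integrable[OF f])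
  then show ?thesis by simp
qed


section \<open>Integration over lines parallel to the axes\<close>

definition upd :: "3 \<Rightarrow> real^3 \<Rightarrow> real \<Rightarrow> real^3" where
  "upd j x s = (\<chi> k. if k = j then s else x $ k)"

lemma upd_nth: "upd j x s $ k = (if k = j then s else x $ k)"
  by (simp add: upd_def)

lemma upd_same [simp]: "upd j x s $ j = s" by (simp add: upd_nth)

lemma upd_upd [simp]: "upd j (upd j x s) t = upd j x t" by (simp add: upd_def vec_eq_iff)

lemma upd_commute: "i \<noteq> j \<Longrightarrow> upd i (upd j x s) t = upd j (upd i x t) s"
  by (auto simp: upd_def vec_eq_iff)

lemma upd_triv [simp]: "upd j x (x $ j) = x" by (simp add: upd_def vec_eq_iff)

lemma upd_eq: "upd j x s = x + (s - x $ j) *\<^sub>R axis j 1"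
  by (auto simp: upd_def vec_eq_iff axis_def)

lemma continuous_on_upd [continuous_intros]:
  assumes "continuous_on S f" "continuous_on S g"
  shows "continuous_on S (\<lambda>x. upd j (f x) (g x))"
  unfolding upd_eq by (intro continuous_intros assms)

lemma measurable_upd [measurable]: "upd j x \<in> borel_measurable borel"
  by (intro borel_measurable_continuous_onI continuous_intros)

lemma abs_le_norm_upd: "\<bar>s\<bar> \<le> norm (upd j x s)"
  using component_le_norm_cart[of "upd j x s" j] by simp

lemma axis_Basis: "axis j (1::real) \<in> Basis"
  by (auto simp: Basis_vec_def)

lemma Basis_real_vec: "(Basis :: (real^'n) set) = range (\<lambda>j. axis j 1)"
  by (auto simp: Basis_vec_def)

lemma inj_axis: "inj (\<lambda>j::'n::finite. axis j (1::real))"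
  by (auto simp: inj_def axis_eq_axis)

lemma sum_Basis_vec: "(\<Sum>b\<in>(Basis :: (real^'n) set). g b) = (\<Sum>j\<in>UNIV. g (axis j 1))"
  unfolding Basis_real_vec by (subst sum.reindex[OF inj_axis]) simp

lemma prod_Basis_vec: "(\<Prod>b\<in>(Basis :: (real^'n) set). g b) = (\<Prod>j\<in>UNIV. g (axis j 1))"
  unfolding Basis_real_vec by (subst prod.reindex[OF inj_axis]) simp

lemma sum_scaleR_axis_nth: "(\<Sum>k\<in>UNIV. c k *\<^sub>R axis k (1::real)) $ i = c i"
proof -
  have "(\<Sum>k\<in>UNIV. c k *\<^sub>R axis k (1::real)) $ i = (\<Sum>k\<in>UNIV. if k = i then c k else 0)"
    unfolding sum_component by (rule sum.cong) (auto simp: axis_def)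
  then show ?thesis by simp
qed

lemma integral_lborel_PiM:
  fixes H :: "'a::euclidean_space \<Rightarrow> real"
  assumes "H \<in> borel_measurable borel"
  shows "(LBINT x. H x) = (\<integral>f. H (\<Sum>b\<in>Basis. f b *\<^sub>R b) \<partial>(\<Pi>\<^sub>M b\<in>Basis. lborel))"
    "integrable lborel H \<longleftrightarrow> integrable (\<Pi>\<^sub>M b\<in>(Basis::'a set). lborel) (\<lambda>f. H (\<Sum>b\<in>Basis. f b *\<^sub>R b))"
proof -
  have T: "(\<lambda>f. \<Sum>b\<in>Basis. f b *\<^sub>R b) \<in> measurable (\<Pi>\<^sub>M b\<in>(Basis::'a set). lborel) borel" by measurable
  show "(LBINT x. H x) = (\<integral>f. H (\<Sum>b\<in>Basis. f b *\<^sub>R b) \<partial>(\<Pi>\<^sub>M b\<in>Basis. lborel))"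
    by (subst lborel_eq) (rule integral_distr[OF T assms])
  show "integrable lborel H \<longleftrightarrow> integrable (\<Pi>\<^sub>M b\<in>(Basis::'a set). lborel) (\<lambda>f. H (\<Sum>b\<in>Basis. f b *\<^sub>R b))"
    by (subst lborel_eq) (rule integrable_distr_eq[OF T assms])
qed

text \<open>Fubini in a form that treats all axes alike: Lebesgue measure is the image of the product over
  the basis, from which the factor of the direction \<open>j\<close> can be split off.\<close>

lemma integral_nonneg_slices:
  fixes H :: "real^3 \<Rightarrow> real"
  assumes H: "integrable lborel H" and nn: "\<And>x. 0 \<le> (LBINT s. H (upd j x s))"
  shows "0 \<le> (LBINT x. H x)"
proof -
  interpret product_sigma_finite "\<lambda>b::real^3. (lborel :: real measure)" ..
  let ?b = "axis j 1 :: real^3"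
  let ?B = "Basis - {?b}"
  have B: "insert ?b ?B = Basis" using axis_Basis by blast
  have Hm: "H \<in> borel_measurable borel" using H by simp
  let ?h = "\<lambda>f. H (\<Sum>b\<in>Basis. f b *\<^sub>R b)"
  have "integrable (\<Pi>\<^sub>M b\<in>insert ?b ?B. lborel) ?h"
    using H integral_lborel_PiM(2)[OF Hm] unfolding B by simp
  then have "(\<integral>f. ?h f \<partial>(\<Pi>\<^sub>M b\<in>insert ?b ?B. lborel)) = (\<integral>x. (LBINT y. ?h (x(?b := y))) \<partial>(\<Pi>\<^sub>M b\<in>?B. lborel))"
    by (rule product_integral_insert[rotated 2]) auto
  moreover have "0 \<le> (LBINT y. ?h (x(?b := y)))" for x
  proof -
    have "(\<Sum>b\<in>Basis. (x(?b := y)) b *\<^sub>R b) = upd j (\<Sum>b\<in>Basis. x b *\<^sub>R b) y" for y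
      unfolding sum_Basis_vec vec_eq_iff sum_scaleR_axis_nth upd_nth by (simp add: axis_eq_axis)
    then show ?thesis using nn by simp
  qed
  ultimately show ?thesis
    unfolding integral_lborel_PiM(1)[OF Hm] B by (simp add: Bochner_Integration.integral_nonneg)
qed

lemma integral_prod_coordinates:
  fixes p :: "3 \<Rightarrow> real \<Rightarrow> real"
  assumes p: "\<And>j. integrable lborel (p j)"
  shows "(LBINT x. (\<Prod>j\<in>UNIV. p j (x $ j))) = (\<Prod>j\<in>UNIV. (LBINT s. p j s))"
proof -
  interpret product_sigma_finite "\<lambda>b::real^3. (lborel :: real measure)" ..
  define P where "P b = p (inv (\<lambda>j::3. axis j (1::real)) b)" for b
  have P: "P (axis j 1) = p j" for j unfolding P_def by (subst inv_f_f[OF inj_axis]) (rule refl)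
  have [measurable]: "p j \<in> borel_measurable borel" for j using p[of j] by simp
  have m: "(\<lambda>x::real^3. \<Prod>j\<in>UNIV. p j (x $ j)) \<in> borel_measurable borel" by measurable
  have "(LBINT x. (\<Prod>j\<in>UNIV. p j (x $ j)))
    = (\<integral>f. (\<Prod>b\<in>Basis. P b (f b)) \<partial>(\<Pi>\<^sub>M b\<in>(Basis::(real^3) set). lborel))"
    unfolding integral_lborel_PiM(1)[OF m] prod_Basis_vec P sum_Basis_vec
    by (simp only: sum_scaleR_axis_nth)
  also have "\<dots> = (\<Prod>b\<in>(Basis::(real^3) set). (LBINT s. P b s))"
    by (rule product_integral_prod) (use p in \<open>auto simp: P_def\<close>)
  finally show ?thesis by (simp add: prod_Basis_vec P)
qed

text \<open>A class of functions that is closed under the operations of the sequel and for which all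
  integrals over space and over lines exist.\<close>

definition tame :: "(real^3 \<Rightarrow> real) \<Rightarrow> bool" where
  "tame H \<longleftrightarrow> H \<in> borel_measurable borel \<and> (\<exists>C M. \<forall>x. \<bar>H x\<bar> \<le> C \<and> (norm x > M \<longrightarrow> H x = 0))"

lemma tameI:
  assumes "H \<in> borel_measurable borel" "\<And>x. \<bar>H x\<bar> \<le> C" "\<And>x. norm x > M \<Longrightarrow> H x = 0"
  shows "tame H"
  using assms unfolding tame_def by blast

lemma bounded_support_integrable:
  fixes H :: "'a::euclidean_space \<Rightarrow> real"
  assumes "H \<in> borel_measurable borel" "\<And>x. \<bar>H x\<bar> \<le> C" "\<And>x. norm x > M \<Longrightarrow> H x = 0"
  shows "integrable lborel H"
proof (rule Bochner_Integration.integrable_bound)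
  show "integrable lborel (\<lambda>x::'a. C * indicator (cball 0 M) x)"
    by (auto intro!: integrable_mult_right integrable_real_indicator emeasure_bounded_finite)
  show "AE x in lborel. norm (H x) \<le> norm (C * indicator (cball 0 M) x)"
  proof (rule AE_I2)
    fix x
    have "C \<ge> 0" using assms(2)[of x] by linarith
    then show "norm (H x) \<le> norm (C * indicator (cball 0 M) x)"
      using assms(2)[of x] assms(3)[of x] by (auto simp: indicator_def not_le)
  qed
qed (use assms in simp)

lemma tame_integrable: "tame H \<Longrightarrow> integrable lborel H"
  unfolding tame_def by (auto intro: bounded_support_integrable)

lemma tame_slice: "tame H \<Longrightarrow> integrable lborel (\<lambda>s. H (upd j x s))"
proof -
  assume "tame H"
  then obtain C M where H: "H \<in> borel_measurable borel" "\<And>x. \<bar>H x\<bar> \<le> C" "\<And>x. norm x > M \<Longrightarrow> H x = 0"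
    unfolding tame_def by blast
  show ?thesis
  proof (rule bounded_support_integrable)
    show "(\<lambda>s. H (upd j x s)) \<in> borel_measurable borel"
      using measurable_compose[OF measurable_upd H(1)] .
    show "\<bar>H (upd j x s)\<bar> \<le> C" for s by (rule H)
    show "H (upd j x s) = 0" if "norm s > M" for s
      using that abs_le_norm_upd[of s j x] by (intro H(3)) simp
  qed
qed

lemma tame_add: assumes "tame F" "tame G" shows "tame (\<lambda>x. F x + G x)"
proof -
  obtain C M C' M' where "\<And>x. \<bar>F x\<bar> \<le> C \<and> (norm x > M \<longrightarrow> F x = 0)" "\<And>x. \<bar>G x\<bar> \<le> C' \<and> (norm x > M' \<longrightarrow> G x = 0)"
    using assms unfolding tame_def by meson
  then have "\<bar>F x + G x\<bar> \<le> C + C' \<and> (norm x > max M M' \<longrightarrow> F x + G x = 0)" for x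
    using abs_triangle_ineq[of "F x" "G x"] by (smt (verit) max_less_iff_conj)
  then have "\<exists>C M. \<forall>x. \<bar>F x + G x\<bar> \<le> C \<and> (norm x > M \<longrightarrow> F x + G x = 0)" by blast
  then show ?thesis using assms unfolding tame_def by auto
qed

lemma tame_mult_bounded:
  assumes "w \<in> borel_measurable borel" "\<And>x. \<bar>w x\<bar> \<le> B" "tame H"
  shows "tame (\<lambda>x. w x * H x)"
proof -
  obtain C M where *: "\<And>x. \<bar>H x\<bar> \<le> C \<and> (norm x > M \<longrightarrow> H x = 0)" "H \<in> borel_measurable borel"
    using assms(3) unfolding tame_def by meson
  have "\<bar>w x * H x\<bar> \<le> B * C" for x
    unfolding abs_mult using assms(2)[of x] *(1)[of x] by (intro mult_mono) linarith+
  then show ?thesis using * assms by (intro tameI[where C="B * C" and M=M]) auto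
qed

lemma tame_cmult: "tame H \<Longrightarrow> tame (\<lambda>x. c * H x)"
  by (rule tame_mult_bounded[where B="\<bar>c\<bar>"]) auto

lemma tame_sum: "(\<And>i. i \<in> I \<Longrightarrow> tame (F i)) \<Longrightarrow> finite I \<Longrightarrow> tame (\<lambda>x. \<Sum>i\<in>I. F i x)"
proof (induction I rule: infinite_finite_induct)
  case empty
  show ?case by (auto simp: tame_def intro!: exI[of _ 0])
qed (auto intro: tame_add)

lemma tame_continuous:
  fixes h :: "real^3 \<Rightarrow> real"
  assumes h: "continuous_on UNIV h" and w: "w \<in> borel_measurable borel" "\<And>x. \<bar>w x\<bar> \<le> B" "\<And>x. norm x > M \<Longrightarrow> w x = 0"
  shows "tame (\<lambda>x. w x * h x)"
proof -
  have "compact (h ` cball 0 M)" by (intro compact_continuous_image continuous_on_subset[OF h]) auto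
  then obtain C where C: "\<And>x. x \<in> cball 0 M \<Longrightarrow> \<bar>h x\<bar> \<le> C"
    by (meson bounded_real compact_imp_bounded image_eqI)
  have "\<bar>w x * h x\<bar> \<le> B * \<bar>C\<bar>" for x
  proof (cases "norm x > M")
    case False
    then have "\<bar>h x\<bar> \<le> \<bar>C\<bar>" using C[of x] by simp
    then show ?thesis unfolding abs_mult using w(2)[of x] by (intro mult_mono) auto
  next
    case True
    then show ?thesis using w(3) w(2)[of x] by auto
  qed
  moreover have "h \<in> borel_measurable borel" using h by (rule borel_measurable_continuous_onI)
  ultimately show ?thesis using w by (intro tameI[where C="B * \<bar>C\<bar>" and M=M]) auto
qed

lemma tame_continuous_support:
  fixes h :: "real^3 \<Rightarrow> real"
  assumes h: "continuous_on UNIV h" "\<And>x. norm x > M \<Longrightarrow> h x = 0"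
  shows "tame h"
proof -
  have "tame (\<lambda>x. indicator (cball 0 M) x * h x)"
    by (rule tame_continuous[OF h(1), where B=1 and M=M]) (auto simp: indicator_def)
  moreover have "(\<lambda>x. indicator (cball 0 M) x * h x) = h"
    using h(2) by (auto simp: indicator_def fun_eq_iff not_le)
  ultimately show ?thesis by simp
qed

text \<open>This turns the inequalities on lines into inequalities on space.\<close>

lemma integral_mono_slices:
  assumes "tame F" "tame G" and le: "\<And>x. (LBINT s. F (upd j x s)) \<le> (LBINT s. G (upd j x s))"
  shows "(LBINT x. F x) \<le> (LBINT x. G x)"
proof -
  have "0 \<le> (LBINT x. G x - F x)"
  proof (rule integral_nonneg_slices)
    show "integrable lborel (\<lambda>x. G x - F x)" using assms by (intro Bochner_Integration.integrable_diff tame_integrable)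
    show "0 \<le> (LBINT s. G (upd j x s) - F (upd j x s))" for x
      using le[of x] by (subst Bochner_Integration.integral_diff) (auto intro: tame_slice assms)
  qed
  then show ?thesis using assms by (simp add: tame_integrable)
qed

lemma integral_eq_slices:
  assumes "tame F" "tame G" "\<And>x. (LBINT s. F (upd j x s)) = (LBINT s. G (upd j x s))"
  shows "(LBINT x. F x) = (LBINT x. G x)"
  by (rule antisym; rule integral_mono_slices[where j=j]; use assms in simp)


section \<open>The central cube and averaging\<close>

definition inQ :: "real^3 \<Rightarrow> real" where
  "inQ x = (if \<forall>k. \<bar>x $ k\<bar> < 1/2 then 1 else 0)"

lemma inQ_upd: "inQ (upd j x s) = (if x \<in> bar j then (if \<bar>s\<bar> < 1/2 then 1 else 0) else 0)"
  unfolding inQ_def upd_nth bar_def by auto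

lemma norm_le_inQ: assumes "inQ x \<noteq> 0" shows "norm x \<le> 2"
proof -
  have "norm x \<le> (\<Sum>i\<in>UNIV. \<bar>x $ i\<bar>)" by (rule norm_le_l1_cart)
  also have "\<dots> \<le> (\<Sum>i\<in>(UNIV::3 set). 1/2)"
    using assms by (intro sum_mono) (auto simp: inQ_def less_imp_le split: if_splits)
  finally show ?thesis by simp
qed

lemma measurable_inQ [measurable]: "inQ \<in> borel_measurable borel"
  unfolding inQ_def[abs_def] by measurable

lemma tame_inQ: "continuous_on UNIV h \<Longrightarrow> tame (\<lambda>x. inQ x * h x)"
proof (rule tame_continuous[where B=1 and M=2])
  show "inQ x = 0" if "norm x > 2" for x using norm_le_inQ[of x] that by linarith
qed (auto simp: inQ_def)

lemma slice_inQ: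
  assumes "continuous_on UNIV h"
  shows "(LBINT s. inQ (upd j x s) * h (upd j x s)) =
    (if x \<in> bar j then integral {-1/2..1/2} (\<lambda>s. h (upd j x s)) else 0)"
proof -
  have "continuous_on UNIV (\<lambda>s. h (upd j x s))"
    by (rule continuous_on_compose2[OF assms]) (auto intro!: continuous_intros)
  from lborel_integral_half_interval[OF this] show ?thesis unfolding inQ_upd by simp
qed

definition avg :: "3 \<Rightarrow> (real^3 \<Rightarrow> real) \<Rightarrow> real^3 \<Rightarrow> real" where
  "avg j h x = integral {-1/2..1/2} (\<lambda>s. h (upd j x s))"

lemma continuous_on_slice: "continuous_on UNIV h \<Longrightarrow> continuous_on S (\<lambda>s. h (upd j x s))"
  by (rule continuous_on_compose2) (auto intro!: continuous_intros)

lemma continuous_on_avg: 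
  assumes "continuous_on UNIV h" shows "continuous_on UNIV (avg j h)"
proof -
  have "continuous_on (UNIV \<times> cbox (-1/2) (1/2)) (\<lambda>(x, s). h (upd j x s))"
    unfolding split_beta
    by (rule continuous_on_compose2[OF assms]) (auto intro!: continuous_intros)
  from integral_continuous_on_param[OF this] show ?thesis
    unfolding avg_def[abs_def] by (simp add: box_real)
qed

lemma avg_upd [simp]: "avg j h (upd j x s) = avg j h x" by (simp add: avg_def)

lemma avg_commute:
  assumes "continuous_on UNIV h" "i \<noteq> j"
  shows "avg i (avg j h) = avg j (avg i h)"
proof
  fix x
  have "continuous_on (cbox (-1/2, -1/2) (1/2, 1/2)) (\<lambda>(s, t). h (upd j (upd i x s) t))"
    unfolding split_beta by (rule continuous_on_compose2[OF assms(1)]) (auto intro!: continuous_intros)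
  from integral_swap_continuous[OF this] show "avg i (avg j h) x = avg j (avg i h) x"
    unfolding avg_def using upd_commute[OF assms(2)] by (simp add: box_real)
qed

lemma avg_diff:
  assumes "continuous_on UNIV h" "continuous_on UNIV k"
  shows "avg j (\<lambda>x. h x - k x) = (\<lambda>x. avg j h x - avg j k x)"
  unfolding avg_def
  by (intro ext Henstock_Kurzweil_Integration.integral_diff integrable_continuous_real continuous_on_slice assms)

definition cubeV :: "(real^3 \<Rightarrow> real) \<Rightarrow> real" where
  "cubeV h = (LBINT x. inQ x * (h x)^2)"

lemma cubeV_nonneg: "0 \<le> cubeV h"
  unfolding cubeV_def by (rule Bochner_Integration.integral_nonneg) (auto simp: inQ_def)

lemma integral_avg:
  assumes "continuous_on UNIV h"
  shows "(LBINT x. inQ x * avg j h x) = (LBINT x. inQ x * h x)"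
proof (rule integral_eq_slices[where j=j])
  show "(LBINT s. inQ (upd j x s) * avg j h (upd j x s)) = (LBINT s. inQ (upd j x s) * h (upd j x s))" for x
    unfolding slice_inQ[OF assms] slice_inQ[OF continuous_on_avg[OF assms]]
    by (simp only: avg_upd) (simp add: avg_def)
qed (intro tame_inQ assms continuous_on_avg)+

text \<open>Pythagoras on every line in direction \<open>j\<close>: the fluctuation is orthogonal to the mean.\<close>

lemma cubeV_avg_split:
  assumes h: "continuous_on UNIV h"
  shows "cubeV h = cubeV (\<lambda>x. h x - avg j h x) + cubeV (avg j h)"
proof -
  note c = h continuous_on_avg[OF h, of j]
  have "cubeV h = (LBINT x. inQ x * ((h x - avg j h x)^2 + (avg j h x)^2))"
    unfolding cubeV_def
  proof (rule integral_eq_slices[where j=j])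
    fix x
    define m where "m = avg j h x"
    note cs = continuous_on_slice[OF h]
    have "integral {-1/2..1/2} (\<lambda>s. (h (upd j x s))^2)
      = integral {-1/2..1/2} (\<lambda>s. ((h (upd j x s) - m)^2 + m^2) + (2 * m) * (h (upd j x s) - m))"
      by (rule Henstock_Kurzweil_Integration.integral_cong) (simp add: power2_eq_square algebra_simps)
    also have "\<dots> = integral {-1/2..1/2} (\<lambda>s. (h (upd j x s) - m)^2 + m^2) + integral {-1/2..1/2} (\<lambda>s. (2 * m) * (h (upd j x s) - m))"
      by (intro Henstock_Kurzweil_Integration.integral_add integrable_continuous_real continuous_intros cs)
    also have "integral {-1/2..1/2} (\<lambda>s. (2 * m) * (h (upd j x s) - m)) = (2 * m) * (avg j h x - m)"
      unfolding integral_mult_right avg_def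
      by (subst Henstock_Kurzweil_Integration.integral_diff) (auto intro!: integrable_continuous_real cs)
    finally have "integral {-1/2..1/2} (\<lambda>s. (h (upd j x s))^2) = integral {-1/2..1/2} (\<lambda>s. (h (upd j x s) - m)^2 + m^2)"
      by (simp add: m_def)
    then show "(LBINT s. inQ (upd j x s) * (h (upd j x s))^2) =
        (LBINT s. inQ (upd j x s) * ((h (upd j x s) - avg j h (upd j x s))^2 + (avg j h (upd j x s))^2))"
      using slice_inQ[of "\<lambda>x. (h x)^2" j x] slice_inQ[of "\<lambda>x. (h x - avg j h x)^2 + (avg j h x)^2" j x] c
      by (simp add: continuous_intros m_def)
  qed (intro tame_inQ continuous_intros c)+
  also have "\<dots> = cubeV (\<lambda>x. h x - avg j h x) + cubeV (avg j h)"
    unfolding cubeV_def distrib_left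
    by (intro Bochner_Integration.integral_add tame_integrable tame_inQ continuous_intros c)
  finally show ?thesis .
qed

lemma cubeV_avg_le: "continuous_on UNIV h \<Longrightarrow> cubeV (avg j h) \<le> cubeV h"
  using cubeV_avg_split[of h j] cubeV_nonneg[of "\<lambda>x. h x - avg j h x"] by simp

lemma UNIV3: "(UNIV :: 3 set) = {1, 2, 3}" using exhaust_3 by auto

lemma integral_inQ: "(LBINT x. inQ x) = 1"
proof -
  let ?p = "\<lambda>s::real. if \<bar>s\<bar> < 1/2 then 1 else 0 :: real"
  have "integrable lborel (\<lambda>s. ?p s * 1)"
    by (rule bounded_support_integrable[where C=1 and M=1]) auto
  then have "(LBINT x. (\<Prod>j\<in>UNIV. ?p ((x::real^3) $ j))) = (\<Prod>j\<in>(UNIV::3 set). (LBINT s. ?p s))"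
    by (intro integral_prod_coordinates) simp
  also have "(LBINT s. ?p s) = 1"
    using lborel_integral_half_interval[of "\<lambda>_. 1"] by simp
  also have "(\<lambda>x::real^3. \<Prod>j\<in>UNIV. ?p (x $ j)) = inQ"
    by (auto simp: inQ_def fun_eq_iff prod_zero_iff)
  finally show ?thesis by simp
qed

text \<open>Variance is subadditive over independent coordinates. Average over one coordinate after the
  other; what is lost at each step is an average of the fluctuation in the current coordinate,
  since averages commute, and averaging does not increase the norm.\<close>

lemma efron_stein:
  assumes h: "continuous_on UNIV h"
  shows "cubeV h - (LBINT x. inQ x * h x)^2 \<le> (\<Sum>j\<in>UNIV. cubeV (\<lambda>x. h x - avg j h x))"
proof -
  note ca = continuous_on_avg
  define a1 where "a1 = avg 1 h"
  define a2 where "a2 = avg 2 a1"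
  define a3 where "a3 = avg 3 a2"
  have c1: "continuous_on UNIV a1" and c2: "continuous_on UNIV a2" and c3: "continuous_on UNIV a3"
    unfolding a1_def a2_def a3_def by (intro ca h)+
  have "cubeV a1 = cubeV (\<lambda>x. a1 x - avg 2 a1 x) + cubeV a2"
    unfolding a2_def by (rule cubeV_avg_split[OF c1])
  moreover have "(\<lambda>x. a1 x - avg 2 a1 x) = avg 1 (\<lambda>x. h x - avg 2 h x)"
    unfolding a1_def by (subst avg_diff[OF h ca[OF h]]) (simp add: avg_commute[OF h, of 2 1])
  moreover have "cubeV (avg 1 (\<lambda>x. h x - avg 2 h x)) \<le> cubeV (\<lambda>x. h x - avg 2 h x)"
    by (rule cubeV_avg_le) (intro continuous_intros h ca)
  moreover have "cubeV a2 = cubeV (\<lambda>x. a2 x - avg 3 a2 x) + cubeV a3"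
    unfolding a3_def by (rule cubeV_avg_split[OF c2])
  moreover have "(\<lambda>x. a2 x - avg 3 a2 x) = avg 2 (avg 1 (\<lambda>x. h x - avg 3 h x))"
  proof -
    have "avg 3 a2 = avg 2 (avg 1 (avg 3 h))"
      unfolding a2_def a1_def
      by (simp add: avg_commute[OF ca[OF h], of 3 2] avg_commute[OF h, of 3 1])
    moreover have "avg 2 (avg 1 (\<lambda>x. h x - avg 3 h x)) = (\<lambda>x. a2 x - avg 2 (avg 1 (avg 3 h)) x)"
      unfolding a2_def a1_def by (simp add: avg_diff h ca)
    ultimately show ?thesis by simp
  qed
  moreover have "cubeV (avg 2 (avg 1 (\<lambda>x. h x - avg 3 h x))) \<le> cubeV (\<lambda>x. h x - avg 3 h x)"
    by (rule order_trans[OF cubeV_avg_le cubeV_avg_le]) (intro continuous_intros h ca)+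
  moreover have "cubeV h = cubeV (\<lambda>x. h x - avg 1 h x) + cubeV a1"
    unfolding a1_def by (rule cubeV_avg_split[OF h])
  moreover have "cubeV a3 = (LBINT x. inQ x * h x)^2"
  proof -
    have const: "a3 x = a3 0" for x
    proof -
      have "a3 (upd 3 x s) = a3 x" for x s by (simp add: a3_def)
      moreover have "a3 (upd 2 x s) = a3 x" for x s
        unfolding a3_def a2_def by (subst (1 2) avg_commute[OF c1]) auto
      moreover have "a3 (upd 1 x s) = a3 x" for x s
      proof -
        have "a3 = avg 1 (avg 3 (avg 2 h))"
          unfolding a3_def a2_def a1_def by (simp add: avg_commute[OF h, of 2 1] avg_commute[OF ca[OF h], of 3 1])
        then show ?thesis by simp
      qed
      moreover have "upd 1 (upd 2 (upd 3 x 0) 0) 0 = 0"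
        using exhaust_3 by (auto simp: vec_eq_iff upd_nth)
      ultimately show ?thesis by metis
    qed
    have "a3 0 = (LBINT x. inQ x * a3 x)"
      by (subst const) (simp add: integral_inQ)
    also have "\<dots> = (LBINT x. inQ x * h x)"
      unfolding a3_def integral_avg[OF c2] unfolding a2_def integral_avg[OF c1] unfolding a1_def integral_avg[OF h] ..
    finally have "a3 0 = (LBINT x. inQ x * h x)" .
    moreover have "cubeV a3 = (a3 0)^2"
      unfolding cubeV_def by (subst const) (simp add: integral_inQ)
    ultimately show ?thesis by simp
  qed
  ultimately show ?thesis unfolding UNIV3 by simp
qed


section \<open>Trial functions and their energy\<close>

abbreviation pd :: "3 \<Rightarrow> (real^3 \<Rightarrow> real) \<Rightarrow> real^3 \<Rightarrow> real" where
  "pd j f \<equiv> dir_deriv (axis j 1) f"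

text \<open>The class of the coercivity estimate. It contains the test functions on \<open>\<Omega>\<close> and is closed under
  linear combinations and reflections, hence contains the parts of definite parity.\<close>

definition trial :: "(real^3 \<Rightarrow> real) \<Rightarrow> bool" where
  "trial f \<longleftrightarrow> C_diff 1 f \<and> (\<exists>M. \<forall>x. norm x > M \<longrightarrow> f x = 0) \<and> (\<forall>x. x \<notin> Omega \<longrightarrow> f x = 0)"

definition energy :: "(real^3 \<Rightarrow> real) \<Rightarrow> real" where
  "energy f = (\<Sum>j\<in>UNIV. LBINT x. (pd j f x)^2) - 2 * pi^2 * (LBINT x. (f x)^2)"

definition cubeM :: "(real^3 \<Rightarrow> real) \<Rightarrow> real" where
  "cubeM f = (LBINT x. inQ x * f x)"

lemma dir_deriv_zero_open:
  assumes "open U" "x \<in> U" "\<And>y. y \<in> U \<Longrightarrow> f y = 0"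
  shows "dir_deriv h f x = 0"
proof -
  have "(f has_derivative (\<lambda>_. 0)) (at x)"
    by (rule has_derivative_transform_within_open[OF _ assms(1,2), of "\<lambda>_. 0"]) (use assms(3) in auto)
  then show ?thesis by (rule dir_deriv_eqI)
qed

lemma dir_deriv_linear:
  assumes "f differentiable (at x)" shows "bounded_linear (\<lambda>h. dir_deriv h f x)"
  using dir_deriv_has_derivative[OF assms] by (rule has_derivative_bounded_linear)

lemma C_diff_1D:
  assumes "C_diff 1 f"
  shows "f differentiable (at x)" "continuous_on S f" "continuous_on S (dir_deriv h f)"
proof -
  have *: "C_diff (Suc 0) f" using assms by simp
  then show "f differentiable (at x)" unfolding C_diff.simps by blast
  show "continuous_on S f" using C_diff_imp_continuous[OF *] by (rule continuous_on_subset) simp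
  have "continuous_on UNIV (dir_deriv h f)" using * unfolding C_diff.simps by blast
  then show "continuous_on S (dir_deriv h f)" by (rule continuous_on_subset) simp
qed

lemma trialD:
  assumes "trial f"
  shows "f differentiable (at x)" "continuous_on S f" "continuous_on S (dir_deriv h f)"
    "x \<notin> Omega \<Longrightarrow> f x = 0"
proof -
  have *: "C_diff 1 f" "\<forall>x. x \<notin> Omega \<longrightarrow> f x = 0" using assms unfolding trial_def by blast+
  show "f differentiable (at x)" "continuous_on S f" "continuous_on S (dir_deriv h f)"
    by (rule C_diff_1D[OF *(1)])+
  show "x \<notin> Omega \<Longrightarrow> f x = 0" using * by blast
qed

lemma trial_support:
  assumes "trial f"
  obtains M where "M > 1" "\<And>x. norm x \<ge> M \<Longrightarrow> f x = 0" "\<And>h x. norm x \<ge> M \<Longrightarrow> dir_deriv h f x = 0"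
proof -
  obtain M where M: "\<And>x. norm x > M \<Longrightarrow> f x = 0" using assms unfolding trial_def by blast
  have op: "open {x :: real^3. norm x > M}" by (intro open_Collect_less continuous_intros)
  have "dir_deriv h f x = 0" if "norm x > M" for h x
    by (rule dir_deriv_zero_open[OF op]) (use M that in auto)
  with M show ?thesis by (intro that[of "\<bar>M\<bar> + 2"]) auto
qed

lemma trial_tame:
  assumes "trial f"
  shows "tame f" "tame (dir_deriv h f)" "tame (\<lambda>x. (f x)^2)" "tame (\<lambda>x. (dir_deriv h f x)^2)"
proof -
  obtain M where M: "\<And>x. norm x \<ge> M \<Longrightarrow> f x = 0" "\<And>h x. norm x \<ge> M \<Longrightarrow> dir_deriv h f x = 0"
    using trial_support[OF assms] by metis
  show "tame f" "tame (dir_deriv h f)" "tame (\<lambda>x. (f x)^2)" "tame (\<lambda>x. (dir_deriv h f x)^2)"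
    by (rule tame_continuous_support[where M=M]; use M trialD[OF assms] in \<open>auto intro!: continuous_intros\<close>)+
qed

lemma trial_line:
  assumes "trial f"
  shows "\<exists>M. line_fun (\<lambda>s. f (upd j x s)) (\<lambda>s. pd j f (upd j x s)) M"
proof -
  obtain M where M: "M > 1" "\<And>x. norm x \<ge> M \<Longrightarrow> f x = 0" "\<And>h x. norm x \<ge> M \<Longrightarrow> dir_deriv h f x = 0"
    using trial_support[OF assms] by metis
  have "((\<lambda>s. f (upd j x s)) has_real_derivative pd j f (upd j x s)) (at s)" for s
  proof -
    have "((\<lambda>s. upd j x s) has_derivative (\<lambda>h. h *\<^sub>R axis j 1)) (at s)"
      unfolding upd_eq by (auto intro!: derivative_eq_intros)
    from has_derivative_compose[OF this dir_deriv_has_derivative[OF trialD(1)[OF assms]]]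
    have "((\<lambda>s. f (upd j x s)) has_derivative (\<lambda>h. dir_deriv (h *\<^sub>R axis j 1) f (upd j x s))) (at s)" .
    moreover have "dir_deriv (h *\<^sub>R axis j 1) f (upd j x s) = pd j f (upd j x s) * h" for h
      using linear_scale[OF bounded_linear.linear[OF dir_deriv_linear[OF trialD(1)[OF assms]]]] by simp
    ultimately show ?thesis by (simp add: has_field_derivative_def)
  qed
  moreover have "continuous_on UNIV (\<lambda>s. pd j f (upd j x s))"
    by (rule continuous_on_slice) (rule trialD[OF assms])
  ultimately have "line_fun (\<lambda>s. f (upd j x s)) (\<lambda>s. pd j f (upd j x s)) M"
    unfolding line_fun_def using M order_trans[OF _ abs_le_norm_upd] by auto
  then show ?thesis ..
qed

text \<open>The arms are closed towards the cube: the faces belong to them, and then \<open>inQ\<close> and the \<open>inA j\<close>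
  are the indicators of a partition of \<open>\<Omega>\<close>.\<close>

definition inA :: "3 \<Rightarrow> real^3 \<Rightarrow> real" where
  "inA j x = (if 1/2 \<le> \<bar>x $ j\<bar> \<and> x \<in> bar j then 1 else 0)"

lemma measurable_bar [measurable]: "bar j \<in> sets borel"
proof -
  have "bar j = (\<Inter>k\<in>-{j}. {x. \<bar>x $ k\<bar> < 1/2})" unfolding bar_def by auto
  moreover have "{x :: real^3. \<bar>x $ k\<bar> < 1/2} \<in> sets borel" for k
    by (intro borel_open open_Collect_less continuous_intros)
  ultimately show ?thesis by (cases "-{j} = {}") auto
qed

lemma measurable_inA [measurable]: "inA j \<in> borel_measurable borel"
  unfolding inA_def[abs_def] by measurable

lemma bar_upd: "upd j x s \<in> bar j \<longleftrightarrow> x \<in> bar j"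
  by (auto simp: bar_def upd_nth)

lemma cube_arms_decomposition:
  assumes "x \<in> Omega \<or> c = 0"
  shows "c = inQ x * c + (\<Sum>j\<in>UNIV. inA j x * c)"
proof (cases "c = 0")
  case False
  then obtain j where j: "x \<in> bar j" using assms unfolding Omega_def by auto
  show ?thesis
  proof (cases "\<bar>x $ j\<bar> < 1/2")
    case True
    then have "\<bar>x $ k\<bar> < 1/2" for k using j by (cases "k = j") (auto simp: bar_def)
    then have "inQ x = 1" "\<And>k. inA k x = 0" by (auto simp: inQ_def inA_def not_le)
    then show ?thesis by simp
  next
    case F: False
    then have 1: "inQ x = 0" by (auto simp: inQ_def)
    have "inA k x = (if k = j then 1 else 0)" for k
      using j F by (auto simp: inA_def bar_def not_le)
    then show ?thesis using 1 by (simp add: if_distrib[where f="\<lambda>a. a * c"] cong: if_cong)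
  qed
qed simp

lemma inA_sum_le: "(\<Sum>k\<in>-{j}. inA k x) \<le> 1"
proof -
  have "(\<Sum>k\<in>-{j}. inA k x) \<le> (\<Sum>k\<in>UNIV. inA k x)"
    by (rule sum_mono2) (auto simp: inA_def)
  also have "\<dots> \<le> 1"
  proof (cases "x \<in> Omega")
    case True
    then have "1 = inQ x * 1 + (\<Sum>j\<in>UNIV. inA j x * 1)" by (intro cube_arms_decomposition) simp
    then show ?thesis by (simp add: inQ_def split: if_splits)
  next
    case False
    then show ?thesis by (simp add: inA_def Omega_def)
  qed
  finally show ?thesis .
qed

lemma tame_divide: "tame H \<Longrightarrow> tame (\<lambda>x. H x / c)"
  using tame_cmult[of H "1/c"] by simp

definition armV :: "3 \<Rightarrow> (real^3 \<Rightarrow> real) \<Rightarrow> real" where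
  "armV j f = (LBINT x. inA j x * (f x)^2)"

lemma tame_weight:
  assumes "trial f" "w \<in> borel_measurable borel" "\<And>x. \<bar>w x\<bar> \<le> C"
  shows "tame (\<lambda>x. w x * (f x)^2)"
  by (rule tame_mult_bounded[OF assms(2,3) trial_tame(3)[OF assms(1)]])

lemma tame_inA: "trial f \<Longrightarrow> tame (\<lambda>x. inA j x * (f x)^2)"
  by (rule tame_weight[where C=1]) (auto simp: inA_def)

lemma integral_square_split:
  assumes "trial f"
  shows "(LBINT x. (f x)^2) = cubeV f + (\<Sum>j\<in>UNIV. armV j f)"
proof -
  have "(LBINT x. (f x)^2) = (LBINT x. inQ x * (f x)^2 + (\<Sum>j\<in>UNIV. inA j x * (f x)^2))"
    by (intro Bochner_Integration.integral_cong refl cube_arms_decomposition) (use trialD(4)[OF assms] in auto)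
  also have "\<dots> = cubeV f + (\<Sum>j\<in>UNIV. armV j f)"
    unfolding cubeV_def armV_def using assms trialD[OF assms]
    by (subst Bochner_Integration.integral_add)
      (auto intro!: tame_integrable tame_inQ tame_inA tame_sum continuous_intros Bochner_Integration.integral_sum)
  finally show ?thesis .
qed

text \<open>A line that misses the bar along its direction crosses at most one other arm, and \<open>f\<close>
  satisfies Dirichlet conditions at its two sides.\<close>

lemma trial_zero_off_bar:
  assumes "trial f" "x \<notin> bar j" "\<bar>s\<bar> \<ge> 1/2" shows "f (upd j x s) = 0"
proof (rule trialD(4)[OF assms(1)], rule notI)
  assume "upd j x s \<in> Omega"
  then obtain l where l: "upd j x s \<in> bar l" by (auto simp: Omega_def)
  show False
  proof (cases "l = j")
    case True with l assms show False by (simp add: bar_upd)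
  next
    case False
    with l have "\<bar>upd j x s $ j\<bar> < 1/2" by (auto simp: bar_def)
    with assms show False by simp
  qed
qed

text \<open>The bookkeeping common to all directional estimates. Lines through the bar \<open>j\<close> are governed by
  the density \<open>H\<close>; the remaining lines cross at most one of the other arms and have the
  Dirichlet constant \<open>c\<close>.\<close>

lemma direction_bound:
  assumes f: "trial f" and c: "c \<ge> 0" and H: "tame H"
    and D: "\<And>x. x \<notin> bar j \<Longrightarrow> c * (LBINT s. (f (upd j x s))^2) \<le> (LBINT s. (pd j f (upd j x s))^2)"
    and core: "\<And>x. x \<in> bar j \<Longrightarrow> (LBINT s. H (upd j x s)) \<le> (LBINT s. (pd j f (upd j x s))^2)"
    and H0: "\<And>x. x \<notin> bar j \<Longrightarrow> H x = 0"
  shows "(LBINT x. H x) + c * ((\<Sum>k\<in>UNIV. armV k f) - armV j f) \<le> (LBINT x. (pd j f x)^2)"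
proof -
  let ?F = "\<lambda>x. H x + c * (\<Sum>k\<in>-{j}. inA k x * (f x)^2)"
  have tS: "tame (\<lambda>x. \<Sum>k\<in>-{j}. inA k x * (f x)^2)"
    by (intro tame_sum tame_inA f) auto
  have tF: "tame ?F" by (intro tame_add H tame_cmult tS)
  have "(LBINT x. ?F x) \<le> (LBINT x. (pd j f x)^2)"
  proof (rule integral_mono_slices[OF tF trial_tame(4)[OF f], where j=j])
    fix x
    show "(LBINT s. ?F (upd j x s)) \<le> (LBINT s. (pd j f (upd j x s))^2)"
    proof (cases "x \<in> bar j")
      case True
      have "inA k (upd j x s) = 0" if "k \<in> -{j}" for k s
        using True that by (auto simp: inA_def upd_nth bar_def)
      then show ?thesis using core[OF True] by simp
    next
      case False
      have "(LBINT s. ?F (upd j x s)) \<le> (LBINT s. c * (f (upd j x s))^2)"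
      proof (rule integral_mono)
        show "integrable lborel (\<lambda>s. ?F (upd j x s))" by (rule tame_slice[OF tF])
        show "integrable lborel (\<lambda>s. c * (f (upd j x s))^2)"
          by (rule tame_slice[OF tame_cmult[OF trial_tame(3)[OF f]]])
        fix s
        have "H (upd j x s) = 0" using False by (intro H0) (simp add: bar_upd)
        moreover have "(\<Sum>k\<in>-{j}. inA k (upd j x s) * (f (upd j x s))^2) \<le> 1 * (f (upd j x s))^2"
          unfolding sum_distrib_right[symmetric] by (intro mult_right_mono inA_sum_le) auto
        ultimately show "?F (upd j x s) \<le> c * (f (upd j x s))^2"
          using mult_left_mono[OF _ c] by fastforce
      qed
      also have "\<dots> \<le> (LBINT s. (pd j f (upd j x s))^2)"
        using D[OF False] by simp
      finally show ?thesis .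
    qed
  qed
  moreover have "(LBINT x. ?F x) = (LBINT x. H x) + c * (\<Sum>k\<in>-{j}. armV k f)"
    unfolding armV_def using tS H f
    by (subst Bochner_Integration.integral_add)
      (auto intro!: tame_integrable tame_cmult tame_inA Bochner_Integration.integral_sum)
  moreover have "(\<Sum>k\<in>-{j}. armV k f) = (\<Sum>k\<in>UNIV. armV k f) - armV j f"
    by (simp add: sum_diff1 Compl_eq_Diff_UNIV)
  ultimately show ?thesis by simp
qed

lemma direction_dirichlet:
  assumes f: "trial f" "x \<notin> bar j"
  shows "pi^2 * (LBINT s. (f (upd j x s))^2) \<le> (LBINT s. (pd j f (upd j x s))^2)"
proof -
  obtain M where "line_fun (\<lambda>s. f (upd j x s)) (\<lambda>s. pd j f (upd j x s)) M" using trial_line[OF f(1)] by blast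
  then show ?thesis by (rule line_dirichlet) (use trial_zero_off_bar[OF f] in auto)
qed

text \<open>The case of a density with a constant weight \<open>a\<close> in the cube and a weight \<open>b\<close> that depends on
  the distance along the arm.\<close>

lemma direction_weight:
  assumes f: "trial f" and c: "c \<ge> 0" and b: "b \<in> borel_measurable borel" "\<And>s. \<bar>b s\<bar> \<le> B"
    and D: "\<And>x. x \<notin> bar j \<Longrightarrow> c * (LBINT s. (f (upd j x s))^2) \<le> (LBINT s. (pd j f (upd j x s))^2)"
    and core: "\<And>x. x \<in> bar j \<Longrightarrow> (LBINT s. (if \<bar>s\<bar> < 1/2 then a else b s) * (f (upd j x s))^2) \<le> (LBINT s. (pd j f (upd j x s))^2)"
  shows "a * cubeV f + (LBINT x. inA j x * b (x $ j) * (f x)^2) + c * ((\<Sum>k\<in>UNIV. armV k f) - armV j f)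
    \<le> (LBINT x. (pd j f x)^2)"
proof -
  let ?H = "\<lambda>x. a * (inQ x * (f x)^2) + inA j x * b (x $ j) * (f x)^2"
  have [measurable]: "b \<in> borel_measurable borel" by (rule b)
  have "0 \<le> B" using b(2)[of 0] by linarith
  then have t1: "tame (\<lambda>x. inA j x * b (x $ j) * (f x)^2)"
    by (intro tame_weight[OF f, where C=B]) (use b(2) in \<open>auto simp: inA_def\<close>)
  have t2: "tame (\<lambda>x. a * (inQ x * (f x)^2))" by (intro tame_cmult tame_inQ continuous_intros trialD[OF f])
  have t: "tame ?H" by (intro tame_add t1 t2)
  have "(LBINT x. ?H x) + c * ((\<Sum>k\<in>UNIV. armV k f) - armV j f) \<le> (LBINT x. (pd j f x)^2)"
  proof (rule direction_bound[OF f c t D])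
    fix x assume x: "x \<in> bar j"
    have "?H (upd j x s) = (if \<bar>s\<bar> < 1/2 then a else b s) * (f (upd j x s))^2" for s
      using x by (simp add: inQ_upd inA_def bar_upd)
    then show "(LBINT s. ?H (upd j x s)) \<le> (LBINT s. (pd j f (upd j x s))^2)"
      using core[OF x] by simp
  next
    fix x assume "x \<notin> bar j"
    then show "?H x = 0" using inQ_upd[of j x "x $ j"] by (simp add: inA_def)
  qed
  moreover have "(LBINT x. ?H x) = a * cubeV f + (LBINT x. inA j x * b (x $ j) * (f x)^2)"
    unfolding cubeV_def using Bochner_Integration.integral_add[OF tame_integrable[OF t2] tame_integrable[OF t1]] by simp
  ultimately show ?thesis by simp
qed

lemma direction_hardy:
  assumes f: "trial f"
  shows "- 5/4 * cubeV f + (LBINT x. inA j x * (1 / (4 * (\<bar>x $ j\<bar> + 1/2)^2)) * (f x)^2)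
     + pi^2 * ((\<Sum>k\<in>UNIV. armV k f) - armV j f) \<le> (LBINT x. (pd j f x)^2)"
proof (rule direction_weight[OF f, where B=1 and b="\<lambda>s. 1 / (4 * (\<bar>s\<bar> + 1/2)^2)"])
  show "\<bar>1 / (4 * (\<bar>s\<bar> + 1/2)^2)\<bar> \<le> 1" for s :: real
  proof -
    have "(1/2)^2 \<le> (\<bar>s\<bar> + 1/2)^2" by (intro power_mono) auto
    then have "1 \<le> 4 * (\<bar>s\<bar> + 1/2)^2" by (simp add: power2_eq_square)
    then show ?thesis by simp
  qed
  show "(LBINT s. (if \<bar>s\<bar> < 1/2 then - 5/4 else 1 / (4 * (\<bar>s\<bar> + 1/2)^2)) * (f (upd j x s))^2)
      \<le> (LBINT s. (pd j f (upd j x s))^2)" for x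
    using trial_line[OF f, of j x] line_hardy by blast
qed (use direction_dirichlet[OF f] in auto)

text \<open>Every arm receives \<open>\<pi>\<^sup>2\<close> from each of its two transversal directions, which compensates the
  threshold \<open>2\<pi>\<^sup>2\<close> exactly; the Hardy terms of the longitudinal directions remain.\<close>

lemma energy_hardy:
  assumes f: "trial f"
  shows "(\<Sum>j\<in>UNIV. LBINT x. inA j x * (1 / (4 * (\<bar>x $ j\<bar> + 1/2)^2)) * (f x)^2) - (2 * pi^2 + 15/4) * cubeV f \<le> energy f"
proof -
  define S where "S = (\<Sum>k\<in>UNIV. armV k f)"
  define h where "h j = (LBINT x. inA j x * (1 / (4 * (\<bar>x $ j\<bar> + 1/2)^2)) * (f x)^2)" for j
  have "(\<Sum>j\<in>UNIV. - 5/4 * cubeV f + h j + pi^2 * (S - armV j f)) \<le> (\<Sum>j\<in>UNIV. LBINT x. (pd j f x)^2)"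
    unfolding S_def h_def by (intro sum_mono direction_hardy f)
  also have "(\<Sum>j\<in>(UNIV::3 set). - 5/4 * cubeV f + h j + pi^2 * (S - armV j f))
      = (\<Sum>j\<in>UNIV. h j) - 15/4 * cubeV f + pi^2 * (3 * S - S)"
    unfolding S_def by (simp add: sum.distrib sum_subtractf sum_distrib_left[symmetric] right_diff_distrib)
  finally show ?thesis unfolding energy_def integral_square_split[OF f] S_def[symmetric] h_def[symmetric]
    by (simp add: algebra_simps)
qed


section \<open>Reflection symmetry\<close>

text \<open>The reflection in the plane \<open>x\<^sub>j = 0\<close>, a symmetry of the domain.\<close>

definition mirror :: "3 \<Rightarrow> real^3 \<Rightarrow> real^3" where
  "mirror j x = upd j x (- x $ j)"

lemma mirror_upd: "mirror j (upd j x s) = upd j x (- s)"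
  by (simp add: mirror_def)

lemma mirror_nth: "mirror j x $ k = (if k = j then - x $ k else x $ k)"
  by (auto simp: mirror_def upd_nth)

lemma mirror_mirror [simp]: "mirror j (mirror j x) = x" by (simp add: vec_eq_iff mirror_nth)

lemma mirror_commute: "mirror i (mirror j x) = mirror j (mirror i x)" by (simp add: vec_eq_iff mirror_nth)

lemma bounded_linear_mirror: "bounded_linear (mirror j)"
  by (intro linear_conv_bounded_linear[THEN iffD1] linearI) (simp_all add: vec_eq_iff mirror_nth)

lemma continuous_on_mirror [continuous_intros]: "continuous_on S f \<Longrightarrow> continuous_on S (\<lambda>x. mirror j (f x))"
  by (rule bounded_linear.continuous_on[OF bounded_linear_mirror])

lemma norm_mirror [simp]: "norm (mirror j x) = norm x"
  unfolding norm_vec_def by (rule L2_set_cong) (auto simp: mirror_nth)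

lemma abs_mirror_nth [simp]: "\<bar>mirror j x $ k\<bar> = \<bar>x $ k\<bar>" by (simp add: mirror_nth)

lemma bar_mirror [simp]: "mirror j x \<in> bar k \<longleftrightarrow> x \<in> bar k" by (simp add: bar_def)

lemma Omega_mirror [simp]: "mirror j x \<in> Omega \<longleftrightarrow> x \<in> Omega" by (simp add: Omega_def)

lemma inQ_mirror [simp]: "inQ (mirror j x) = inQ x" by (simp add: inQ_def)

lemma tame_mirror: assumes "tame F" shows "tame (\<lambda>x. F (mirror j x))"
proof -
  obtain C M where F: "F \<in> borel_measurable borel" "\<And>x. \<bar>F x\<bar> \<le> C" "\<And>x. norm x > M \<Longrightarrow> F x = 0"
    using assms unfolding tame_def by blast
  have "mirror j \<in> borel_measurable borel"
    by (intro borel_measurable_continuous_onI continuous_on_mirror continuous_on_id)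
  from measurable_compose[OF this F(1)] F show ?thesis by (intro tameI[where C=C and M=M]) auto
qed

lemma integral_mirror: assumes "tame F" shows "(LBINT x. F (mirror j x)) = (LBINT x. F x)"
proof (rule integral_eq_slices[OF tame_mirror[OF assms] assms, where j=j])
  fix x
  show "(LBINT s. F (mirror j (upd j x s))) = (LBINT s. F (upd j x s))"
    unfolding mirror_upd using lborel_integral_real_affine[of "-1" "\<lambda>s. F (upd j x s)" 0] by simp
qed

definition even_part :: "3 \<Rightarrow> (real^3 \<Rightarrow> real) \<Rightarrow> real^3 \<Rightarrow> real" where
  "even_part j f x = (f x + f (mirror j x)) / 2"

definition odd_part :: "3 \<Rightarrow> (real^3 \<Rightarrow> real) \<Rightarrow> real^3 \<Rightarrow> real" where
  "odd_part j f x = (f x - f (mirror j x)) / 2"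

lemma mirror_axis: "mirror j (axis k 1) = (if k = j then -1 else 1) *\<^sub>R axis k 1"
  by (auto simp: vec_eq_iff mirror_nth axis_def)

lemma pd_mirror:
  assumes "trial f"
  shows "pd k (\<lambda>x. f (mirror j x)) x = (if k = j then -1 else 1) * pd k f (mirror j x)"
proof -
  have D: "((\<lambda>x. f (mirror j x)) has_derivative (\<lambda>h. dir_deriv (mirror j h) f (mirror j x))) (at x)"
    by (rule has_derivative_compose[OF bounded_linear_imp_has_derivative[OF bounded_linear_mirror]
      dir_deriv_has_derivative[OF trialD(1)[OF assms]]])
  show ?thesis
    unfolding dir_deriv_eqI[OF D] mirror_axis
      linear_scale[OF bounded_linear.linear[OF dir_deriv_linear[OF trialD(1)[OF assms]]]] by simp
qed

lemma trial_mirror: assumes "trial f" shows "trial (\<lambda>x. f (mirror j x))"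
proof -
  obtain M where "\<And>x. norm x > M \<Longrightarrow> f x = 0" using assms unfolding trial_def by blast
  then have "\<forall>x. norm x > M \<longrightarrow> f (mirror j x) = 0" by simp
  moreover have "C_diff 1 (\<lambda>x. f (mirror j x + 0))"
    using assms unfolding trial_def by (intro C_diff_comp_affine[OF bounded_linear_mirror]) simp
  ultimately show ?thesis using assms unfolding trial_def by (simp del: C_diff.simps) blast
qed

lemma trial_combination:
  assumes "trial f" "trial g" shows "trial (\<lambda>x. a * f x + b * g x)"
proof -
  obtain M M' where "\<And>x. norm x > M \<Longrightarrow> f x = 0" "\<And>x. norm x > M' \<Longrightarrow> g x = 0"
    using assms unfolding trial_def by blast
  then have "\<exists>M. \<forall>x. norm x > M \<longrightarrow> a * f x + b * g x = 0" by (intro exI[of _ "max M M'"]) auto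
  moreover have "C_diff 1 (\<lambda>x. a * f x + b * g x)"
    using assms unfolding trial_def by (intro C_diff_add C_diff_mult C_diff_const) auto
  ultimately show ?thesis using assms unfolding trial_def by auto
qed

lemma dir_deriv_combination:
  fixes f g :: "'a::euclidean_space \<Rightarrow> real"
  assumes "f differentiable (at x)" "g differentiable (at x)"
  shows "dir_deriv h (\<lambda>x. a * f x + b * g x) x = a * dir_deriv h f x + b * dir_deriv h g x"
  by (rule dir_deriv_eqI)
    (intro has_derivative_add has_derivative_mult_right dir_deriv_has_derivative assms)

lemma even_part_eq: "even_part j f = (\<lambda>x. (1/2) * f x + (1/2) * f (mirror j x))"
  and odd_part_eq: "odd_part j f = (\<lambda>x. (1/2) * f x + (-1/2) * f (mirror j x))"
  by (auto simp: even_part_def odd_part_def field_simps)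

lemma trial_even_part: "trial f \<Longrightarrow> trial (even_part j f)" and trial_odd_part: "trial f \<Longrightarrow> trial (odd_part j f)"
  unfolding even_part_eq odd_part_eq by (intro trial_combination trial_mirror; assumption)+

lemma pd_even_part: "trial f \<Longrightarrow> pd k (even_part j f) = (if k = j then odd_part j (pd k f) else even_part j (pd k f))"
  and pd_odd_part: "trial f \<Longrightarrow> pd k (odd_part j f) = (if k = j then even_part j (pd k f) else odd_part j (pd k f))"
  unfolding even_part_eq odd_part_eq
  by (simp_all only: fun_eq_iff dir_deriv_combination[OF trialD(1) trialD(1)[OF trial_mirror]] pd_mirror)
    (auto simp: field_simps)

text \<open>The parallelogram law \<open>e\<^sup>2 + o\<^sup>2 = (h\<^sup>2 + (h \<circ> mirror)\<^sup>2) / 2\<close>, integrated against an invariant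
  weight.\<close>

lemma integral_parity_split:
  assumes w: "w \<in> borel_measurable borel" "\<And>x. \<bar>w x\<bar> \<le> C" "\<And>x. w (mirror j x) = w x"
    and h: "continuous_on UNIV h" "\<And>x. norm x > M \<Longrightarrow> h x = 0"
  shows "(LBINT x. w x * (h x)^2) = (LBINT x. w x * (even_part j h x)^2) + (LBINT x. w x * (odd_part j h x)^2)"
proof -
  have hr: "continuous_on UNIV (\<lambda>x. h (mirror j x))"
    by (rule continuous_on_compose2[OF h(1)]) (auto intro!: continuous_intros)
  have t: "tame (\<lambda>x. w x * (g x)^2)" if "continuous_on UNIV g" "\<And>x. norm x > M \<Longrightarrow> g x = 0" for g
    by (rule tame_mult_bounded[OF w(1,2) tame_continuous_support[where M=M]]) (use that in \<open>auto intro!: continuous_intros\<close>)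
  have te: "tame (\<lambda>x. w x * (even_part j h x)^2)" and to: "tame (\<lambda>x. w x * (odd_part j h x)^2)"
    by (rule t; use h hr in \<open>auto simp: even_part_def odd_part_def intro!: continuous_intros\<close>)+
  have th: "tame (\<lambda>x. w x * (h x)^2)" using t h by blast
  have r: "(LBINT x. w x * (h (mirror j x))^2) = (LBINT x. w x * (h x)^2)"
    using integral_mirror[OF th, of j] w(3) by simp
  have tr: "tame (\<lambda>x. w x * (h (mirror j x))^2)" using tame_mirror[OF th, of j] w(3) by simp
  have "(LBINT x. w x * (even_part j h x)^2) + (LBINT x. w x * (odd_part j h x)^2)
    = (LBINT x. w x * (even_part j h x)^2 + w x * (odd_part j h x)^2)"
    by (rule Bochner_Integration.integral_add[symmetric]) (intro tame_integrable te to)+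
  also have "\<dots> = (LBINT x. (1/2) * (w x * (h x)^2) + (1/2) * (w x * (h (mirror j x))^2))"
    by (rule Bochner_Integration.integral_cong) (auto simp: even_part_def odd_part_def power2_eq_square field_simps)
  also have "\<dots> = (1/2) * (LBINT x. w x * (h x)^2) + (1/2) * (LBINT x. w x * (h (mirror j x))^2)"
    by (subst Bochner_Integration.integral_add) (auto intro!: tame_integrable th tr tame_divide)
  finally show ?thesis unfolding r by simp
qed

text \<open>A derivative of an even or odd part is again the even or odd part of a derivative, with the
  parity exchanged in the direction of reflection.\<close>

lemma energy_parity:
  assumes f: "trial f"
  shows "energy f = energy (even_part j f) + energy (odd_part j f)"
proof -
  obtain M where M: "\<And>x. norm x \<ge> M \<Longrightarrow> f x = 0" "\<And>h x. norm x \<ge> M \<Longrightarrow> dir_deriv h f x = 0"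
    using trial_support[OF f] by metis
  have 1: "(LBINT x. (h x)^2) = (LBINT x. (even_part j h x)^2) + (LBINT x. (odd_part j h x)^2)"
    if "continuous_on UNIV h" "\<And>x. norm x > M \<Longrightarrow> h x = 0" for h
    using integral_parity_split[of "\<lambda>_. 1" 1 j h M] that by simp
  have "(LBINT x. (pd k f x)^2) = (LBINT x. (pd k (even_part j f) x)^2) + (LBINT x. (pd k (odd_part j f) x)^2)" for k
    unfolding pd_even_part[OF f] pd_odd_part[OF f] using 1[OF trialD(3)[OF f], of "axis k 1"] M by auto
  then show ?thesis unfolding energy_def
    using 1[OF trialD(2)[OF f]] M by (simp add: sum.distrib algebra_simps)
qed

lemma cubeV_parity: assumes f: "trial f" shows "cubeV f = cubeV (even_part j f) + cubeV (odd_part j f)"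
proof -
  obtain M where M: "\<And>x. norm x \<ge> M \<Longrightarrow> f x = 0" using trial_support[OF f] by metis
  show ?thesis unfolding cubeV_def
    by (rule integral_parity_split[where C=1 and M=M]) (use M trialD[OF f] in \<open>auto simp: inQ_def\<close>)
qed

lemma cubeM_even_part: assumes f: "trial f" shows "cubeM (even_part j f) = cubeM f"
proof -
  have t: "tame (\<lambda>x. inQ x * f x)" by (intro tame_inQ trialD[OF f])
  have "cubeM (even_part j f) = (LBINT x. (1/2) * (inQ x * f x) + (1/2) * (inQ (mirror j x) * f (mirror j x)))"
    unfolding cubeM_def by (rule Bochner_Integration.integral_cong) (auto simp: even_part_def algebra_simps add_divide_distrib)
  also have "\<dots> = (1/2) * cubeM f + (1/2) * (LBINT x. inQ (mirror j x) * f (mirror j x))"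
    unfolding cubeM_def using tame_mirror[OF t, of j]
    by (subst Bochner_Integration.integral_add) (auto intro!: tame_integrable t tame_divide)
  also have "(LBINT x. inQ (mirror j x) * f (mirror j x)) = cubeM f"
    unfolding cubeM_def by (rule integral_mirror[OF t])
  finally show ?thesis by simp
qed


section \<open>Coercivity\<close>

lemma direction_even:
  assumes f: "trial f" and even: "\<And>x. f (mirror j x) = f x"
  shows "4 * pi^2 * cubeV (\<lambda>x. f x - avg j f x) + pi^2 * ((\<Sum>k\<in>UNIV. armV k f) - armV j f)
    \<le> (LBINT x. (pd j f x)^2)"
proof -
  let ?H = "\<lambda>x. 4 * pi^2 * (inQ x * (f x - avg j f x)^2)"
  have t: "tame ?H" by (intro tame_cmult tame_inQ continuous_intros continuous_on_avg trialD[OF f])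
  have "(LBINT x. ?H x) + pi^2 * ((\<Sum>k\<in>UNIV. armV k f) - armV j f) \<le> (LBINT x. (pd j f x)^2)"
  proof (rule direction_bound[OF f _ t])
    fix x assume x: "x \<in> bar j"
    obtain M where l: "line_fun (\<lambda>s. f (upd j x s)) (\<lambda>s. pd j f (upd j x s)) M" using trial_line[OF f] by blast
    have "4 * pi^2 * (LBINT s. (if \<bar>s\<bar> < 1/2 then 1 else 0) * (f (upd j x s) - avg j f x)^2)
      \<le> (LBINT s. (pd j f (upd j x s))^2)"
      by (rule line_even[OF l]) (use even[of "upd j x _"] mirror_upd in \<open>auto simp: avg_def\<close>)
    then show "(LBINT s. ?H (upd j x s)) \<le> (LBINT s. (pd j f (upd j x s))^2)"
      using x by (simp add: inQ_upd)
  next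
    fix x assume "x \<notin> bar j"
    then show "?H x = 0" using inQ_upd[of j x "x $ j"] by simp
  qed (use direction_dirichlet[OF f] in auto)
  then show ?thesis by (simp add: cubeV_def)
qed

text \<open>The mean over the cube is the only obstruction here: off the constants the constant \<open>4\<pi>\<^sup>2\<close>
  exceeds the threshold.\<close>

lemma energy_even:
  assumes f: "trial f" and even: "\<And>j x. f (mirror j x) = f x"
  shows "2 * pi^2 * cubeV f - 4 * pi^2 * (cubeM f)^2 \<le> energy f"
proof -
  define S where "S = (\<Sum>k\<in>UNIV. armV k f)"
  define v where "v j = cubeV (\<lambda>x. f x - avg j f x)" for j
  have "(\<Sum>j\<in>UNIV. 4 * pi^2 * v j + pi^2 * (S - armV j f)) \<le> (\<Sum>j\<in>UNIV. LBINT x. (pd j f x)^2)"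
    unfolding S_def v_def by (intro sum_mono direction_even f even)
  also have "(\<Sum>j\<in>(UNIV::3 set). 4 * pi^2 * v j + pi^2 * (S - armV j f)) = 4 * pi^2 * (\<Sum>j\<in>UNIV. v j) + pi^2 * (3 * S - S)"
    unfolding S_def by (simp add: sum.distrib sum_subtractf sum_distrib_left[symmetric] right_diff_distrib)
  finally have "4 * pi^2 * (\<Sum>j\<in>UNIV. v j) + 2 * pi^2 * S \<le> (\<Sum>j\<in>UNIV. LBINT x. (pd j f x)^2)" by simp
  moreover have "4 * pi^2 * (cubeV f - (cubeM f)^2) \<le> 4 * pi^2 * (\<Sum>j\<in>UNIV. v j)"
    unfolding v_def cubeM_def by (intro mult_left_mono efron_stein trialD[OF f]) auto
  ultimately show ?thesis unfolding energy_def integral_square_split[OF f] S_def[symmetric]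
    by (simp add: algebra_simps)
qed

text \<open>Lines in direction \<open>j\<close> that cross another arm carry a function that is odd between two Dirichlet
  ends; this is where the surplus \<open>4\<pi>\<^sup>2 - \<pi>\<^sup>2 = 3\<pi>\<^sup>2\<close> of the two other arms comes from.\<close>

lemma direction_odd:
  assumes f: "trial f" and odd: "\<And>x. f (mirror j x) = - f x"
  shows "pi^2 * cubeV f + 4 * pi^2 * ((\<Sum>k\<in>UNIV. armV k f) - armV j f) \<le> (LBINT x. (pd j f x)^2)"
proof -
  have oddl: "f (upd j x (- s)) = - f (upd j x s)" for x s
    using odd[of "upd j x s"] by (simp add: mirror_upd)
  have "pi^2 * cubeV f + (LBINT x. inA j x * 0 * (f x)^2) + (4 * pi^2) * ((\<Sum>k\<in>UNIV. armV k f) - armV j f)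
      \<le> (LBINT x. (pd j f x)^2)"
  proof (rule direction_weight[OF f, where B=0 and b="\<lambda>_. 0"])
    fix x
    obtain M where l: "line_fun (\<lambda>s. f (upd j x s)) (\<lambda>s. pd j f (upd j x s)) M" using trial_line[OF f] by blast
    show "(LBINT s. (if \<bar>s\<bar> < 1/2 then pi^2 else 0) * (f (upd j x s))^2) \<le> (LBINT s. (pd j f (upd j x s))^2)"
      by (rule line_odd[OF l oddl])
    show "(4 * pi^2) * (LBINT s. (f (upd j x s))^2) \<le> (LBINT s. (pd j f (upd j x s))^2)" if x: "x \<notin> bar j"
      by (rule line_dirichlet_odd[OF l _ oddl]) (rule trial_zero_off_bar[OF f x])
  qed auto
  then show ?thesis by simp
qed

text \<open>For \<open>f\<close> odd in another direction, the term \<open>- 3\<pi>\<^sup>2\<close> is paid for by the surplus from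
  \<open>direction_odd\<close>.\<close>

lemma direction_robin:
  assumes f: "trial f"
  shows "(71/100 * pi)^2 * cubeV f - 3 * pi^2 * armV j f + pi^2 * ((\<Sum>k\<in>UNIV. armV k f) - armV j f)
    \<le> (LBINT x. (pd j f x)^2)"
proof -
  have "(71/100 * pi)^2 * cubeV f + (LBINT x. inA j x * (- 3 * pi^2) * (f x)^2) + pi^2 * ((\<Sum>k\<in>UNIV. armV k f) - armV j f)
    \<le> (LBINT x. (pd j f x)^2)"
  proof (rule direction_weight[OF f, where B="3 * pi^2" and b="\<lambda>_. - 3 * pi^2"])
    show "(LBINT s. (if \<bar>s\<bar> < 1/2 then (71/100 * pi)^2 else - 3 * pi^2) * (f (upd j x s))^2)
      \<le> (LBINT s. (pd j f (upd j x s))^2)" for x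
      using trial_line[OF f, of j x] line_robin by blast
  qed (use direction_dirichlet[OF f] in auto)
  moreover have "(\<lambda>x. inA j x * (- 3 * pi^2) * (f x)^2) = (\<lambda>x. (- 3 * pi^2) * (inA j x * (f x)^2))"
    by (simp add: mult_ac fun_eq_iff)
  ultimately show ?thesis unfolding armV_def by (simp only: Bochner_Integration.integral_mult_right_zero)
qed

text \<open>On the cube \<open>\<pi>\<^sup>2 + 2 (0.71 \<pi>)\<^sup>2\<close> exceeds \<open>2\<pi>\<^sup>2\<close> by slightly more than \<open>\<pi>\<^sup>2/125\<close>; on the arms
  everything cancels.\<close>

lemma energy_odd:
  assumes f: "trial f" and odd: "\<And>x. f (mirror j x) = - f x"
  shows "pi^2 / 125 * cubeV f \<le> energy f"
proof -
  define S where "S = (\<Sum>k\<in>UNIV. armV k f)"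
  let ?E = "\<lambda>k. LBINT x. (pd k f x)^2"
  have S: "(\<Sum>k\<in>-{j}. armV k f) = S - armV j f"
    unfolding S_def by (simp add: sum_diff1 Compl_eq_Diff_UNIV)
  have card: "card (-{j}) = 2" by (simp add: Compl_eq_Diff_UNIV card_Diff_singleton)
  have "(\<Sum>k\<in>-{j}. (71/100 * pi)^2 * cubeV f - 3 * pi^2 * armV k f + pi^2 * (S - armV k f)) \<le> (\<Sum>k\<in>-{j}. ?E k)"
    unfolding S_def by (intro sum_mono direction_robin f)
  also have "(\<Sum>k\<in>-{j}. (71/100 * pi)^2 * cubeV f - 3 * pi^2 * armV k f + pi^2 * (S - armV k f))
    = 2 * (71/100 * pi)^2 * cubeV f - 3 * pi^2 * (S - armV j f) + pi^2 * (2 * S - (S - armV j f))"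
    unfolding S[symmetric]
    by (simp add: sum.distrib sum_subtractf sum_distrib_left[symmetric] sum_distrib_right[symmetric] right_diff_distrib card)
  finally have 1: "2 * (71/100 * pi)^2 * cubeV f - 3 * pi^2 * (S - armV j f) + pi^2 * (2 * S - (S - armV j f))
      \<le> (\<Sum>k\<in>-{j}. ?E k)" .
  have 2: "(\<Sum>k\<in>UNIV. ?E k) = ?E j + (\<Sum>k\<in>-{j}. ?E k)"
    by (simp add: sum_diff1 Compl_eq_Diff_UNIV)
  have "pi^2 * cubeV f + 2 * (71/100 * pi)^2 * cubeV f + 2 * pi^2 * S \<le> (\<Sum>k\<in>UNIV. ?E k)"
    unfolding 2 using 1 direction_odd[OF f odd] unfolding S_def[symmetric] by (simp add: algebra_simps)
  moreover have "pi^2 / 125 * cubeV f + 2 * pi^2 * cubeV f \<le> pi^2 * cubeV f + 2 * (71/100 * pi)^2 * cubeV f"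
  proof -
    have "(pi^2 * cubeV f) * (1/125 + 2) \<le> (pi^2 * cubeV f) * (1 + 2 * (71/100)^2)"
      using cubeV_nonneg[of f] by (intro mult_left_mono) (auto simp: power2_eq_square)
    then show ?thesis unfolding power_mult_distrib by (simp add: algebra_simps)
  qed
  ultimately show ?thesis unfolding energy_def integral_square_split[OF f] S_def[symmetric]
    by (simp add: algebra_simps)
qed

text \<open>Peel off the odd part in \<open>x\<^sub>1\<close>, then in \<open>x\<^sub>2\<close>, then in \<open>x\<^sub>3\<close>. Only the last remainder, even in
  all variables, sees the mean over the cube.\<close>

lemma energy_cube_bound:
  assumes f: "trial f"
  shows "pi^2 / 125 * cubeV f - 4 * pi^2 * (cubeM f)^2 \<le> energy f"
proof -
  define f1 where "f1 = even_part 1 f"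
  define f2 where "f2 = even_part 2 f1"
  define f3 where "f3 = even_part 3 f2"
  have t: "trial f1" "trial f2" "trial f3" unfolding f1_def f2_def f3_def by (intro trial_even_part f)+
  have odd: "pi^2 / 125 * cubeV (odd_part j g) \<le> energy (odd_part j g)" if "trial g" for j g
    by (rule energy_odd[where j=j]) (auto simp: trial_odd_part that odd_part_def field_simps)
  have ev: "f3 (mirror j x) = f3 x" for j x
  proof -
    have "j \<in> {1,2,3}" using exhaust_3[of j] by auto
    then show ?thesis
      unfolding f3_def f2_def f1_def even_part_def
      by (auto simp: mirror_commute[of 2 1] mirror_commute[of 3 1] mirror_commute[of 3 2] add.commute add.left_commute)
  qed
  have "pi^2 / 125 * cubeV f3 \<le> 2 * pi^2 * cubeV f3" using cubeV_nonneg[of f3] by (intro mult_right_mono) auto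
  then have e3: "pi^2 / 125 * cubeV f3 - 4 * pi^2 * (cubeM f3)^2 \<le> energy f3"
    using energy_even[OF t(3) ev] by linarith
  have "energy f = energy (odd_part 1 f) + (energy (odd_part 2 f1) + (energy (odd_part 3 f2) + energy f3))"
    using energy_parity[OF f, of 1] energy_parity[OF t(1), of 2] energy_parity[OF t(2), of 3]
    unfolding f1_def f2_def f3_def by simp
  moreover have "cubeV f = cubeV (odd_part 1 f) + (cubeV (odd_part 2 f1) + (cubeV (odd_part 3 f2) + cubeV f3))"
    using cubeV_parity[OF f, of 1] cubeV_parity[OF t(1), of 2] cubeV_parity[OF t(2), of 3]
    unfolding f1_def f2_def f3_def by simp
  moreover have "cubeM f3 = cubeM f"
    using cubeM_even_part f t unfolding f3_def f2_def f1_def by simp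
  ultimately show ?thesis using odd[OF f, of 1] odd[OF t(1), of 2] odd[OF t(2), of 3] e3
    by (simp add: distrib_left)
qed

definition rho :: "real^3 \<Rightarrow> real" where
  "rho x = 1 / (4 * (norm x + 1/2)^2)"

lemma rho_bounds: "0 < rho x" "rho x \<le> 1"
proof -
  have "(1/2)^2 \<le> (norm x + 1/2)^2" by (intro power_mono) auto
  moreover have "norm x * 2 + 1 \<noteq> 0" using norm_ge_zero[of x] by linarith
  ultimately have "1 \<le> 4 * (norm x + 1/2)^2" "norm x * 2 + 1 \<noteq> 0" by (simp_all add: power2_eq_square)
  then show "0 < rho x" "rho x \<le> 1" unfolding rho_def by (auto simp: divide_simps)
qed

lemma measurable_rho [measurable]: "rho \<in> borel_measurable borel"
  unfolding rho_def[abs_def] by measurable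

text \<open>A convex combination of \<open>energy_cube_bound\<close>, which controls the cube, and of a small multiple of
  \<open>energy_hardy\<close>, which controls the arms at the expense of the cube.\<close>

lemma energy_coercive:
  "\<exists>k>0. \<exists>C. \<forall>f. trial f \<longrightarrow> k * (LBINT x. rho x * (f x)^2) \<le> energy f + C * (cubeM f)^2"
proof -
  define n where "n = pi^2 / 125"
  define K where "K = 2 * pi^2 + 15/4 + n + 1"
  \<comment> \<open>The weight of the Hardy estimate: \<open>K\<close> adds up what it takes from the cube, plus one unit that is left over.\<close>
  define e where "e = n / K"
  have n: "n > 0" by (simp add: n_def)
  have K: "K > 0" "K \<ge> n" unfolding K_def using n by (auto intro: add_pos_nonneg add_nonneg_nonneg)
  have e: "e > 0" "e \<le> 1" "e * K = n" using n K by (auto simp: e_def)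
  have "e * (LBINT x. rho x * (f x)^2) \<le> energy f + 4 * pi^2 * (cubeM f)^2" if f: "trial f" for f
  proof -
    let ?w = "\<lambda>j x. inA j x * (1 / (4 * (\<bar>x $ j\<bar> + 1/2)^2))"
    define h where "h j = (LBINT x. ?w j x * (f x)^2)" for j
    have w1: "\<bar>?w j x\<bar> \<le> 1" "inA j x * rho x \<le> ?w j x" for j x
    proof -
      have "\<bar>?w j x\<bar> \<le> 1 \<and> inA j x * rho x \<le> ?w j x"
      proof (cases "inA j x = 0")
        case False
        then have *: "\<bar>x $ j\<bar> \<ge> 1/2" "inA j x = 1" by (auto simp: inA_def split: if_splits)
        then have "1^2 \<le> (\<bar>x $ j\<bar> + 1/2)^2" by (intro power_mono) auto
        moreover have "(\<bar>x $ j\<bar> + 1/2)^2 \<le> (norm x + 1/2)^2"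
          using component_le_norm_cart[of x j] by (intro power_mono) auto
        ultimately show ?thesis using * unfolding rho_def by (auto simp: divide_simps)
      qed simp
      then show "\<bar>?w j x\<bar> \<le> 1" "inA j x * rho x \<le> ?w j x" by auto
    qed
    have tw: "tame (\<lambda>x. ?w j x * (f x)^2)" for j by (rule tame_weight[OF f _ w1(1)]) measurable
    have tq: "tame (\<lambda>x. inQ x * (f x)^2)" by (intro tame_inQ continuous_intros trialD[OF f])
    have tr: "tame (\<lambda>x. rho x * (f x)^2)"
      by (rule tame_weight[OF f, where C=1]) (use rho_bounds in \<open>auto simp: abs_of_pos\<close>)
    have "(LBINT x. rho x * (f x)^2) \<le> (LBINT x. inQ x * (f x)^2 + (\<Sum>j\<in>UNIV. ?w j x * (f x)^2))"
    proof (rule integral_mono)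
      fix x
      have "rho x * (f x)^2 = inQ x * (rho x * (f x)^2) + (\<Sum>j\<in>UNIV. inA j x * (rho x * (f x)^2))"
        by (rule cube_arms_decomposition) (use trialD(4)[OF f] in auto)
      also have "\<dots> \<le> inQ x * (1 * (f x)^2) + (\<Sum>j\<in>UNIV. ?w j x * (f x)^2)"
      proof (intro add_mono sum_mono)
        show "inQ x * (rho x * (f x)^2) \<le> inQ x * (1 * (f x)^2)"
          by (intro mult_left_mono mult_right_mono rho_bounds) (auto simp: inQ_def)
        show "inA j x * (rho x * (f x)^2) \<le> ?w j x * (f x)^2" for j
          using mult_right_mono[OF w1(2)[of j x], of "(f x)^2"] by (simp add: mult.assoc)
      qed
      finally show "rho x * (f x)^2 \<le> inQ x * (f x)^2 + (\<Sum>j\<in>UNIV. ?w j x * (f x)^2)" by simp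
    qed (intro tame_integrable tr tame_add tame_sum tq tw finite)+
    also have "\<dots> = cubeV f + (\<Sum>j\<in>UNIV. h j)"
      unfolding cubeV_def h_def
      by (subst Bochner_Integration.integral_add, (intro tame_integrable tame_sum tq tw finite)+,
        subst Bochner_Integration.integral_sum, (intro tame_integrable tw)+) simp
    finally have "e * (LBINT x. rho x * (f x)^2) \<le> e * (cubeV f + (\<Sum>j\<in>UNIV. h j))"
      using e(1) by simp
    moreover have "e * ((\<Sum>j\<in>UNIV. h j) - (2 * pi^2 + 15/4) * cubeV f) \<le> e * energy f"
      using energy_hardy[OF f] e(1) unfolding h_def by simp
    moreover have "(1 - e) * (n * cubeV f - 4 * pi^2 * (cubeM f)^2) \<le> (1 - e) * energy f"
      using energy_cube_bound[OF f] e(2) unfolding n_def by (intro mult_left_mono) auto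
    moreover have "e * (cubeV f + (\<Sum>j\<in>UNIV. h j)) - 4 * pi^2 * (cubeM f)^2
      \<le> e * ((\<Sum>j\<in>UNIV. h j) - (2 * pi^2 + 15/4) * cubeV f) + (1 - e) * (n * cubeV f - 4 * pi^2 * (cubeM f)^2)"
    proof -
      have "e * ((\<Sum>j\<in>UNIV. h j) - (2 * pi^2 + 15/4) * cubeV f) + (1 - e) * (n * cubeV f - 4 * pi^2 * (cubeM f)^2)
         - (e * (cubeV f + (\<Sum>j\<in>UNIV. h j)) - 4 * pi^2 * (cubeM f)^2)
        = (n - e * K) * cubeV f + e * (4 * pi^2 * (cubeM f)^2)"
        unfolding K_def by (simp add: algebra_simps)
      also have "\<dots> \<ge> 0" using e by simp
      finally show ?thesis by simp
    qed
    ultimately show ?thesis by (simp add: algebra_simps)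
  qed
  then show ?thesis using e(1) by blast
qed


section \<open>A test function with negative energy\<close>

lemma test_funI:
  assumes "\<And>n. C_diff n f" "closed S" "bounded S" "S \<subseteq> U" "\<And>x. f x \<noteq> 0 \<Longrightarrow> x \<in> S"
  shows "test_fun U f"
proof -
  have "closure {x. f x \<noteq> 0} \<subseteq> S" using assms by (intro closure_minimal) auto
  moreover from this have "bounded (closure {x. f x \<noteq> 0})" using assms(3) bounded_subset by blast
  ultimately show ?thesis unfolding test_fun_def using assms(1,4) by (auto simp: compact_eq_bounded_closed)
qed

lemma test_funD:
  assumes "test_fun U f"
  shows "C_diff n f" "x \<notin> U \<Longrightarrow> f x = 0"
proof -
  show "C_diff n f" using assms by (simp add: test_fun_def)
  show "f x = 0" if "x \<notin> U"
    using assms that closure_subset[of "{x. f x \<noteq> 0}"] unfolding test_fun_def by blast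
qed

lemma test_fun_trial: assumes "test_fun Omega f" shows "trial f"
proof -
  have "bounded {x. f x \<noteq> 0}"
    using assms bounded_subset[OF compact_imp_bounded closure_subset] unfolding test_fun_def by blast
  then obtain M where "\<And>x. f x \<noteq> 0 \<Longrightarrow> norm x \<le> M" unfolding bounded_iff by blast
  then have "\<forall>x. norm x > M \<longrightarrow> f x = 0" by (meson not_le)
  then show ?thesis unfolding trial_def using test_funD[OF assms] by blast
qed

lemma lborel_integral_derivative_0:
  fixes G :: "real \<Rightarrow> real"
  assumes G: "\<And>x. (G has_real_derivative g x) (at x)" "continuous_on UNIV g"
    and z: "\<And>x. \<bar>x\<bar> \<ge> M \<Longrightarrow> G x = 0" "\<And>x. \<bar>x\<bar> > M \<Longrightarrow> g x = 0" and M: "M > 0"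
  shows "(LBINT x. g x) = 0"
proof -
  have "(LBINT x. indicator {-M..M} x *\<^sub>R g x) = G M - G (- M)"
    by (rule integral_FTC_atLeastAtMost)
      (use M G in \<open>auto simp: has_real_derivative_iff_has_vector_derivative[symmetric]
        intro: has_field_derivative_at_within continuous_on_subset\<close>)
  moreover have "(\<lambda>x. indicator {-M..M} x *\<^sub>R g x) = g"
  proof
    show "indicator {-M..M} x *\<^sub>R g x = g x" for x
      using z(2)[of x] by (cases "\<bar>x\<bar> > M") (auto simp: indicator_def)
  qed
  ultimately show ?thesis using z(1)[of M] z(1)[of "-M"] M by simp
qed

lemma lborel_integral_le_width:
  fixes g :: "real \<Rightarrow> real"
  assumes "integrable lborel g" "\<And>x. g x \<le> C * indicator S x" "compact S"
  shows "(LBINT x. g x) \<le> C * measure lborel S"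
proof -
  have "(LBINT x. g x) \<le> (LBINT x. C * indicator S x)"
    by (rule integral_mono) (use assms emeasure_compact_finite in \<open>auto intro!: integrable_mult_right integrable_real_indicator borel_compact\<close>)
  then show ?thesis using borel_compact[OF assms(3)] by simp
qed

lemma lborel_integral_ge_width:
  fixes g :: "real \<Rightarrow> real"
  assumes "integrable lborel g" "\<And>x. C * indicator S x \<le> g x" "compact S"
  shows "C * measure lborel S \<le> (LBINT x. g x)"
proof -
  have "(LBINT x. C * indicator S x) \<le> (LBINT x. g x)"
    by (rule integral_mono) (use assms emeasure_compact_finite in \<open>auto intro!: integrable_mult_right integrable_real_indicator borel_compact\<close>)
  then show ?thesis using borel_compact[OF assms(3)] by simp
qed

text \<open>The product \<open>P\<^sub>1(x\<^sub>1) P\<^sub>2(x\<^sub>2) P\<^sub>3(x\<^sub>3)\<close>.\<close>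

definition tensor :: "(3 \<Rightarrow> real \<Rightarrow> real) \<Rightarrow> real^3 \<Rightarrow> real" where
  "tensor P x = (\<Prod>j\<in>UNIV. P j (x $ j))"

lemma prod3: "(\<Prod>j\<in>(UNIV::3 set). g j) = g 1 * g 2 * g 3"
  unfolding UNIV3 by (simp add: mult.assoc)

lemma sum3: "(\<Sum>j\<in>(UNIV::3 set). g j) = g 1 + g 2 + g 3"
  unfolding UNIV3 by (simp add: add.assoc)

lemma C_diff_coordinate:
  assumes "C_diff n p" shows "C_diff n (\<lambda>x::real^3. p (x $ j))"
proof -
  have "C_diff n (\<lambda>x::real^3. p (x $ j + 0))"
    by (rule C_diff_comp_affine[OF _ assms]) (rule bounded_linear_vec_nth)
  then show ?thesis by simp
qed

lemma C_diff_tensor: "(\<And>j. C_diff n (P j)) \<Longrightarrow> C_diff n (tensor P)"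
  unfolding tensor_def[abs_def] prod3 by (intro C_diff_mult C_diff_coordinate) auto

lemma tensor_has_derivative:
  assumes "\<And>j s. (P j has_real_derivative P' j s) (at s)"
  shows "(tensor P has_derivative (\<lambda>h. (P 1 (x $ 1) * P 2 (x $ 2)) * (P' 3 (x $ 3) * h $ 3)
      + (P 1 (x $ 1) * (P' 2 (x $ 2) * h $ 2) + P' 1 (x $ 1) * h $ 1 * P 2 (x $ 2)) * P 3 (x $ 3))) (at x)"
proof -
  have D: "((\<lambda>x::real^3. P j (x $ j)) has_derivative (\<lambda>h. P' j (x $ j) * h $ j)) (at x)" for j
  proof -
    have "((\<lambda>x::real^3. x $ j) has_derivative (\<lambda>h. h $ j)) (at x)"
      by (rule bounded_linear_imp_has_derivative) (rule bounded_linear_vec_nth)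
    from has_derivative_compose[OF this] assms[of j "x $ j"]
    show ?thesis by (simp add: has_field_derivative_def)
  qed
  show ?thesis unfolding tensor_def[abs_def] prod3 by (intro has_derivative_mult D)
qed

lemma tensor_differentiable:
  assumes "\<And>j s. (P j has_real_derivative P' j s) (at s)"
  shows "tensor P differentiable (at x)"
  using tensor_has_derivative[of P P', OF assms] unfolding differentiable_def by blast

lemma pd_tensor:
  assumes "\<And>j s. (P j has_real_derivative P' j s) (at s)"
  shows "pd k (tensor P) = tensor (P(k := P' k))"
proof
  fix x
  from dir_deriv_eqI[OF tensor_has_derivative[of P P', OF assms], of "axis k 1" x]
  show "pd k (tensor P) x = tensor (P(k := P' k)) x"
    using exhaust_3[of k] unfolding tensor_def prod3 by (auto simp: axis_def)
qed

lemma integral_tensor_mult: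
  assumes "\<And>j. integrable lborel (\<lambda>s. P j s * Q j s)"
  shows "(LBINT x. tensor P x * tensor Q x) = (LBINT s. P 1 s * Q 1 s) * (LBINT s. P 2 s * Q 2 s) * (LBINT s. P 3 s * Q 3 s)"
proof -
  have "(\<lambda>x. tensor P x * tensor Q x) = (\<lambda>x. \<Prod>j\<in>UNIV. P j (x $ j) * Q j (x $ j))"
    by (simp add: tensor_def fun_eq_iff prod.distrib)
  then show ?thesis
    using integral_prod_coordinates[of "\<lambda>j s. P j s * Q j s"] assms by (simp add: prod3)
qed

lemma test_fun_tensor:
  assumes P: "\<And>n j. C_diff n (P j)" and z: "\<And>j s. \<bar>s\<bar> > B j \<Longrightarrow> P j s = 0"
    and B: "\<And>k. k \<noteq> i \<Longrightarrow> B k < 1/2"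
  shows "test_fun Omega (tensor P)"
proof (rule test_funI)
  let ?S = "{x :: real^3. \<forall>j. \<bar>x $ j\<bar> \<le> B j}"
  show "C_diff n (tensor P)" for n by (rule C_diff_tensor[OF P])
  have "?S = (\<Inter>j. {x. \<bar>x $ j\<bar> \<le> B j})" by auto
  also have "closed \<dots>" by (intro closed_INT ballI closed_Collect_le continuous_intros)
  finally show "closed ?S" .
  show "bounded ?S" unfolding bounded_iff
  proof (intro exI ballI)
    fix x assume "x \<in> ?S"
    then show "norm x \<le> (\<Sum>j\<in>UNIV. B j)"
      using norm_le_l1_cart[of x] sum_mono[of UNIV "\<lambda>j. \<bar>x $ j\<bar>" B] by auto
  qed
  have "?S \<subseteq> bar i" unfolding bar_def
  proof (intro subsetI CollectI allI impI)
    fix x k assume "x \<in> ?S" "k \<noteq> i"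
    then show "\<bar>x $ k\<bar> < 1/2" using B[of k] le_less_trans[of "\<bar>x $ k\<bar>" "B k" "1/2"] by blast
  qed
  then show "?S \<subseteq> Omega" unfolding Omega_def by blast
  show "x \<in> ?S" if "tensor P x \<noteq> 0" for x
  proof -
    have "P j (x $ j) \<noteq> 0" for j using that unfolding tensor_def by (auto simp: prod_zero_iff)
    then show ?thesis using z not_le by blast
  qed
qed

lemma test_fun_add:
  assumes "test_fun U f" "test_fun U g" shows "test_fun U (\<lambda>x. f x + g x)"
proof (rule test_funI[where S="closure {x. f x \<noteq> 0} \<union> closure {x. g x \<noteq> 0}"])
  show "C_diff n (\<lambda>x. f x + g x)" for n by (intro C_diff_add test_funD[OF assms(1)] test_funD[OF assms(2)])
  show "x \<in> closure {x. f x \<noteq> 0} \<union> closure {x. g x \<noteq> 0}" if "f x + g x \<noteq> 0" for x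
  proof -
    have "f x \<noteq> 0 \<or> g x \<noteq> 0" using that by auto
    then show ?thesis
      using subsetD[OF closure_subset, of x "{x. f x \<noteq> 0}"] subsetD[OF closure_subset, of x "{x. g x \<noteq> 0}"] by blast
  qed
qed (use assms in \<open>auto simp: test_fun_def compact_imp_bounded\<close>)

text \<open>Here \<open>t\<close> is the profile across a bar and \<open>h\<close> the cutoff along it, equal to one on the support of \<open>t\<close>.
  The first two terms are the energies of the two waves, which are small. The last one is their
  interaction: it has its sign from \<open>\<integral>t'\<^sup>2 \<approx> \<pi>\<^sup>2 \<integral>t\<^sup>2\<close>, since only one of the three derivatives falls on
  the variable that both waves treat as transversal.\<close>

lemma energy_two_tensor:
  fixes h h' t t' :: "real \<Rightarrow> real"
  assumes h: "\<And>s. (h has_real_derivative h' s) (at s)" "continuous_on UNIV h'" "\<And>s. \<bar>s\<bar> > N \<Longrightarrow> h s = 0" "\<And>s. \<bar>s\<bar> > N \<Longrightarrow> h' s = 0"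
    and t: "\<And>s. (t has_real_derivative t' s) (at s)" "continuous_on UNIV t'" "\<And>s. \<bar>s\<bar> > N \<Longrightarrow> t s = 0" "\<And>s. \<bar>s\<bar> > N \<Longrightarrow> t' s = 0"
    and ht: "\<And>s. h s * t s = t s" "\<And>s. h' s * t' s = 0"
    and tr: "trial (\<lambda>x. tensor (\<lambda>j. if j = 1 then h else t) x + tensor (\<lambda>j. if j = 2 then h else t) x)"
  shows "energy (\<lambda>x. tensor (\<lambda>j. if j = 1 then h else t) x + tensor (\<lambda>j. if j = 2 then h else t) x)
    = 2 * (LBINT s. (h' s)^2) * (LBINT s. (t s)^2)^2
      + 4 * (LBINT s. (h s)^2) * (LBINT s. (t s)^2) * ((LBINT s. (t' s)^2) - pi^2 * (LBINT s. (t s)^2))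
      + 2 * (LBINT s. t s)^2 * ((LBINT s. (t' s)^2) - 2 * pi^2 * (LBINT s. (t s)^2))"
proof -
  let ?P = "\<lambda>j::3. if j = 1 then h else t" and ?Q = "\<lambda>j::3. if j = 2 then h else t"
  let ?P' = "\<lambda>j::3. if j = 1 then h' else t'" and ?Q' = "\<lambda>j::3. if j = 2 then h' else t'"
  have ch: "continuous_on UNIV h" "continuous_on UNIV t"
    using h(1) t(1) by (auto intro!: continuous_at_imp_continuous_on DERIV_isCont)
  define good where "good p \<longleftrightarrow> continuous_on UNIV p \<and> (\<forall>s. \<bar>s\<bar> > N \<longrightarrow> p s = 0)" for p :: "real \<Rightarrow> real"
  have good: "good h" "good h'" "good t" "good t'" using ch h t unfolding good_def by auto
  have int: "integrable lborel (\<lambda>s. p s * q s)" if "good p" "good q" for p q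
    by (rule integrable_continuous_compact_support[where M=N]) (use that in \<open>auto simp: good_def intro!: continuous_intros\<close>)
  have gf: "good (?P j)" "good (?Q j)" "good ((?P(k := ?P' k)) j)" "good ((?Q(k := ?Q' k)) j)" for j k
    using good by auto
  have dP: "pd k (tensor ?P) = tensor (?P(k := ?P' k))" and dQ: "pd k (tensor ?Q) = tensor (?Q(k := ?Q' k))" for k
    by (rule pd_tensor; use h t in auto)+
  have tame_tensor: "tame (\<lambda>x. tensor A x * tensor B x)" if AB: "\<And>j. good (A j)" "\<And>j. good (B j)" for A B
  proof (rule tame_continuous_support[where M="3 * \<bar>N\<bar>"])
    show "continuous_on UNIV (\<lambda>x. tensor A x * tensor B x)"
      using C_diff_tensor[of 0 A] C_diff_tensor[of 0 B] AB by (intro continuous_on_mult) (auto simp: good_def)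
    fix x :: "real^3" assume "norm x > 3 * \<bar>N\<bar>"
    then have "(\<Sum>j\<in>UNIV. \<bar>x $ j\<bar>) > 3 * \<bar>N\<bar>" using norm_le_l1_cart[of x] by linarith
    moreover have "(\<Sum>j\<in>(UNIV::3 set). \<bar>N\<bar>) = 3 * \<bar>N\<bar>" by simp
    ultimately have "\<not> (\<forall>j. \<bar>x $ j\<bar> \<le> \<bar>N\<bar>)" using sum_mono[of UNIV "\<lambda>j. \<bar>x $ j\<bar>" "\<lambda>_. \<bar>N\<bar>"] by force
    then have "\<exists>j. \<bar>x $ j\<bar> > N" by (meson abs_ge_self le_less_trans not_le)
    then obtain j where "A j (x $ j) = 0" using AB unfolding good_def by blast
    then show "tensor A x * tensor B x = 0" unfolding tensor_def by (auto simp: prod_zero_iff)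
  qed
  have sq: "(LBINT x. (tensor A x + tensor B x)^2)
      = (LBINT x. tensor A x * tensor A x) + 2 * (LBINT x. tensor A x * tensor B x) + (LBINT x. tensor B x * tensor B x)"
    if AB: "\<And>j. good (A j)" "\<And>j. good (B j)" for A B
  proof -
    have "(\<lambda>x. (tensor A x + tensor B x)^2) = (\<lambda>x. (tensor A x * tensor A x + 2 * (tensor A x * tensor B x)) + tensor B x * tensor B x)"
      by (simp add: power2_eq_square algebra_simps fun_eq_iff)
    then show ?thesis
      using tame_integrable[OF tame_tensor[OF AB(1) AB(1)]] tame_integrable[OF tame_tensor[OF AB(1) AB(2)]]
        tame_integrable[OF tame_tensor[OF AB(2) AB(2)]] by simp
  qed
  have val: "(LBINT x. tensor A x * tensor B x) = (LBINT s. A 1 s * B 1 s) * (LBINT s. A 2 s * B 2 s) * (LBINT s. A 3 s * B 3 s)"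
    if AB: "\<And>j. good (A j)" "\<And>j. good (B j)" for A B
    by (rule integral_tensor_mult) (intro int AB)
  have pds: "pd k (\<lambda>x. tensor ?P x + tensor ?Q x) x = tensor (?P(k := ?P' k)) x + tensor (?Q(k := ?Q' k)) x" for k x
  proof -
    have "tensor ?P differentiable (at x)" "tensor ?Q differentiable (at x)"
      by (rule tensor_differentiable[where P'="?P'"], use h t in simp, rule tensor_differentiable[where P'="?Q'"], use h t in simp)
    from dir_deriv_combination[OF this, of "axis k 1" 1 1] show ?thesis by (simp add: dP dQ)
  qed
  have ht': "t s * h s = t s" "t' s * h' s = 0" for s using ht[of s] by (simp_all add: mult.commute)
  show ?thesis
    unfolding energy_def pds sq[OF gf(3) gf(4)] sq[OF gf(1) gf(2)]
      val[OF gf(3) gf(3)] val[OF gf(3) gf(4)] val[OF gf(4) gf(4)] val[OF gf(1) gf(1)] val[OF gf(1) gf(2)] val[OF gf(2) gf(2)] sum3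
    by (simp add: ht ht' power2_eq_square algebra_simps)
qed


lemma cos_ge_cos_pi4: assumes "\<bar>s\<bar> \<le> 1/4" shows "7/10 \<le> cos (pi * s)"
proof -
  have "cos (pi / 4) \<le> cos (\<bar>pi * s\<bar>)"
    by (rule cos_monotone_0_pi_le) (use assms in \<open>auto simp: abs_mult\<close>)
  moreover have "7/10 \<le> sqrt 2 / 2"
  proof -
    have "7/5 \<le> sqrt 2" by (rule real_le_rsqrt) (auto simp: power2_eq_square)
    then show ?thesis by simp
  qed
  ultimately show ?thesis by (simp add: cos_45)
qed

text \<open>The profile across an arm: the ground state \<open>cos (\<pi> s)\<close> of the cross section, cut off near the
  two walls so as to become a test function. Its Rayleigh quotient exceeds \<open>\<pi>^2\<close> by as little as we wish.\<close>

lemma transversal_profile: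
  assumes "d > 0"
  shows "\<exists>(t :: real \<Rightarrow> real) t'. (\<forall>n. C_diff n t) \<and> (\<forall>s. (t has_real_derivative t' s) (at s)) \<and> continuous_on UNIV t' \<and>
    (\<exists>b<1/2. \<forall>s. \<bar>s\<bar> > b \<longrightarrow> t s = 0 \<and> t' s = 0) \<and>
    (LBINT s. (t' s)^2) - pi^2 * (LBINT s. (t s)^2) \<le> d \<and>
    1/5 \<le> (LBINT s. (t s)^2) \<and> (LBINT s. (t s)^2) \<le> 1 \<and> 7/20 \<le> (LBINT s. t s) \<and> (LBINT s. t s) \<le> 1"
proof -
  obtain K where K: "K > 0" and pl: "\<And>a b. 0 < a \<Longrightarrow> a < b \<Longrightarrow> \<exists>p p'. plateau K a b p p'"
    using plateau_exists by blast
  \<comment> \<open>\<open>e\<close> is the width of the layer in which the profile is cut off.\<close>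
  define e where "e = min (1/8) (d / (8 * pi^2 * K^2))"
  have e: "e > 0" "e \<le> 1/8" "8 * pi^2 * K^2 * e \<le> d"
  proof -
    show "e > 0" "e \<le> 1/8" using assms K by (auto simp: e_def)
    have "8 * pi^2 * K^2 * e \<le> 8 * pi^2 * K^2 * (d / (8 * pi^2 * K^2))"
      by (intro mult_left_mono) (auto simp: e_def)
    then show "8 * pi^2 * K^2 * e \<le> d" using K by simp
  qed
  define a where "a = 1/2 - 2 * e"
  define b where "b = 1/2 - e"
  have ab: "1/4 \<le> a" "a < b" "b < 1/2" "b - a = e" using e by (auto simp: a_def b_def)
  obtain p p' where pp: "plateau K a b p p'" using pl[of a b] ab by auto
  note p = plateauD[OF pp, unfolded ab(4)] and p'0 = plateauD(9)[OF pp]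
  define c where "c x = cos (pi * x)" for x
  define t where "t x = c x * p x" for x
  define t' where "t' x = c x * p' x + (- pi * sin (pi * x)) * p x" for x
  have c': "(c has_real_derivative - pi * sin (pi * x)) (at x)" for x
    unfolding c_def[abs_def] by (auto intro!: derivative_eq_intros)
  have tD: "(t has_real_derivative t' x) (at x)" for x
    unfolding t_def[abs_def] t'_def using DERIV_mult[OF c' p(2), of x] by (simp add: algebra_simps)
  have smc: "C_diff n c" for n
    using C_diff_cos[of n 1 pi 0] by (simp add: c_def[abs_def])
  have smt: "C_diff n t" for n unfolding t_def[abs_def] by (intro C_diff_mult smc p)
  have cp: "continuous_on UNIV p" using C_diff_imp_continuous[OF p(1)] .
  have cp': "continuous_on UNIV p'" by (rule p)
  have cc: "continuous_on UNIV c" unfolding c_def[abs_def] by (intro continuous_intros)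
  have ct: "continuous_on UNIV t" unfolding t_def[abs_def] by (intro continuous_intros cc cp)
  have ct': "continuous_on UNIV t'" unfolding t'_def[abs_def] by (intro continuous_intros cc cp cp')
  have z: "t x = 0" "t' x = 0" if "\<bar>x\<bar> > b" for x using that p(6) p'0 by (auto simp: t_def t'_def)
  have int: "integrable lborel g" if "continuous_on UNIV g" "\<And>x. \<bar>x\<bar> > b \<Longrightarrow> g x = 0" for g :: "real \<Rightarrow> real"
    by (rule integrable_continuous_compact_support[where M=b]) (use that in auto)
  have it: "integrable lborel t" "integrable lborel (\<lambda>x. (t x)^2)" "integrable lborel (\<lambda>x. (t' x)^2)"
    by (rule int; use z ct ct' in \<open>auto intro!: continuous_intros\<close>)+
  have icp: "integrable lborel (\<lambda>x. (c x * p' x)^2)"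
    by (rule int) (use cc cp' p'0 in \<open>auto intro!: continuous_intros\<close>)

  have c_le: "\<bar>c x\<bar> \<le> 1" for x by (simp add: c_def)
  have t_le: "t x \<le> 1 * indicator {-1/2..1/2} x" "(t x)^2 \<le> 1 * indicator {-1/2..1/2} x" for x
  proof -
    have "\<bar>t x\<bar> \<le> 1" unfolding t_def abs_mult using c_le[of x] p(3,4)[of x] by (intro mult_le_one) auto
    moreover from this have "(t x)^2 \<le> 1" by (simp add: abs_square_le_1)
    moreover have "t x = 0" if "x \<notin> {-1/2..1/2}" using that z(1)[of x] ab by (auto simp: abs_if split: if_splits)
    ultimately show "t x \<le> 1 * indicator {-1/2..1/2} x" "(t x)^2 \<le> 1 * indicator {-1/2..1/2} x"
      by (auto simp: indicator_def)
  qed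
  have c_pos: "0 \<le> c x" if "\<bar>x\<bar> \<le> 1/2" for x
  proof -
    have "\<bar>pi * x\<bar> \<le> pi * (1/2)" unfolding abs_mult using that by (intro mult_mono) auto
    then show ?thesis unfolding c_def by (intro cos_ge_zero) linarith+
  qed
  have t_ge: "7/10 * indicator {-1/4..1/4} x \<le> t x" "49/100 * indicator {-1/4..1/4} x \<le> (t x)^2" for x
  proof -
    have "t x \<ge> 0"
    proof (cases "\<bar>x\<bar> > b")
      case False
      then show ?thesis unfolding t_def using ab p by (intro mult_nonneg_nonneg c_pos) auto
    qed (simp add: z)
    moreover have "7/10 \<le> t x" if "\<bar>x\<bar> \<le> 1/4"
      using cos_ge_cos_pi4[OF that] p(5)[of x] that ab by (simp add: t_def c_def)
    moreover from this have "(7/10)^2 \<le> (t x)^2" if "\<bar>x\<bar> \<le> 1/4" using that by (intro power_mono) auto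
    ultimately show "7/10 * indicator {-1/4..1/4} x \<le> t x" "49/100 * indicator {-1/4..1/4} x \<le> (t x)^2"
      by (auto simp: indicator_def power2_eq_square abs_if)
  qed
  have "(LBINT s. t s) \<le> 1 * measure lborel {-1/2..1/2::real}"
    by (rule lborel_integral_le_width[OF it(1) t_le(1)]) auto
  moreover have "(LBINT s. (t s)^2) \<le> 1 * measure lborel {-1/2..1/2::real}"
    by (rule lborel_integral_le_width[OF it(2) t_le(2)]) auto
  moreover have "7/10 * measure lborel {-1/4..1/4::real} \<le> (LBINT s. t s)"
    by (rule lborel_integral_ge_width[OF it(1) t_ge(1)]) auto
  moreover have "49/100 * measure lborel {-1/4..1/4::real} \<le> (LBINT s. (t s)^2)"
    by (rule lborel_integral_ge_width[OF it(2) t_ge(2)]) auto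
  ultimately have bounds: "1/5 \<le> (LBINT s. (t s)^2)" "(LBINT s. (t s)^2) \<le> 1" "7/20 \<le> (LBINT s. t s)" "(LBINT s. t s) \<le> 1"
    by auto

  \<comment> \<open>Since \<open>c'' = - \<pi>\<^sup>2 c\<close>, the integrand is the derivative of \<open>c c' p\<^sup>2\<close>. The excess energy is therefore \<open>\<integral>(c p')\<^sup>2\<close>, and in the layer \<open>c\<close> is small of the order of the width.\<close>
  have "(LBINT x. (t' x)^2 - pi^2 * (t x)^2 - (c x * p' x)^2) = 0"
  proof (rule lborel_integral_derivative_0[where M=1])
    let ?G = "\<lambda>x. c x * (- pi * sin (pi * x)) * (p x)^2"
    have s': "((\<lambda>x. - pi * sin (pi * x)) has_real_derivative - (pi^2) * c x) (at x)" for x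
      unfolding c_def by (auto intro!: derivative_eq_intros simp: power2_eq_square)
    show "(?G has_real_derivative (t' x)^2 - pi^2 * (t x)^2 - (c x * p' x)^2) (at x)" for x
      unfolding t'_def t_def
      by (rule derivative_eq_intros c' s' p(2) refl)+ (simp add: power2_eq_square algebra_simps)
    show "continuous_on UNIV (\<lambda>x. (t' x)^2 - pi^2 * (t x)^2 - (c x * p' x)^2)"
      by (intro continuous_intros ct ct' cc cp')
    show "?G x = 0" if "\<bar>x\<bar> \<ge> 1" for x using p(6)[of x] that ab by simp
    show "(t' x)^2 - pi^2 * (t x)^2 - (c x * p' x)^2 = 0" if "\<bar>x\<bar> > 1" for x
      using z[of x] p'0[of x] that ab by simp
  qed simp
  then have D: "(LBINT x. (t' x)^2) - pi^2 * (LBINT x. (t x)^2) = (LBINT x. (c x * p' x)^2)"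
    using it icp by simp
  have cp_le: "(c x * p' x)^2 \<le> 4 * pi^2 * K^2 * indicator ({a..b} \<union> {-b..-a}) x" for x
  proof (cases "x \<in> {a..b} \<union> {-b..-a}")
    case True
    then have x: "a \<le> \<bar>x\<bar>" "\<bar>x\<bar> \<le> b" using ab by (auto simp: abs_if)
    have "c x = sin (pi * (1/2 - \<bar>x\<bar>))"
      using cos_sin_eq[of "pi * \<bar>x\<bar>"] unfolding c_def by (auto simp: abs_if algebra_simps)
    also have "\<dots> \<le> pi * (1/2 - \<bar>x\<bar>)" by (rule sin_x_le_x) (use x ab in auto)
    also have "\<dots> \<le> pi * (2 * e)" using x by (intro mult_left_mono) (auto simp: a_def)
    finally have "\<bar>c x\<bar> \<le> pi * (2 * e)" using c_pos[of x] x ab by simp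
    then have "\<bar>c x * p' x\<bar> \<le> pi * (2 * e) * (K / e)" unfolding abs_mult using p(7)[of x] by (intro mult_mono) auto
    then have "(c x * p' x)^2 \<le> (2 * pi * K)^2" using e by (intro power2_le_iff_abs_le[THEN iffD2]) (use K in auto)
    then show ?thesis using True by (simp add: power_mult_distrib)
  next
    case False
    then have "\<bar>x\<bar> < a \<or> \<bar>x\<bar> > b" using ab by (auto simp: abs_if)
    then show ?thesis using p'0 False by simp
  qed
  have "(LBINT x. (c x * p' x)^2) \<le> 4 * pi^2 * K^2 * measure lborel ({a..b} \<union> {-b..-a})"
    by (rule lborel_integral_le_width[OF icp cp_le]) auto
  also have "measure lborel ({a..b} \<union> {-b..-a}) = 2 * e"
    by (subst measure_Union) (use ab in \<open>auto simp: emeasure_lborel_Icc_eq\<close>)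
  finally have "(LBINT s. (t' s)^2) - pi^2 * (LBINT s. (t s)^2) \<le> d" unfolding D using e(3) by simp
  then show ?thesis using smt tD ct' z ab(3) bounds by (intro exI[of _ t] exI[of _ t'] conjI allI) auto
qed

text \<open>With \<open>X = \<integral>h\<^sup>2\<close>, \<open>Y = \<integral>h'\<^sup>2\<close>, \<open>I = \<integral>t\<^sup>2\<close>, \<open>J = \<integral>t\<close>, \<open>D = \<integral>t'\<^sup>2\<close> the energy is \<open>I (2 Y I - 2 \<pi>\<^sup>2
  J\<^sup>2) + (D - \<pi>\<^sup>2 I) (4 X I + 2 J\<^sup>2)\<close>. A long cutoff makes \<open>Y\<close> small. This fixes \<open>X\<close>, and
  afterwards the transversal profile is chosen so that \<open>D - \<pi>\<^sup>2 I\<close> is small compared with \<open>1 /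
  X\<close>.\<close>

lemma negative_energy: "\<exists>\<phi>. test_fun Omega \<phi> \<and> energy \<phi> < 0"
proof -
  obtain K where K: "K > 0" and pl: "\<And>a b. 0 < a \<Longrightarrow> a < b \<Longrightarrow> \<exists>p p'. plateau K a b p p'"
    using plateau_exists by blast
  \<comment> \<open>This makes \<open>4 K\<^sup>2 / R \<le> 1/4\<close>.\<close>
  define R where "R = 16 * K^2 + 1"
  have R: "R \<ge> 1" using K by (simp add: R_def)
  obtain h h' where hh: "plateau K R (2 * R) h h'" using pl[of R "2 * R"] R by auto
  have RR: "2 * R - R = R" by simp
  note h = plateauD[OF hh, unfolded RR] and h'0 = plateauD(9)[OF hh] and ch' = plateauD(8)[OF hh]
  have ch: "continuous_on UNIV h" using C_diff_imp_continuous[OF h(1)] .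
  define X where "X = (LBINT s. (h s)^2)"
  define Y where "Y = (LBINT s. (h' s)^2)"
  have X: "X \<ge> 0" unfolding X_def by (rule Bochner_Integration.integral_nonneg) simp
  have Y: "Y \<le> 1/4"
  proof -
    have "Y \<le> (K / R)^2 * measure lborel {-(2*R)..2*R}"
      unfolding Y_def
    proof (rule lborel_integral_le_width)
      show "integrable lborel (\<lambda>s. (h' s)^2)"
        by (rule integrable_continuous_compact_support[where M="2 * R"]) (use ch' h'0 in \<open>auto intro!: continuous_intros\<close>)
      show "(h' x)^2 \<le> (K / R)^2 * indicator {-(2*R)..2*R} x" for x
      proof (cases "\<bar>x\<bar> > 2 * R")
        case False
        then have "x \<in> {-(2*R)..2*R}" by auto
        moreover have "(h' x)^2 \<le> (K / R)^2"
          using h(7)[of x] by (intro power2_le_iff_abs_le[THEN iffD2]) (use K R in auto)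
        ultimately show ?thesis by simp
      qed (use h'0 in simp)
    qed simp
    also have "\<dots> = 4 * K^2 / R" using R by (simp add: power2_eq_square field_simps)
    also have "\<dots> \<le> 1/4" using R by (simp add: divide_simps) (simp add: R_def)
    finally show ?thesis .
  qed
  \<comment> \<open>The admissible excess of the profile, given the length of the cutoff.\<close>
  define d where "d = 1 / (20 * (2 * X + 1))"
  have d: "d > 0" "d * (4 * X + 2) \<le> 1/10" using X by (auto simp: d_def divide_simps)
  obtain t t' b where t: "\<And>n. C_diff n t" "\<And>s. (t has_real_derivative t' s) (at s)" "continuous_on UNIV t'"
    "b < 1/2" "\<And>s. \<bar>s\<bar> > b \<Longrightarrow> t s = 0" "\<And>s. \<bar>s\<bar> > b \<Longrightarrow> t' s = 0"
    "(LBINT s. (t' s)^2) - pi^2 * (LBINT s. (t s)^2) \<le> d"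
    "1/5 \<le> (LBINT s. (t s)^2)" "(LBINT s. (t s)^2) \<le> 1"
    "7/20 \<le> (LBINT s. t s)" "(LBINT s. t s) \<le> 1"
    using transversal_profile[OF d(1)] by blast
  let ?P = "\<lambda>j::3. if j = 1 then h else t" and ?Q = "\<lambda>j::3. if j = 2 then h else t"
  define \<phi> where "\<phi> x = tensor ?P x + tensor ?Q x" for x
  have "test_fun Omega (tensor ?P)"
    by (rule test_fun_tensor[where B="\<lambda>j. if j = 1 then 2 * R else b" and i=1]) (use h t in auto)
  moreover have "test_fun Omega (tensor ?Q)"
    by (rule test_fun_tensor[where B="\<lambda>j. if j = 2 then 2 * R else b" and i=2]) (use h t in auto)
  ultimately have tf: "test_fun Omega \<phi>" unfolding \<phi>_def[abs_def] by (rule test_fun_add)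
  define I where "I = (LBINT s. (t s)^2)"
  define J where "J = (LBINT s. t s)"
  define D where "D = (LBINT s. (t' s)^2)"
  have "energy \<phi> = 2 * Y * I^2 + 4 * X * I * (D - pi^2 * I) + 2 * J^2 * (D - 2 * pi^2 * I)"
    unfolding \<phi>_def[abs_def] X_def Y_def I_def J_def D_def
  proof (rule energy_two_tensor[where N="2 * R"])
    show "h s * t s = t s" for s using h(5)[of s] t(4) t(5)[of s] R by (cases "\<bar>s\<bar> > b") auto
    show "h' s * t' s = 0" for s using h'0[of s] t(4) t(6)[of s] R by (cases "\<bar>s\<bar> > b") auto
    show "trial (\<lambda>x. tensor ?P x + tensor ?Q x)" using test_fun_trial[OF tf] unfolding \<phi>_def[abs_def] .
    show "t s = 0" "t' s = 0" if "\<bar>s\<bar> > 2 * R" for s using that t(4,5,6) R by auto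
  qed (use h h'0 ch' t in auto)
  also have "\<dots> = I * (2 * (Y * I) - 2 * (pi^2 * J^2)) + (D - pi^2 * I) * (4 * (X * I) + 2 * J^2)"
    by (simp add: power2_eq_square algebra_simps)
  also have "\<dots> < 0"
  proof -
    have I: "1/5 \<le> I" "I \<le> 1" and J: "7/20 \<le> J" "J \<le> 1" and Dd: "D - pi^2 * I \<le> d"
      using t unfolding I_def J_def D_def by auto
    have "Y * I \<le> 1/4 * 1" using Y I by (intro mult_mono) auto
    moreover have "9 * (7/20)^2 \<le> pi^2 * J^2"
    proof (rule mult_mono)
      have "3^2 \<le> pi^2" using pi_gt3 by (intro power_mono) auto
      then show "9 \<le> pi^2" by simp
    qed (use J in \<open>auto intro: power_mono\<close>)
    ultimately have "2 * (Y * I) - 2 * (pi^2 * J^2) \<le> - 1" by (simp add: power2_eq_square)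
    then have "I * (2 * (Y * I) - 2 * (pi^2 * J^2)) \<le> I * (- 1)" using I by (intro mult_left_mono) auto
    moreover have "(D - pi^2 * I) * (4 * (X * I) + 2 * J^2) \<le> d * (4 * (X * 1) + 2 * 1^2)"
      using Dd d X I J by (intro mult_mono add_mono mult_left_mono power_mono) auto
    ultimately show ?thesis using I d by simp
  qed
  finally show ?thesis using tf by blast
qed


section \<open>Square-integrable convergence\<close>

definition sq_int :: "'a measure \<Rightarrow> ('a \<Rightarrow> real) \<Rightarrow> bool" where
  "sq_int N x \<longleftrightarrow> x \<in> borel_measurable N \<and> integrable N (\<lambda>w. (x w)^2)"

text \<open>Convergence in \<open>L\<^sup>2(N)\<close> for functions, not classes; square integrability is part of the notion
  so that every integral of a product exists.\<close>

definition l2conv :: "'a measure \<Rightarrow> (nat \<Rightarrow> 'a \<Rightarrow> real) \<Rightarrow> ('a \<Rightarrow> real) \<Rightarrow> bool" where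
  "l2conv N X x \<longleftrightarrow> (\<forall>n. sq_int N (X n)) \<and> sq_int N x \<and> (\<lambda>n. \<integral>w. (X n w - x w)^2 \<partial>N) \<longlonglongrightarrow> 0"

lemma sq_int_mult_integrable:
  assumes "sq_int N x" "sq_int N y" shows "integrable N (\<lambda>w. x w * y w)"
proof (rule Bochner_Integration.integrable_bound)
  show "integrable N (\<lambda>w. (x w)^2 + (y w)^2)" using assms by (simp add: sq_int_def)
  show "(\<lambda>w. x w * y w) \<in> borel_measurable N" using assms by (auto simp: sq_int_def)
  have "\<bar>a * b\<bar> \<le> \<bar>a^2 + b^2\<bar>" for a b :: real
  proof -
    have "0 \<le> (\<bar>a\<bar> - \<bar>b\<bar>)^2" by simp
    then have "2 * (\<bar>a\<bar> * \<bar>b\<bar>) \<le> a^2 + b^2" by (simp add: power2_diff)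
    moreover have "0 \<le> \<bar>a\<bar> * \<bar>b\<bar>" by simp
    ultimately have "\<bar>a\<bar> * \<bar>b\<bar> \<le> a^2 + b^2" by linarith
    then show ?thesis unfolding abs_mult using abs_ge_self[of "a^2 + b^2"] by linarith
  qed
  then show "AE w in N. norm (x w * y w) \<le> norm ((x w)^2 + (y w)^2)" by simp
qed

lemma sq_int_bounded_mult:
  assumes "sq_int N x" "w \<in> borel_measurable N" "\<And>a. a \<in> space N \<Longrightarrow> \<bar>w a\<bar> \<le> C"
  shows "sq_int N (\<lambda>a. w a * x a)"
  unfolding sq_int_def
proof
  show "(\<lambda>a. w a * x a) \<in> borel_measurable N" using assms by (auto simp: sq_int_def)
  show "integrable N (\<lambda>a. (w a * x a)^2)"
  proof (rule Bochner_Integration.integrable_bound)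
    show "integrable N (\<lambda>a. C^2 * (x a)^2)" using assms by (simp add: sq_int_def)
    show "(\<lambda>a. (w a * x a)^2) \<in> borel_measurable N" using assms by (auto simp: sq_int_def)
    show "AE a in N. norm ((w a * x a)^2) \<le> norm (C^2 * (x a)^2)"
    proof (rule AE_I2)
      fix a assume "a \<in> space N"
      then have "\<bar>w a\<bar>^2 \<le> C^2" using assms(3)[of a] by (intro power_mono) auto
      then show "norm ((w a * x a)^2) \<le> norm (C^2 * (x a)^2)"
        by (simp add: power_mult_distrib mult_right_mono)
    qed
  qed
qed

lemma sq_int_cmult: "sq_int N x \<Longrightarrow> sq_int N (\<lambda>a. c * x a)"
  by (rule sq_int_bounded_mult[where C="\<bar>c\<bar>"]) auto

lemma sq_int_add:
  assumes "sq_int N x" "sq_int N y" shows "sq_int N (\<lambda>a. x a + y a)"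
proof -
  have "integrable N (\<lambda>a. (x a)^2 + (y a)^2 + 2 * (x a * y a))"
    using assms sq_int_mult_integrable[OF assms] by (auto simp: sq_int_def)
  moreover have "(\<lambda>a. (x a)^2 + (y a)^2 + 2 * (x a * y a)) = (\<lambda>a. (x a + y a)^2)"
    by (simp add: power2_sum fun_eq_iff)
  ultimately show ?thesis using assms by (auto simp: sq_int_def)
qed

lemma sq_int_diff: "sq_int N x \<Longrightarrow> sq_int N y \<Longrightarrow> sq_int N (\<lambda>a. x a - y a)"
  using sq_int_add[of N x "\<lambda>a. (-1) * y a"] sq_int_cmult[of N y "-1"] by simp

text \<open>The quadratic polynomial \<open>\<integral>(x - s y)\<^sup>2\<close> in \<open>s\<close> is non-negative.\<close>

lemma cauchy_schwarz_integral:
  assumes "sq_int N x" "sq_int N y"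
  shows "(\<integral>w. x w * y w \<partial>N)^2 \<le> (\<integral>w. (x w)^2 \<partial>N) * (\<integral>w. (y w)^2 \<partial>N)"
proof -
  define A where "A = (\<integral>w. (x w)^2 \<partial>N)"
  define B where "B = (\<integral>w. (y w)^2 \<partial>N)"
  define P where "P = (\<integral>w. x w * y w \<partial>N)"
  have i: "integrable N (\<lambda>w. (x w)^2)" "integrable N (\<lambda>w. (y w)^2)" "integrable N (\<lambda>w. x w * y w)"
    using assms sq_int_mult_integrable[OF assms] by (auto simp: sq_int_def)
  have q: "0 \<le> A - 2 * s * P + s^2 * B" for s
  proof -
    have "0 \<le> (\<integral>w. (x w - s * y w)^2 \<partial>N)" by (rule Bochner_Integration.integral_nonneg) simp
    also have "(\<lambda>w. (x w - s * y w)^2) = (\<lambda>w. ((x w)^2 - (2 * s) * (x w * y w)) + s^2 * (y w)^2)"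
      by (simp add: power2_eq_square algebra_simps fun_eq_iff)
    also have "(\<integral>w. ((x w)^2 - (2 * s) * (x w * y w)) + s^2 * (y w)^2 \<partial>N) = A - 2 * s * P + s^2 * B"
      unfolding A_def B_def P_def using i by simp
    finally show ?thesis .
  qed
  have B0: "B \<ge> 0" unfolding B_def by (rule Bochner_Integration.integral_nonneg) simp
  have "P^2 \<le> A * B"
  proof (cases "B = 0")
    case True
    have "P = 0"
    proof (rule ccontr)
      assume "P \<noteq> 0"
      then show False using q[of "(A + 1) / (2 * P)"] True by simp
    qed
    then show ?thesis using True by simp
  next
    case False
    then have "0 \<le> (A - 2 * (P / B) * P + (P / B)^2 * B) * B" using q[of "P / B"] B0 by simp
    also have "\<dots> = A * B - P^2" using False by (simp add: power2_eq_square field_simps)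
    finally show ?thesis by simp
  qed
  then show ?thesis unfolding A_def B_def P_def .
qed

lemma l2convD: "l2conv N X x \<Longrightarrow> sq_int N (X n)" "l2conv N X x \<Longrightarrow> sq_int N x"
  by (auto simp: l2conv_def)

lemma l2conv_const: "sq_int N x \<Longrightarrow> l2conv N (\<lambda>_. x) x"
  by (simp add: l2conv_def)

lemma l2conv_add:
  assumes "l2conv N X x" "l2conv N Y y"
  shows "l2conv N (\<lambda>n a. X n a + Y n a) (\<lambda>a. x a + y a)"
  unfolding l2conv_def
proof (intro conjI allI)
  show "sq_int N (\<lambda>a. X n a + Y n a)" "sq_int N (\<lambda>a. x a + y a)" for n using assms by (auto intro!: sq_int_add dest: l2convD)
  have dX: "sq_int N (\<lambda>a. X n a - x a)" and dY: "sq_int N (\<lambda>a. Y n a - y a)" for n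
    using assms by (auto intro!: sq_int_diff dest: l2convD)
  show "(\<lambda>n. \<integral>a. (X n a + Y n a - (x a + y a))^2 \<partial>N) \<longlonglongrightarrow> 0"
  proof (rule real_tendsto_sandwich)
    show "eventually (\<lambda>n. 0 \<le> (\<integral>a. (X n a + Y n a - (x a + y a))^2 \<partial>N)) sequentially"
      by (auto intro: Bochner_Integration.integral_nonneg)
    show "eventually (\<lambda>n. (\<integral>a. (X n a + Y n a - (x a + y a))^2 \<partial>N) \<le> 2 * (\<integral>a. (X n a - x a)^2 \<partial>N) + 2 * (\<integral>a. (Y n a - y a)^2 \<partial>N)) sequentially"
    proof (rule always_eventually, rule allI)
      fix n
      have "(\<integral>a. (X n a + Y n a - (x a + y a))^2 \<partial>N) \<le> (\<integral>a. 2 * (X n a - x a)^2 + 2 * (Y n a - y a)^2 \<partial>N)"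
      proof (rule integral_mono)
        have "sq_int N (\<lambda>a. (X n a - x a) + (Y n a - y a))" by (rule sq_int_add[OF dX dY])
        moreover have "(\<lambda>a. (X n a - x a) + (Y n a - y a)) = (\<lambda>a. X n a + Y n a - (x a + y a))" by auto
        ultimately show "integrable N (\<lambda>a. (X n a + Y n a - (x a + y a))^2)" by (simp add: sq_int_def)
        show "integrable N (\<lambda>a. 2 * (X n a - x a)^2 + 2 * (Y n a - y a)^2)" using dX dY by (simp add: sq_int_def)
        show "(X n a + Y n a - (x a + y a))^2 \<le> 2 * (X n a - x a)^2 + 2 * (Y n a - y a)^2" for a
          using zero_le_power2[of "(X n a - x a) - (Y n a - y a)"] by (simp add: power2_eq_square algebra_simps)
      qed
      also have "\<dots> = 2 * (\<integral>a. (X n a - x a)^2 \<partial>N) + 2 * (\<integral>a. (Y n a - y a)^2 \<partial>N)"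
        using dX[of n] dY[of n] by (simp add: sq_int_def)
      finally show "(\<integral>a. (X n a + Y n a - (x a + y a))^2 \<partial>N) \<le> 2 * (\<integral>a. (X n a - x a)^2 \<partial>N) + 2 * (\<integral>a. (Y n a - y a)^2 \<partial>N)" .
    qed
    show "(\<lambda>n. 2 * (\<integral>a. (X n a - x a)^2 \<partial>N) + 2 * (\<integral>a. (Y n a - y a)^2 \<partial>N)) \<longlonglongrightarrow> 0"
    proof -
      have "(\<lambda>n. \<integral>a. (X n a - x a)^2 \<partial>N) \<longlonglongrightarrow> 0" "(\<lambda>n. \<integral>a. (Y n a - y a)^2 \<partial>N) \<longlonglongrightarrow> 0"
        using assms by (auto simp: l2conv_def)
      from tendsto_add[OF tendsto_mult_right_zero[OF this(1), of 2] tendsto_mult_right_zero[OF this(2), of 2]]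
      show ?thesis by simp
    qed
  qed simp
qed

lemma l2conv_mult:
  assumes "l2conv N X x" and w: "w \<in> borel_measurable N" "\<And>a. a \<in> space N \<Longrightarrow> \<bar>w a\<bar> \<le> C"
  shows "l2conv N (\<lambda>n a. w a * X n a) (\<lambda>a. w a * x a)"
  unfolding l2conv_def
proof (intro conjI allI)
  show "sq_int N (\<lambda>a. w a * X n a)" "sq_int N (\<lambda>a. w a * x a)" for n
    using assms by (auto intro!: sq_int_bounded_mult dest: l2convD)
  have dX: "sq_int N (\<lambda>a. X n a - x a)" for n using assms by (auto intro!: sq_int_diff dest: l2convD)
  show "(\<lambda>n. \<integral>a. (w a * X n a - w a * x a)^2 \<partial>N) \<longlonglongrightarrow> 0"
  proof (rule real_tendsto_sandwich)
    show "eventually (\<lambda>n. 0 \<le> (\<integral>a. (w a * X n a - w a * x a)^2 \<partial>N)) sequentially"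
      by (auto intro: Bochner_Integration.integral_nonneg)
    show "eventually (\<lambda>n. (\<integral>a. (w a * X n a - w a * x a)^2 \<partial>N) \<le> C^2 * (\<integral>a. (X n a - x a)^2 \<partial>N)) sequentially"
    proof (rule always_eventually, rule allI)
      fix n
      have "(\<integral>a. (w a * X n a - w a * x a)^2 \<partial>N) \<le> (\<integral>a. C^2 * (X n a - x a)^2 \<partial>N)"
      proof (rule integral_mono)
        have "sq_int N (\<lambda>a. w a * (X n a - x a))" by (rule sq_int_bounded_mult[OF dX w])
        then show "integrable N (\<lambda>a. (w a * X n a - w a * x a)^2)" by (simp add: sq_int_def right_diff_distrib)
        show "integrable N (\<lambda>a. C^2 * (X n a - x a)^2)" using dX by (simp add: sq_int_def)
        fix a assume "a \<in> space N"
        then have "\<bar>w a\<bar>^2 \<le> C^2" using w(2)[of a] by (intro power_mono) auto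
        then have "(w a)^2 * (X n a - x a)^2 \<le> C^2 * (X n a - x a)^2" by (intro mult_right_mono) auto
        then show "(w a * X n a - w a * x a)^2 \<le> C^2 * (X n a - x a)^2"
          by (simp add: right_diff_distrib[symmetric] power_mult_distrib)
      qed
      then show "(\<integral>a. (w a * X n a - w a * x a)^2 \<partial>N) \<le> C^2 * (\<integral>a. (X n a - x a)^2 \<partial>N)" by simp
    qed
    show "(\<lambda>n. C^2 * (\<integral>a. (X n a - x a)^2 \<partial>N)) \<longlonglongrightarrow> 0"
      using assms(1) by (auto simp: l2conv_def intro: tendsto_mult_right_zero)
  qed simp
qed

lemma l2conv_cmult: "l2conv N X x \<Longrightarrow> l2conv N (\<lambda>n a. c * X n a) (\<lambda>a. c * x a)"
  by (rule l2conv_mult[where C="\<bar>c\<bar>"]) auto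

lemma l2conv_diff:
  "l2conv N X x \<Longrightarrow> l2conv N Y y \<Longrightarrow> l2conv N (\<lambda>n a. X n a - Y n a) (\<lambda>a. x a - y a)"
  using l2conv_add[of N X x "\<lambda>n a. (-1) * Y n a" "\<lambda>a. (-1) * y a"] l2conv_cmult[of N Y y "-1"] by simp

lemma l2conv_integral_mult:
  assumes X: "l2conv N X x" and Y: "l2conv N Y y"
  shows "(\<lambda>n. \<integral>a. X n a * Y n a \<partial>N) \<longlonglongrightarrow> (\<integral>a. x a * y a \<partial>N)"
proof -
  have 0: "(\<lambda>n. \<integral>a. U n a * V n a \<partial>N) \<longlonglongrightarrow> 0"
    if s: "\<And>n. sq_int N (U n)" "\<And>n. sq_int N (V n)" and c: "(\<lambda>n. (\<integral>a. (U n a)^2 \<partial>N) * (\<integral>a. (V n a)^2 \<partial>N)) \<longlonglongrightarrow> 0" for U V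
  proof -
    have "(\<lambda>n. (\<integral>a. U n a * V n a \<partial>N)^2) \<longlonglongrightarrow> 0"
    proof (rule real_tendsto_sandwich[OF _ _ tendsto_const c])
      show "eventually (\<lambda>n. (\<integral>a. U n a * V n a \<partial>N)^2 \<le> (\<integral>a. (U n a)^2 \<partial>N) * (\<integral>a. (V n a)^2 \<partial>N)) sequentially"
        by (intro always_eventually allI cauchy_schwarz_integral s)
    qed simp
    from tendsto_real_sqrt[OF this] have "(\<lambda>n. \<bar>\<integral>a. U n a * V n a \<partial>N\<bar>) \<longlonglongrightarrow> 0" by simp
    then show ?thesis by (rule tendsto_rabs_zero_cancel)
  qed
  have dX: "sq_int N (\<lambda>a. X n a - x a)" and dY: "sq_int N (\<lambda>a. Y n a - y a)" for n
    using assms by (auto intro!: sq_int_diff dest: l2convD)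
  have cX: "(\<lambda>n. \<integral>a. (X n a - x a)^2 \<partial>N) \<longlonglongrightarrow> 0" and cY: "(\<lambda>n. \<integral>a. (Y n a - y a)^2 \<partial>N) \<longlonglongrightarrow> 0"
    using assms by (auto simp: l2conv_def)
  have 1: "(\<lambda>n. \<integral>a. (X n a - x a) * (Y n a - y a) \<partial>N) \<longlonglongrightarrow> 0"
    by (rule 0[OF dX dY]) (use tendsto_mult[OF cX cY] in simp)
  have 2: "(\<lambda>n. \<integral>a. x a * (Y n a - y a) \<partial>N) \<longlonglongrightarrow> 0"
    by (rule 0[OF l2convD(2)[OF X] dY]) (rule tendsto_mult_right_zero[OF cY])
  have 3: "(\<lambda>n. \<integral>a. (X n a - x a) * y a \<partial>N) \<longlonglongrightarrow> 0"
    by (rule 0[OF dX l2convD(2)[OF Y]]) (rule tendsto_mult_left_zero[OF cX])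
  have eq: "(\<integral>a. X n a * Y n a \<partial>N) = (\<integral>a. (X n a - x a) * (Y n a - y a) \<partial>N) + (\<integral>a. x a * (Y n a - y a) \<partial>N)
      + (\<integral>a. (X n a - x a) * y a \<partial>N) + (\<integral>a. x a * y a \<partial>N)" for n
  proof -
    have "(\<lambda>a. X n a * Y n a) = (\<lambda>a. (X n a - x a) * (Y n a - y a) + x a * (Y n a - y a) + (X n a - x a) * y a + x a * y a)"
      by (simp add: algebra_simps fun_eq_iff)
    moreover have "integrable N (\<lambda>a. (X n a - x a) * (Y n a - y a))" "integrable N (\<lambda>a. x a * (Y n a - y a))"
      "integrable N (\<lambda>a. (X n a - x a) * y a)" "integrable N (\<lambda>a. x a * y a)"
      by (intro sq_int_mult_integrable dX dY l2convD(2)[OF X] l2convD(2)[OF Y])+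
    ultimately show ?thesis by (simp del: Bochner_Integration.integral_diff)
  qed
  show ?thesis unfolding eq using tendsto_add[OF tendsto_add[OF tendsto_add[OF 1 2] 3] tendsto_const] by simp
qed


section \<open>The weak formulation in real terms\<close>

lemma test_fun_dir_deriv:
  assumes "test_fun U f" shows "test_fun U (dir_deriv h f)"
proof (rule test_funI[where S="closure {x. f x \<noteq> 0}"])
  show "C_diff n (dir_deriv h f)" for n using test_funD(1)[OF assms, of "Suc n"] by simp
  show "x \<in> closure {x. f x \<noteq> 0}" if "dir_deriv h f x \<noteq> 0" for x
  proof (rule ccontr)
    assume x: "x \<notin> closure {x. f x \<noteq> 0}"
    have "dir_deriv h f x = 0"
    proof (rule dir_deriv_zero_open[of "- closure {x. f x \<noteq> 0}"])
      show "f y = 0" if "y \<in> - closure {x. f x \<noteq> 0}" for y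
        using that closure_subset[of "{x. f x \<noteq> 0}"] by auto
    qed (use x in auto)
    with that show False by simp
  qed
qed (use assms in \<open>auto simp: test_fun_def compact_imp_bounded\<close>)

lemma test_fun_mono: "test_fun U f \<Longrightarrow> U \<subseteq> V \<Longrightarrow> test_fun V f"
  unfolding test_fun_def by blast

lemma open_Omega: "open Omega"
proof -
  have "bar j = (\<Inter>k\<in>-{j}. {x. \<bar>x $ k\<bar> < 1/2})" for j unfolding bar_def by auto
  moreover have "open {x :: real^3. \<bar>x $ k\<bar> < 1/2}" for k by (intro open_Collect_less continuous_intros)
  ultimately have "open (bar j)" for j by (simp add: open_INT)
  then show ?thesis unfolding Omega_def by auto
qed

lemma set_lebesgue_restrict:
  fixes f :: "'a::euclidean_space \<Rightarrow> 'b::euclidean_space"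
  assumes "U \<in> sets lebesgue"
  shows "(LINT x:U|lebesgue. f x) = (\<integral>x. f x \<partial>lebesgue_on U)"
    "set_integrable lebesgue U f \<longleftrightarrow> integrable (lebesgue_on U) f"
    "set_borel_measurable lebesgue U f \<longleftrightarrow> f \<in> borel_measurable (lebesgue_on U)"
proof -
  have U: "U \<inter> space lebesgue \<in> sets lebesgue" using assms by simp
  show "(LINT x:U|lebesgue. f x) = (\<integral>x. f x \<partial>lebesgue_on U)"
    unfolding set_lebesgue_integral_def integral_restrict_space[OF U] ..
  show "set_integrable lebesgue U f \<longleftrightarrow> integrable (lebesgue_on U) f"
    unfolding set_integrable_def integrable_restrict_space[OF U] ..
  show "set_borel_measurable lebesgue U f \<longleftrightarrow> f \<in> borel_measurable (lebesgue_on U)"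
    unfolding set_borel_measurable_def borel_measurable_restrict_space_iff[OF U] ..
qed

lemma continuous_lebesgue_on_measurable:
  fixes f :: "'a::euclidean_space \<Rightarrow> 'b::euclidean_space"
  assumes "continuous_on UNIV f" shows "f \<in> borel_measurable (lebesgue_on U)"
proof -
  have "f \<in> borel_measurable lebesgue"
    using borel_measurable_continuous_onI[OF assms] by (intro measurable_completion) simp
  then show ?thesis by (rule measurable_restrict_space1)
qed

lemma continuous_bounded_on:
  fixes f :: "'a::euclidean_space \<Rightarrow> 'b::euclidean_space"
  assumes "continuous_on UNIV f" "bounded U"
  shows "\<exists>C. \<forall>x\<in>U. norm (f x) \<le> C"
proof -
  have "compact (f ` closure U)"
    using assms by (intro compact_continuous_image continuous_on_subset[OF assms(1)]) (auto simp: compact_eq_bounded_closed)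
  then obtain C where "\<And>x. x \<in> closure U \<Longrightarrow> norm (f x) \<le> C"
    by (meson bounded_iff compact_imp_bounded image_eqI)
  then show ?thesis using closure_subset by blast
qed

lemma integrable_continuous_on_bounded:
  fixes f :: "'a::euclidean_space \<Rightarrow> 'b::euclidean_space"
  assumes "continuous_on UNIV f" "U \<in> lmeasurable" "bounded U"
  shows "integrable (lebesgue_on U) f"
proof -
  obtain C where C: "\<And>x. x \<in> U \<Longrightarrow> norm (f x) \<le> C" using continuous_bounded_on[OF assms(1,3)] by blast
  interpret finite_measure "lebesgue_on U" by (rule finite_measure_lebesgue_on[OF assms(2)])
  show ?thesis
    by (rule integrable_const_bound[where B=C])
      (use C continuous_lebesgue_on_measurable[OF assms(1)] in \<open>auto simp: space_restrict_space\<close>)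
qed

lemma sq_int_continuous:
  fixes f :: "'a::euclidean_space \<Rightarrow> real"
  assumes "continuous_on UNIV f" "U \<in> lmeasurable" "bounded U"
  shows "sq_int (lebesgue_on U) f"
  unfolding sq_int_def using assms
  by (intro conjI continuous_lebesgue_on_measurable integrable_continuous_on_bounded continuous_intros)

lemma L2_on_integrable_diff:
  fixes f v :: "'a::euclidean_space \<Rightarrow> complex"
  assumes f: "continuous_on UNIV f" and v: "L2_on U v" and U: "U \<in> lmeasurable" "bounded U"
  shows "integrable (lebesgue_on U) (\<lambda>x. (norm (f x - v x))^2)"
proof (rule Bochner_Integration.integrable_bound)
  have Us: "U \<in> sets lebesgue" using U(1) by (rule fmeasurableD)
  have vm: "v \<in> borel_measurable (lebesgue_on U)" and vi: "integrable (lebesgue_on U) (\<lambda>x. (norm (v x))^2)"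
    using v unfolding L2_on_def set_lebesgue_restrict[OF Us] by auto
  have fi: "integrable (lebesgue_on U) (\<lambda>x. (norm (f x))^2)"
    by (rule integrable_continuous_on_bounded[OF _ U]) (intro continuous_intros f)
  show "integrable (lebesgue_on U) (\<lambda>x. 2 * (norm (f x))^2 + 2 * (norm (v x))^2)" using fi vi by simp
  show "(\<lambda>x. (norm (f x - v x))^2) \<in> borel_measurable (lebesgue_on U)"
    using vm continuous_lebesgue_on_measurable[OF f] by measurable
  show "AE x in lebesgue_on U. norm ((norm (f x - v x))^2) \<le> norm (2 * (norm (f x))^2 + 2 * (norm (v x))^2)"
  proof (rule AE_I2)
    fix x
    have "(norm (f x - v x))^2 \<le> (norm (f x) + norm (v x))^2"
      by (intro power_mono norm_triangle_ineq4) simp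
    also have "\<dots> \<le> 2 * (norm (f x))^2 + 2 * (norm (v x))^2"
      using zero_le_power2[of "norm (f x) - norm (v x)"] by (simp add: power2_eq_square algebra_simps)
    finally show "norm ((norm (f x - v x))^2) \<le> norm (2 * (norm (f x))^2 + 2 * (norm (v x))^2)" by simp
  qed
qed

lemma L2_on_part:
  fixes v :: "'a::euclidean_space \<Rightarrow> complex"
  assumes L: "bounded_linear L" "\<And>z. \<bar>L z\<bar> \<le> norm z" and v: "L2_on U v" and U: "U \<in> sets lebesgue"
  shows "sq_int (lebesgue_on U) (\<lambda>x. L (v x))"
proof -
  have vm: "v \<in> borel_measurable (lebesgue_on U)" and vi: "integrable (lebesgue_on U) (\<lambda>x. (norm (v x))^2)"
    using v unfolding L2_on_def set_lebesgue_restrict[OF U] by auto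
  have m: "(\<lambda>x. L (v x)) \<in> borel_measurable (lebesgue_on U)"
    by (rule measurable_compose[OF vm]) (rule borel_measurable_continuous_onI, rule linear_continuous_on[OF L(1)])
  moreover have "integrable (lebesgue_on U) (\<lambda>x. (L (v x))^2)"
  proof (rule Bochner_Integration.integrable_bound[OF vi])
    show "AE x in lebesgue_on U. norm ((L (v x))^2) \<le> norm ((norm (v x))^2)"
    proof (rule AE_I2)
      fix x
      have "\<bar>L (v x)\<bar>^2 \<le> (norm (v x))^2" using L(2) by (intro power_mono) auto
      then show "norm ((L (v x))^2) \<le> norm ((norm (v x))^2)" by simp
    qed
  qed (use m in measurable)
  ultimately show ?thesis by (simp add: sq_int_def)
qed

lemma l2conv_part:
  fixes v :: "'a::euclidean_space \<Rightarrow> complex"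
  assumes L: "bounded_linear L" "\<And>z. \<bar>L z\<bar> \<le> norm z" and v: "L2_on U v" and U: "U \<in> lmeasurable" "bounded U"
    and f: "\<And>n. continuous_on UNIV (f n)"
    and c: "(\<lambda>n. \<integral>x. (norm (f n x - v x))^2 \<partial>lebesgue_on U) \<longlonglongrightarrow> 0"
  shows "l2conv (lebesgue_on U) (\<lambda>n x. L (f n x)) (\<lambda>x. L (v x))"
  unfolding l2conv_def
proof (intro conjI allI)
  have Us: "U \<in> sets lebesgue" using U(1) by (rule fmeasurableD)
  have Lf: "continuous_on UNIV (\<lambda>x. L (f n x))" for n
    by (rule bounded_linear.continuous_on[OF L(1) f])
  show s1: "sq_int (lebesgue_on U) (\<lambda>x. L (f n x))" for n by (rule sq_int_continuous[OF Lf U])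
  show s2: "sq_int (lebesgue_on U) (\<lambda>x. L (v x))" by (rule L2_on_part[OF L v Us])
  show "(\<lambda>n. \<integral>x. (L (f n x) - L (v x))^2 \<partial>lebesgue_on U) \<longlonglongrightarrow> 0"
  proof (rule real_tendsto_sandwich[OF _ _ tendsto_const c])
    show "eventually (\<lambda>n. 0 \<le> (\<integral>x. (L (f n x) - L (v x))^2 \<partial>lebesgue_on U)) sequentially"
      by (auto intro: Bochner_Integration.integral_nonneg)
    show "eventually (\<lambda>n. (\<integral>x. (L (f n x) - L (v x))^2 \<partial>lebesgue_on U) \<le> (\<integral>x. (norm (f n x - v x))^2 \<partial>lebesgue_on U)) sequentially"
    proof (intro always_eventually allI integral_mono)
      fix n
      show "integrable (lebesgue_on U) (\<lambda>x. (L (f n x) - L (v x))^2)" using sq_int_diff[OF s1 s2] by (simp add: sq_int_def)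
      show "integrable (lebesgue_on U) (\<lambda>x. (norm (f n x - v x))^2)" by (rule L2_on_integrable_diff[OF f v U])
      fix x
      have "\<bar>L (f n x - v x)\<bar>^2 \<le> (norm (f n x - v x))^2" using L(2) by (intro power_mono) auto
      then show "(L (f n x) - L (v x))^2 \<le> (norm (f n x - v x))^2"
        by (simp add: linear_diff[OF bounded_linear.linear[OF L(1)], symmetric])
    qed
  qed
qed

lemma dir_deriv_part:
  assumes L: "bounded_linear L" and f: "f differentiable (at x)"
  shows "dir_deriv h (\<lambda>x. L (f x)) x = L (dir_deriv h f x)"
  by (rule dir_deriv_eqI) (rule bounded_linear.has_derivative[OF L dir_deriv_has_derivative[OF f]])

lemma test_fun_part:
  assumes L: "bounded_linear L" and f: "test_fun U f"
  shows "test_fun U (\<lambda>x. L (f x))"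
proof (rule test_funI[where S="closure {x. f x \<noteq> 0}"])
  show "C_diff n (\<lambda>x. L (f x))" for n by (rule C_diff_linear_comp[OF L test_funD(1)[OF f]])
  show "x \<in> closure {x. f x \<noteq> 0}" if "L (f x) \<noteq> 0" for x
    using that closure_subset[of "{x. f x \<noteq> 0}"] linear_0[OF bounded_linear.linear[OF L]] by (cases "f x = 0") auto
qed (use f in \<open>auto simp: test_fun_def compact_imp_bounded\<close>)

lemma continuous_times_L2_integrable:
  fixes \<psi> :: "'a::euclidean_space \<Rightarrow> real" and g :: "'a \<Rightarrow> complex"
  assumes \<psi>: "continuous_on UNIV \<psi>" and g: "L2_on U g" and U: "U \<in> lmeasurable" "bounded U"
  shows "integrable (lebesgue_on U) (\<lambda>x. \<psi> x *\<^sub>R g x)"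
proof -
  have Us: "U \<in> sets lebesgue" using U(1) by (rule fmeasurableD)
  have gm: "g \<in> borel_measurable (lebesgue_on U)" and gi: "integrable (lebesgue_on U) (\<lambda>x. (norm (g x))^2)"
    using g unfolding L2_on_def set_lebesgue_restrict[OF Us] by auto
  have pm: "\<psi> \<in> borel_measurable (lebesgue_on U)" by (rule continuous_lebesgue_on_measurable[OF \<psi>])
  have "sq_int (lebesgue_on U) (\<lambda>x. norm (g x))" using gm gi by (simp add: sq_int_def)
  from sq_int_mult_integrable[OF sq_int_continuous[OF \<psi> U] this]
  show ?thesis by (rule Bochner_Integration.integrable_bound) (use gm pm in auto)
qed

text \<open>Real and imaginary parts are treated at once through a real-linear functional \<open>L\<close>. On a large
  ball the distributional equation becomes the weak equation against the weak gradient \<open>G\<close>,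
  after one integration by parts with the test functions \<open>\<partial>\<^sub>b \<psi>\<close>; zero trace provides the
  approximation of \<open>L \<circ> v\<close> by test functions on \<open>\<Omega>\<close>.\<close>

lemma solution_real_form:
  fixes v :: "real^3 \<Rightarrow> complex"
  assumes sol: "dirichlet_solution Omega \<mu> v" and L: "bounded_linear L" "\<And>z. \<bar>L z\<bar> \<le> norm z"
    and r: "r > 0" and U: "U = Omega \<inter> ball 0 r"
  shows "\<exists>F G. (\<forall>n. test_fun Omega (F n)) \<and> l2conv (lebesgue_on U) F (\<lambda>x. L (v x)) \<and>
    (\<forall>j. l2conv (lebesgue_on U) (\<lambda>n. pd j (F n)) (G j)) \<and>
    (\<forall>\<psi>. test_fun U \<psi> \<longrightarrow> (\<Sum>j\<in>UNIV. \<integral>x. pd j \<psi> x * G j x \<partial>lebesgue_on U) = \<mu> * (\<integral>x. \<psi> x * L (v x) \<partial>lebesgue_on U))"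
proof -
  have oU: "open U" unfolding U by (intro open_Int open_Omega) simp
  have bU: "bounded U" unfolding U by auto
  have Ul: "U \<in> lmeasurable" using oU bU by (simp add: bounded_set_imp_lmeasurable)
  have Us: "U \<in> sets lebesgue" using Ul by (rule fmeasurableD)
  have Os: "Omega \<in> sets lebesgue" using open_Omega by simp
  have "zero_trace Omega v" using sol by (simp add: dirichlet_solution_def)
  then obtain f where f: "\<And>n. test_fun Omega (f n)" "H1_tendsto U f v"
    unfolding zero_trace_def U using r by meson
  then obtain g where g: "H1_with_gradient U v g" and
     "(\<lambda>n. (LINT x:U|lebesgue. (norm (f n x - v x))^2) +
          (\<Sum>b\<in>Basis. LINT x:U|lebesgue. (norm (dir_deriv b (f n) x - g b x))^2)) \<longlonglongrightarrow> 0"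
    unfolding H1_tendsto_def by blast
  then have lim: "(\<lambda>n. (\<integral>x. (norm (f n x - v x))^2 \<partial>lebesgue_on U) +
          (\<Sum>b\<in>Basis. \<integral>x. (norm (dir_deriv b (f n) x - g b x))^2 \<partial>lebesgue_on U)) \<longlonglongrightarrow> 0"
    unfolding set_lebesgue_restrict[OF Us] by blast
  have vL2: "L2_on U v" and gL2: "\<And>b. b \<in> Basis \<Longrightarrow> L2_on U (g b)"
    and ibp: "\<And>b \<phi>. b \<in> Basis \<Longrightarrow> test_fun U \<phi> \<Longrightarrow> (\<integral>x. dir_deriv b \<phi> x *\<^sub>R v x \<partial>lebesgue_on U) = - (\<integral>x. \<phi> x *\<^sub>R g b x \<partial>lebesgue_on U)"
    using g unfolding H1_with_gradient_def set_lebesgue_restrict[OF Us] by blast+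
  let ?T = "\<lambda>n. (\<integral>x. (norm (f n x - v x))^2 \<partial>lebesgue_on U)"
  let ?S = "\<lambda>b n. (\<integral>x. (norm (dir_deriv b (f n) x - g b x))^2 \<partial>lebesgue_on U)"
  have T0: "0 \<le> ?T n" and S0: "0 \<le> ?S b n" for n b by (auto intro: Bochner_Integration.integral_nonneg)
  have T: "?T \<longlonglongrightarrow> 0"
    by (rule real_tendsto_sandwich[OF _ _ tendsto_const lim]) (use T0 S0 in \<open>auto simp: sum_nonneg\<close>)
  have S: "?S b \<longlonglongrightarrow> 0" if b: "b \<in> Basis" for b
  proof (rule real_tendsto_sandwich[OF _ _ tendsto_const lim])
    show "eventually (\<lambda>n. ?S b n \<le> ?T n + (\<Sum>b\<in>Basis. ?S b n)) sequentially"
    proof (intro always_eventually allI)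
      fix n
      have "?S b n \<le> (\<Sum>b\<in>Basis. ?S b n)" by (rule member_le_sum[OF b]) (use S0 in auto)
      then show "?S b n \<le> ?T n + (\<Sum>b\<in>Basis. ?S b n)" using T0[of n] by linarith
    qed
  qed (use S0 in auto)
  have fc: "continuous_on UNIV (f n)" for n using C_diff_imp_continuous[OF test_funD(1)[OF f(1), of 0]] .
  have fdc: "continuous_on UNIV (dir_deriv b (f n))" for n b
    using C_diff_imp_continuous[OF test_funD(1)[OF test_fun_dir_deriv[OF f(1)], of 0]] .
  have fd: "f n differentiable (at x)" for n x using test_funD(1)[OF f(1), of "Suc 0" n] by simp
  define F where "F n x = L (f n x)" for n x
  define G where "G j x = L (g (axis j 1) x)" for j x
  have "test_fun Omega (F n)" for n unfolding F_def[abs_def] by (rule test_fun_part[OF L(1) f(1)])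
  moreover have "l2conv (lebesgue_on U) F (\<lambda>x. L (v x))"
    unfolding F_def[abs_def] by (rule l2conv_part[OF L vL2 Ul bU fc T])
  moreover have "l2conv (lebesgue_on U) (\<lambda>n. pd j (F n)) (G j)" for j
  proof -
    have "(\<lambda>n. pd j (F n)) = (\<lambda>n x. L (dir_deriv (axis j 1) (f n) x))"
      unfolding F_def[abs_def] using dir_deriv_part[OF L(1) fd] by (simp add: fun_eq_iff)
    then show ?thesis unfolding G_def[abs_def]
      using l2conv_part[OF L gL2[OF axis_Basis] Ul bU fdc S[OF axis_Basis]] by simp
  qed
  moreover have "(\<Sum>j\<in>UNIV. \<integral>x. pd j \<psi> x * G j x \<partial>lebesgue_on U) = \<mu> * (\<integral>x. \<psi> x * L (v x) \<partial>lebesgue_on U)"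
    if \<psi>: "test_fun U \<psi>" for \<psi>
  proof -
    have \<psi>O: "test_fun Omega \<psi>" by (rule test_fun_mono[OF \<psi>]) (simp add: U)
    have dd: "test_fun U (dir_deriv b (dir_deriv c \<psi>))" "test_fun U (dir_deriv b \<psi>)" for b c
      by (intro test_fun_dir_deriv \<psi>)+
    have cont: "continuous_on UNIV h" if "test_fun U h" for h :: "real^3 \<Rightarrow> real"
      using C_diff_imp_continuous[OF test_funD(1)[OF that, of 0]] .
    have ext: "(LINT x:Omega|lebesgue. h x *\<^sub>R v x) = (\<integral>x. h x *\<^sub>R v x \<partial>lebesgue_on U)"
      if "\<And>x. x \<notin> U \<Longrightarrow> h x = 0" for h :: "real^3 \<Rightarrow> real"
    proof -
      have "(LINT x:Omega|lebesgue. h x *\<^sub>R v x) = (LINT x:U|lebesgue. h x *\<^sub>R v x)"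
        unfolding set_lebesgue_integral_def
        by (rule Bochner_Integration.integral_cong) (use that in \<open>auto simp: indicator_def U\<close>)
      then show ?thesis unfolding set_lebesgue_restrict[OF Us] .
    qed
    have "- (LINT x:Omega|lebesgue. laplacian \<psi> x *\<^sub>R v x) = \<mu> *\<^sub>R (LINT x:Omega|lebesgue. \<psi> x *\<^sub>R v x)"
      using sol \<psi>O unfolding dirichlet_solution_def helmholtz_distr_def by blast
    moreover have "laplacian \<psi> x = 0" if "x \<notin> U" for x
      unfolding laplacian_def using test_funD(2)[OF dd(1) that] by simp
    ultimately have h: "- (\<integral>x. laplacian \<psi> x *\<^sub>R v x \<partial>lebesgue_on U) = \<mu> *\<^sub>R (\<integral>x. \<psi> x *\<^sub>R v x \<partial>lebesgue_on U)"
      using ext[of "laplacian \<psi>"] ext[of \<psi>] test_funD(2)[OF \<psi>] by simp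
    have "(\<integral>x. laplacian \<psi> x *\<^sub>R v x \<partial>lebesgue_on U) = (\<Sum>b\<in>Basis. \<integral>x. dir_deriv b (dir_deriv b \<psi>) x *\<^sub>R v x \<partial>lebesgue_on U)"
      unfolding laplacian_def scaleR_sum_left
      by (rule Bochner_Integration.integral_sum) (rule continuous_times_L2_integrable[OF cont[OF dd(1)] vL2 Ul bU])
    also have "\<dots> = (\<Sum>b\<in>Basis. - (\<integral>x. dir_deriv b \<psi> x *\<^sub>R g b x \<partial>lebesgue_on U))"
      by (rule sum.cong[OF HOL.refl]) (rule ibp[OF _ dd(2)])
    finally have "(\<Sum>b\<in>Basis. \<integral>x. dir_deriv b \<psi> x *\<^sub>R g b x \<partial>lebesgue_on U) = \<mu> *\<^sub>R (\<integral>x. \<psi> x *\<^sub>R v x \<partial>lebesgue_on U)"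
      using h by (simp add: sum_negf)
    then have eq: "L (\<Sum>b\<in>Basis. \<integral>x. dir_deriv b \<psi> x *\<^sub>R g b x \<partial>lebesgue_on U) = L (\<mu> *\<^sub>R (\<integral>x. \<psi> x *\<^sub>R v x \<partial>lebesgue_on U))" by simp
    note linear = bounded_linear.linear[OF L(1)]
    have Li: "L (\<integral>x. h x *\<^sub>R k x \<partial>lebesgue_on U) = (\<integral>x. h x * L (k x) \<partial>lebesgue_on U)"
      if "continuous_on UNIV h" "L2_on U k" for h :: "real^3 \<Rightarrow> real" and k
      using integral_bounded_linear[OF L(1) continuous_times_L2_integrable[OF that Ul bU]] linear_scale[OF linear] by simp
    have "L (\<Sum>b\<in>Basis. \<integral>x. dir_deriv b \<psi> x *\<^sub>R g b x \<partial>lebesgue_on U) = (\<Sum>b\<in>Basis. \<integral>x. dir_deriv b \<psi> x * L (g b x) \<partial>lebesgue_on U)"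
      unfolding linear_sum[OF linear] by (intro sum.cong HOL.refl Li cont[OF dd(2)] gL2)
    also have "\<dots> = (\<Sum>j\<in>UNIV. \<integral>x. pd j \<psi> x * G j x \<partial>lebesgue_on U)"
      unfolding sum_Basis_vec G_def ..
    finally show ?thesis
      using eq linear_scale[OF linear] Li[OF cont[OF \<psi>] vL2] by simp
  qed
  ultimately show ?thesis by blast
qed


section \<open>Cutting off the solution\<close>

text \<open>A product of three plateau functions. Inside a bar only the factor along the bar varies.\<close>

definition cutoff :: "real \<Rightarrow> real \<Rightarrow> (real^3 \<Rightarrow> real) \<Rightarrow> bool" where
  "cutoff K R c \<longleftrightarrow> (\<forall>n. C_diff n c) \<and> (\<forall>x. (\<forall>j. \<bar>x $ j\<bar> \<le> R) \<longrightarrow> c x = 1) \<and>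
     (\<forall>x. (\<forall>j. \<bar>x $ j\<bar> < R) \<longrightarrow> (\<forall>j. pd j c x = 0)) \<and> (\<forall>x. norm x > 6 * R \<longrightarrow> c x = 0) \<and>
     (\<forall>x j. \<bar>pd j c x\<bar> \<le> K / R) \<and> (\<forall>x. (\<exists>k. \<bar>x $ k\<bar> > 2 * R) \<longrightarrow> (\<forall>j. pd j c x = 0))"

lemma cutoffD:
  assumes "cutoff K R c"
  shows "C_diff n c" "(\<forall>j. \<bar>x $ j\<bar> \<le> R) \<Longrightarrow> c x = 1" "(\<forall>j. \<bar>x $ j\<bar> < R) \<Longrightarrow> pd j c x = 0"
    "norm x > 6 * R \<Longrightarrow> c x = 0" "\<bar>pd j c x\<bar> \<le> K / R" "\<bar>x $ k\<bar> > 2 * R \<Longrightarrow> pd j c x = 0"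
  using assms unfolding cutoff_def by blast+

lemma cutoff_exists: "\<exists>K>0. \<forall>R\<ge>1. \<exists>c. cutoff K R c"
proof -
  obtain K where K: "K > 0" and pl: "\<And>a b. 0 < a \<Longrightarrow> a < b \<Longrightarrow> \<exists>p p'. plateau K a b p p'"
    using plateau_exists by blast
  have "\<exists>c. cutoff K R c" if R: "R \<ge> 1" for R
  proof -
    obtain h h' where hh: "plateau K R (2 * R) h h'" using pl[of R "2 * R"] R by auto
    have RR: "2 * R - R = R" by simp
    note h = plateauD[OF hh, unfolded RR] and h'0 = plateauD(9)[OF hh]
    define c where "c = tensor (\<lambda>_. h)"
    have pdc: "pd j c x = (\<Prod>k\<in>UNIV. (if k = j then h' (x $ k) else h (x $ k)))" for j x
      unfolding c_def pd_tensor[of "\<lambda>_. h" "\<lambda>_. h'", OF h(2)] tensor_def by (rule prod.cong) auto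
    have "C_diff n c" for n unfolding c_def by (rule C_diff_tensor[OF h(1)])
    moreover have "c x = 1" if "\<forall>j. \<bar>x $ j\<bar> \<le> R" for x
      unfolding c_def tensor_def using that h(5) by simp
    moreover have "pd j c x = 0" if "\<forall>j. \<bar>x $ j\<bar> < R" for x j
      unfolding pdc using that h'0 by (auto simp: prod_zero_iff intro!: exI[of _ j])
    moreover have "c x = 0" if "norm x > 6 * R" for x
    proof -
      have "\<exists>j. \<bar>x $ j\<bar> > 2 * R"
      proof (rule ccontr)
        assume "\<nexists>j. \<bar>x $ j\<bar> > 2 * R"
        then have "(\<Sum>j\<in>UNIV. \<bar>x $ j\<bar>) \<le> (\<Sum>j\<in>(UNIV::3 set). 2 * R)" by (intro sum_mono) (simp add: not_less)
        with norm_le_l1_cart[of x] that show False by simp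
      qed
      then obtain j where "h (x $ j) = 0" using h(6) less_imp_le by blast
      then show ?thesis unfolding c_def tensor_def by (intro prod_zero) auto
    qed
    moreover have "\<bar>pd j c x\<bar> \<le> K / R" for j x
    proof -
      have "\<bar>pd j c x\<bar> = (\<Prod>k\<in>UNIV. \<bar>if k = j then h' (x $ k) else h (x $ k)\<bar>)" unfolding pdc abs_prod ..
      also have "\<dots> \<le> (\<Prod>k\<in>UNIV. if k = j then K / R else 1)"
        by (rule prod_mono) (use h in auto)
      also have "\<dots> = K / R" by simp
      finally show ?thesis .
    qed
    moreover have "pd j c x = 0" if "\<bar>x $ k\<bar> > 2 * R" for x j k
      unfolding pdc using that h'0[of "x $ k"] h(6)[of "x $ k"] by (intro prod_zero[OF finite] bexI[of _ k]) auto
    ultimately show ?thesis unfolding cutoff_def by (intro exI[of _ c]) blast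
  qed
  then show ?thesis using K by blast
qed

lemma test_fun_smooth_mult:
  fixes f c :: "'a::euclidean_space \<Rightarrow> real"
  assumes "\<And>n. C_diff n c" "test_fun U f" shows "test_fun U (\<lambda>x. c x * f x)"
proof (rule test_funI[where S="closure {x. f x \<noteq> 0}"])
  show "C_diff n (\<lambda>x. c x * f x)" for n by (intro C_diff_mult assms test_funD(1)[OF assms(2)])
  show "x \<in> closure {x. f x \<noteq> 0}" if "c x * f x \<noteq> 0" for x
    using that closure_subset[of "{x. f x \<noteq> 0}"] by auto
qed (use assms in \<open>auto simp: test_fun_def compact_imp_bounded\<close>)

lemma test_fun_combination:
  fixes f g :: "'a::euclidean_space \<Rightarrow> real"
  assumes "test_fun U f" "test_fun U g" shows "test_fun U (\<lambda>x. f x - a * g x)"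
proof -
  have "test_fun U (\<lambda>x. f x + (- a) * g x)"
    by (rule test_fun_add[OF assms(1) test_fun_smooth_mult[OF C_diff_const assms(2)]])
  then show ?thesis by simp
qed

lemma test_fun_localize:
  fixes f :: "'a::euclidean_space \<Rightarrow> real"
  assumes "test_fun U f" "\<And>x. norm x > r' \<Longrightarrow> f x = 0" "r' < r"
  shows "test_fun (U \<inter> ball 0 r) f"
proof -
  have "closure {x. f x \<noteq> 0} \<subseteq> cball 0 r'"
  proof (intro closure_minimal subsetI)
    show "x \<in> cball 0 r'" if "x \<in> {x. f x \<noteq> 0}" for x
      using that assms(2)[of x] by (cases "norm x > r'") auto
  qed simp
  also have "\<dots> \<subseteq> ball 0 r" using assms(3) by auto
  finally show ?thesis using assms(1) unfolding test_fun_def by auto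
qed

lemma integral_lborel_restrict:
  fixes h :: "'a::euclidean_space \<Rightarrow> real"
  assumes "h \<in> borel_measurable borel" "\<And>x. x \<notin> U \<Longrightarrow> h x = 0" "U \<in> sets lebesgue"
  shows "(LBINT x. h x) = (\<integral>x. h x \<partial>lebesgue_on U)"
proof -
  have "(\<integral>x. h x \<partial>lebesgue_on U) = (\<integral>x. indicator U x *\<^sub>R h x \<partial>lebesgue)"
    by (rule integral_restrict_space) (use assms in simp)
  also have "(\<lambda>x. indicator U x *\<^sub>R h x) = h"
  proof
    show "indicator U x *\<^sub>R h x = h x" for x using assms(2)[of x] by (cases "x \<in> U") auto
  qed
  also have "(\<integral>x. h x \<partial>lebesgue) = (LBINT x. h x)" by (rule integral_completion) (use assms in simp)
  finally show ?thesis ..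
qed

lemma l2conv_continuous_mult:
  fixes w :: "'a::euclidean_space \<Rightarrow> real"
  assumes "l2conv (lebesgue_on U) X x" "continuous_on UNIV w" "bounded U"
  shows "l2conv (lebesgue_on U) (\<lambda>n a. w a * X n a) (\<lambda>a. w a * x a)"
proof -
  obtain C where "\<And>a. a \<in> U \<Longrightarrow> norm (w a) \<le> C" using continuous_bounded_on[OF assms(2,3)] by blast
  then show ?thesis
    by (intro l2conv_mult[OF assms(1) continuous_lebesgue_on_measurable[OF assms(2)], where C=C])
      (auto simp: space_restrict_space)
qed

lemma test_fun_continuous:
  assumes "test_fun U f" shows "continuous_on UNIV f" "continuous_on UNIV (dir_deriv h f)"
  using C_diff_imp_continuous[OF test_funD(1)[OF assms, of 0]]
    C_diff_imp_continuous[OF test_funD(1)[OF test_fun_dir_deriv[OF assms], of 0]] by blast+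

lemma smooth_differentiable: "(\<And>n. C_diff n f) \<Longrightarrow> f differentiable (at x)"
  using C_diff_1D(1)[of f x] by blast

lemma dir_deriv_mult:
  fixes f g :: "'a::euclidean_space \<Rightarrow> real"
  assumes "f differentiable (at x)" "g differentiable (at x)"
  shows "dir_deriv h (\<lambda>x. f x * g x) x = f x * dir_deriv h g x + dir_deriv h f x * g x"
  by (rule dir_deriv_eqI) (intro has_derivative_mult dir_deriv_has_derivative assms)

lemma sq_int_inQ:
  assumes "U \<in> lmeasurable" "bounded U" shows "sq_int (lebesgue_on U) inQ"
proof -
  have "sq_int (lebesgue_on U) (\<lambda>a. inQ a * 1)"
  proof (rule sq_int_bounded_mult[where C=1])
    show "sq_int (lebesgue_on U) (\<lambda>_. 1)" by (rule sq_int_continuous[OF _ assms]) simp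
    show "inQ \<in> borel_measurable (lebesgue_on U)"
      by (intro measurable_restrict_space1 measurable_completion) simp
    show "\<bar>inQ a\<bar> \<le> 1" for a by (simp add: inQ_def)
  qed
  then show ?thesis by simp
qed

text \<open>Let \<open>u = L \<circ> v\<close> and apply coercivity to \<open>w\<^sub>n = c F\<^sub>n - t \<phi>\<close>, where the test functions \<open>F\<^sub>n\<close>
  converge to \<open>u\<close>. The weak equation is tested with \<open>\<psi>\<^sub>n = c\<^sup>2 F\<^sub>n - 2 t \<phi>\<close>. In the limit the
  pointwise identity \<open>|\<nabla>(c u - t \<phi>)|\<^sup>2 = \<nabla>u \<sqdot> \<nabla>(c\<^sup>2 u - 2 t \<phi>) + |\<nabla>c|\<^sup>2 u\<^sup>2 + t\<^sup>2 |\<nabla>\<phi>|\<^sup>2\<close>,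
  together with its analogue without gradients, removes \<open>\<nabla>u\<close> altogether. It holds because \<open>c =
  1\<close> near the support of \<open>\<phi>\<close>.\<close>

lemma cutoff_inequality:
  fixes v :: "real^3 \<Rightarrow> complex"
  assumes sol: "dirichlet_solution Omega (2 * pi^2) v" and L: "bounded_linear L" "\<And>z. \<bar>L z\<bar> \<le> norm z"
    and coer: "\<And>f. trial f \<Longrightarrow> k * (LBINT x. rho x * (f x)^2) \<le> energy f + C * (cubeM f)^2"
    and R: "R \<ge> 1" and U: "U = Omega \<inter> ball 0 (7 * R)"
    and cut: "cutoff K R c"
    and \<phi>: "test_fun Omega \<phi>" "\<And>x. norm x \<ge> R \<Longrightarrow> \<phi> x = 0" "\<And>x j. norm x \<ge> R \<Longrightarrow> pd j \<phi> x = 0"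
  shows "sq_int (lebesgue_on U) (\<lambda>x. L (v x))" (is ?sq)
    "k * (\<integral>x. rho x * (c x * L (v x) - t * \<phi> x)^2 \<partial>lebesgue_on U)
    \<le> (\<Sum>j\<in>UNIV. \<integral>x. (pd j c x)^2 * (L (v x))^2 \<partial>lebesgue_on U) + t^2 * energy \<phi>
      + C * (\<integral>x. inQ x * (c x * L (v x) - t * \<phi> x) \<partial>lebesgue_on U)^2" (is ?le)
proof -
  note c = cutoffD[OF cut]
  define u where "u x = L (v x)" for x
  let ?N = "lebesgue_on U"
  have oU: "open U" unfolding U by (intro open_Int open_Omega) simp
  have bU: "bounded U" unfolding U by auto
  have Ul: "U \<in> lmeasurable" using oU bU by (simp add: bounded_set_imp_lmeasurable)
  have Us: "U \<in> sets lebesgue" using Ul by (rule fmeasurableD)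
  from solution_real_form[OF sol L _ U] R obtain F G where F: "\<And>n. test_fun Omega (F n)"
    and Fu: "l2conv ?N F u" and FG: "\<And>j. l2conv ?N (\<lambda>n. pd j (F n)) (G j)"
    and weak: "\<And>\<psi>. test_fun U \<psi> \<Longrightarrow> (\<Sum>j\<in>UNIV. \<integral>x. pd j \<psi> x * G j x \<partial>?N) = (2 * pi^2) * (\<integral>x. \<psi> x * u x \<partial>?N)"
    unfolding u_def by auto
  have su: "sq_int ?N u" by (rule l2convD(2)[OF Fu])
  then show ?sq unfolding u_def .
  have sG: "sq_int ?N (G j)" for j by (rule l2convD(2)[OF FG])
  have cc: "continuous_on UNIV c" "continuous_on UNIV (pd j c)" for j
    using C_diff_1D[of c] c(1) by blast+
  have c\<phi>: "c x * \<phi> x = \<phi> x" "c x * pd j \<phi> x = pd j \<phi> x" "pd j c x * pd j \<phi> x = 0" for x j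
  proof -
    have "norm x \<ge> R \<or> (c x = 1 \<and> pd j c x = 0)"
      using component_le_norm_cart[of x] c(2)[of x] c(3)[of x j] le_less_trans[of _ "norm x" R]
      by (metis less_imp_le not_le)
    then show "c x * \<phi> x = \<phi> x" "c x * pd j \<phi> x = pd j \<phi> x" "pd j c x * pd j \<phi> x = 0"
      using \<phi>(2,3)[of x] by auto
  qed
  have cd: "c differentiable (at x)" for x by (rule smooth_differentiable[OF c(1)])
  have Fd: "F n differentiable (at x)" for n x by (rule smooth_differentiable[OF test_funD(1)[OF F]])
  have \<phi>d: "\<phi> differentiable (at x)" for x by (rule smooth_differentiable[OF test_funD(1)[OF \<phi>(1)]])
  define w where "w n x = c x * F n x - t * \<phi> x" for n x
  define \<psi> where "\<psi> n x = c x * (c x * F n x) - (2 * t) * \<phi> x" for n x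
  have \<phi>U: "test_fun U \<phi>" unfolding U by (rule test_fun_localize[OF \<phi>(1), of R]) (use \<phi>(2) R in auto)
  have cFU: "test_fun U (\<lambda>x. c x * F n x)" for n
    unfolding U by (rule test_fun_localize[OF test_fun_smooth_mult[OF c(1) F], of "6 * R"]) (use c(4) R in auto)
  have wU: "test_fun U (w n)" for n unfolding w_def[abs_def] by (rule test_fun_combination[OF cFU \<phi>U])
  have \<psi>U: "test_fun U (\<psi> n)" for n
    unfolding \<psi>_def[abs_def] by (rule test_fun_combination[OF test_fun_smooth_mult[OF c(1) cFU] \<phi>U])
  have cFd: "(\<lambda>x. c x * F n x) differentiable (at x)" for n x by (rule smooth_differentiable[OF test_funD(1)[OF cFU]])
  have diffc: "dir_deriv h (\<lambda>x. f x - a * g x) x = dir_deriv h f x - a * dir_deriv h g x"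
    if "f differentiable (at x)" "g differentiable (at x)" for f g :: "real^3 \<Rightarrow> real" and a h x
    using dir_deriv_combination[OF that, of h 1 "- a"] by simp
  have pdw: "pd j (w n) = (\<lambda>x. (c x * pd j (F n) x + pd j c x * F n x) - t * pd j \<phi> x)" for j n
    unfolding w_def[abs_def] by (rule ext) (simp only: diffc[OF cFd \<phi>d] dir_deriv_mult[OF cd Fd])
  have pd\<psi>: "pd j (\<psi> n) = (\<lambda>x. (c x * (c x * pd j (F n) x + pd j c x * F n x) + pd j c x * (c x * F n x)) - (2 * t) * pd j \<phi> x)" for j n
    unfolding \<psi>_def[abs_def]
    by (rule ext) (simp only: diffc[OF smooth_differentiable[OF test_funD(1)[OF test_fun_smooth_mult[OF c(1) cFU]]] \<phi>d]
      dir_deriv_mult[OF cd cFd] dir_deriv_mult[OF cd Fd])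
  have s\<phi>: "sq_int ?N \<phi>" "sq_int ?N (pd j \<phi>)" for j
    using test_fun_continuous[OF \<phi>(1)] by (intro sq_int_continuous Ul bU; blast)+
  note l2 = l2conv_add l2conv_diff l2conv_cmult l2conv_continuous_mult[OF _ _ bU] cc Fu FG l2conv_const s\<phi>
  define W where "W x = c x * u x - t * \<phi> x" for x
  define W' where "W' j x = (c x * G j x + pd j c x * u x) - t * pd j \<phi> x" for j x
  define P where "P x = c x * (c x * u x) - (2 * t) * \<phi> x" for x
  define P' where "P' j x = (c x * (c x * G j x + pd j c x * u x) + pd j c x * (c x * u x)) - (2 * t) * pd j \<phi> x" for j x
  have wW: "l2conv ?N w W" unfolding w_def[abs_def] W_def[abs_def] by (intro l2)
  have wW': "l2conv ?N (\<lambda>n. pd j (w n)) (W' j)" for j unfolding pdw W'_def[abs_def] by (intro l2)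
  have \<psi>P: "l2conv ?N \<psi> P" unfolding \<psi>_def[abs_def] P_def[abs_def] by (intro l2)
  have \<psi>P': "l2conv ?N (\<lambda>n. pd j (\<psi> n)) (P' j)" for j unfolding pd\<psi> P'_def[abs_def] by (intro l2)

  \<comment> \<open>The weak equation for \<open>\<psi>\<^sub>n\<close>, in the limit \<open>n \<rightarrow> \<infinity>\<close>.\<close>
  have weakP: "(\<Sum>j\<in>UNIV. \<integral>x. P' j x * G j x \<partial>?N) = (2 * pi^2) * (\<integral>x. P x * u x \<partial>?N)"
  proof (rule LIMSEQ_unique)
    show "(\<lambda>n. \<Sum>j\<in>UNIV. \<integral>x. pd j (\<psi> n) x * G j x \<partial>?N) \<longlonglongrightarrow> (\<Sum>j\<in>UNIV. \<integral>x. P' j x * G j x \<partial>?N)"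
      by (intro tendsto_sum l2conv_integral_mult[OF \<psi>P'] l2conv_const sG)
    show "(\<lambda>n. \<Sum>j\<in>UNIV. \<integral>x. pd j (\<psi> n) x * G j x \<partial>?N) \<longlonglongrightarrow> (2 * pi^2) * (\<integral>x. P x * u x \<partial>?N)"
      unfolding weak[OF \<psi>U] by (intro tendsto_mult_left l2conv_integral_mult[OF \<psi>P] l2conv_const su)
  qed

  have toN: "(LBINT x. g x * h x) = (\<integral>x. g x * h x \<partial>?N)" if "test_fun U h" "g \<in> borel_measurable borel" for g h :: "real^3 \<Rightarrow> real"
    by (rule integral_lborel_restrict[OF _ _ Us])
      (use that test_funD(2)[OF that(1)] borel_measurable_continuous_onI[OF test_fun_continuous(1)[OF that(1)]] in auto)
  have meas: "h \<in> borel_measurable borel" if "test_fun U h" for h :: "real^3 \<Rightarrow> real"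
    by (rule borel_measurable_continuous_onI[OF test_fun_continuous(1)[OF that]])
  have energyN: "energy h = (\<Sum>j\<in>UNIV. \<integral>x. pd j h x * pd j h x \<partial>?N) - 2 * pi^2 * (\<integral>x. h x * h x \<partial>?N)"
    if "test_fun U h" for h :: "real^3 \<Rightarrow> real"
    unfolding energy_def power2_eq_square
    by (simp only: toN[OF that meas[OF that]] toN[OF test_fun_dir_deriv[OF that] meas[OF test_fun_dir_deriv[OF that]]])
  have UO: "U \<subseteq> Omega" by (simp add: U)
  have tw: "trial (w n)" for n by (rule test_fun_trial[OF test_fun_mono[OF wU UO]])

  have e1: "(\<lambda>n. energy (w n)) \<longlonglongrightarrow> (\<Sum>j\<in>UNIV. \<integral>x. W' j x * W' j x \<partial>?N) - 2 * pi^2 * (\<integral>x. W x * W x \<partial>?N)"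
    unfolding energyN[OF wU] by (intro tendsto_diff tendsto_sum tendsto_mult_left l2conv_integral_mult wW wW')
  have e2: "(\<lambda>n. cubeM (w n)) \<longlonglongrightarrow> (\<integral>x. inQ x * W x \<partial>?N)"
    unfolding cubeM_def toN[OF wU measurable_inQ] by (intro l2conv_integral_mult l2conv_const sq_int_inQ[OF Ul bU] wW)
  have rhoc: "continuous_on UNIV rho"
  proof -
    have "norm x + 1/2 \<noteq> 0" for x :: "real^3" using norm_ge_zero[of x] by linarith
    then have "4 * (norm x + 1/2)^2 \<noteq> 0" for x :: "real^3" by simp
    then show ?thesis unfolding rho_def[abs_def] by (intro continuous_intros ballI)
  qed
  have e3: "(\<lambda>n. LBINT x. rho x * (w n x)^2) \<longlonglongrightarrow> (\<integral>x. rho x * (W x)^2 \<partial>?N)"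
  proof -
    have "(LBINT x. rho x * (w n x)^2) = (\<integral>x. (rho x * w n x) * w n x \<partial>?N)" for n
      using toN[OF wU, of "\<lambda>x. rho x * w n x" n] meas[OF wU, of n] by (simp add: power2_eq_square mult.assoc)
    moreover have "(\<lambda>n. \<integral>x. (rho x * w n x) * w n x \<partial>?N) \<longlonglongrightarrow> (\<integral>x. (rho x * W x) * W x \<partial>?N)"
      by (intro l2conv_integral_mult l2conv_continuous_mult[OF _ rhoc bU] wW)
    ultimately show ?thesis by (simp add: power2_eq_square mult.assoc)
  qed
  have lim: "k * (\<integral>x. rho x * (W x)^2 \<partial>?N)
    \<le> ((\<Sum>j\<in>UNIV. \<integral>x. W' j x * W' j x \<partial>?N) - 2 * pi^2 * (\<integral>x. W x * W x \<partial>?N)) + C * (\<integral>x. inQ x * W x \<partial>?N)^2"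
  proof (rule LIMSEQ_le)
    show "(\<lambda>n. k * (LBINT x. rho x * (w n x)^2)) \<longlonglongrightarrow> k * (\<integral>x. rho x * (W x)^2 \<partial>?N)"
      by (intro tendsto_mult_left e3)
    show "(\<lambda>n. energy (w n) + C * (cubeM (w n))^2) \<longlonglongrightarrow> ((\<Sum>j\<in>UNIV. \<integral>x. W' j x * W' j x \<partial>?N) - 2 * pi^2 * (\<integral>x. W x * W x \<partial>?N)) + C * (\<integral>x. inQ x * W x \<partial>?N)^2"
      by (intro tendsto_add tendsto_mult_left tendsto_power e1 e2)
    show "\<exists>N. \<forall>n\<ge>N. k * (LBINT x. rho x * (w n x)^2) \<le> energy (w n) + C * (cubeM (w n))^2"
      using coer[OF tw] by blast
  qed
  have sP: "sq_int ?N P" "sq_int ?N (P' j)" for j using l2convD(2)[OF \<psi>P] l2convD(2)[OF \<psi>P'] by blast+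
  have scu: "sq_int ?N (\<lambda>x. pd j c x * u x)" for j
    using l2convD(2)[OF l2conv_continuous_mult[OF Fu cc(2) bU]] .
  have W'sq: "(\<integral>x. W' j x * W' j x \<partial>?N) = (\<integral>x. P' j x * G j x \<partial>?N) + (\<integral>x. (pd j c x)^2 * (u x)^2 \<partial>?N) + t^2 * (\<integral>x. pd j \<phi> x * pd j \<phi> x \<partial>?N)" for j
  proof -
    \<comment> \<open>The cross terms between \<open>\<phi>\<close> and the cutoff vanish.\<close>
    have "W' j x * W' j x = P' j x * G j x + (pd j c x * u x) * (pd j c x * u x) + t^2 * (pd j \<phi> x * pd j \<phi> x)" for x
    proof -
      have "W' j x * W' j x = P' j x * G j x + (pd j c x * u x) * (pd j c x * u x) + t^2 * (pd j \<phi> x * pd j \<phi> x)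
         - 2 * t * (c x * pd j \<phi> x - pd j \<phi> x) * G j x - 2 * t * (pd j c x * pd j \<phi> x) * u x"
        unfolding W'_def P'_def by (simp add: power2_eq_square algebra_simps)
      then show ?thesis by (simp add: c\<phi>)
    qed
    moreover have "integrable ?N (\<lambda>x. P' j x * G j x)" "integrable ?N (\<lambda>x. (pd j c x * u x) * (pd j c x * u x))"
      "integrable ?N (\<lambda>x. pd j \<phi> x * pd j \<phi> x)"
      by (intro sq_int_mult_integrable sP sG scu s\<phi>)+
    ultimately have "(\<integral>x. W' j x * W' j x \<partial>?N) = (\<integral>x. P' j x * G j x \<partial>?N) + (\<integral>x. (pd j c x * u x) * (pd j c x * u x) \<partial>?N) + t^2 * (\<integral>x. pd j \<phi> x * pd j \<phi> x \<partial>?N)"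
      by simp
    moreover have "(\<lambda>x. (pd j c x * u x) * (pd j c x * u x)) = (\<lambda>x. (pd j c x)^2 * (u x)^2)"
      by (simp add: power2_eq_square algebra_simps fun_eq_iff)
    ultimately show ?thesis by simp
  qed
  have Wsq: "(\<integral>x. W x * W x \<partial>?N) = (\<integral>x. P x * u x \<partial>?N) + t^2 * (\<integral>x. \<phi> x * \<phi> x \<partial>?N)"
  proof -
    have "W x * W x = P x * u x + t^2 * (\<phi> x * \<phi> x)" for x
    proof -
      have "W x * W x = P x * u x + t^2 * (\<phi> x * \<phi> x) - 2 * t * (c x * \<phi> x - \<phi> x) * u x"
        unfolding W_def P_def by (simp add: power2_eq_square algebra_simps)
      then show ?thesis by (simp add: c\<phi>)
    qed
    moreover have "integrable ?N (\<lambda>x. P x * u x)" "integrable ?N (\<lambda>x. \<phi> x * \<phi> x)"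
      by (intro sq_int_mult_integrable sP su s\<phi>)+
    ultimately show ?thesis by simp
  qed
  have "(\<Sum>j\<in>UNIV. \<integral>x. W' j x * W' j x \<partial>?N) - 2 * pi^2 * (\<integral>x. W x * W x \<partial>?N)
    = (\<Sum>j\<in>UNIV. \<integral>x. (pd j c x)^2 * (u x)^2 \<partial>?N) + t^2 * energy \<phi>"
    unfolding W'sq Wsq energyN[OF \<phi>U] sum.distrib weakP by (simp add: sum_distrib_left[symmetric] algebra_simps)
  with lim show ?le unfolding W_def u_def by simp
qed

text \<open>The gradient of the cutoff lives in the three bars, on a set of volume at most \<open>12 R\<close>.\<close>

lemma cutoff_error:
  fixes u :: "real^3 \<Rightarrow> real"
  assumes R: "R \<ge> 1" and U: "U \<in> sets lebesgue" "U \<subseteq> Omega"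
    and B: "AE x in lebesgue. x \<in> Omega \<longrightarrow> \<bar>u x\<bar> \<le> B" and su: "sq_int (lebesgue_on U) u"
    and d: "continuous_on UNIV d" "\<And>x. \<bar>d x\<bar> \<le> K / R" "\<And>x k. \<bar>x $ k\<bar> > 2 * R \<Longrightarrow> d x = 0"
  shows "(\<integral>x. (d x)^2 * (u x)^2 \<partial>lebesgue_on U) \<le> 12 * (K^2 * B^2) / R"
proof -
  let ?lo = "\<lambda>i. (\<chi> k. if k = i then - (2 * R) else - (1/2)) :: real^3"
  let ?hi = "\<lambda>i. (\<chi> k. if k = i then 2 * R else 1/2) :: real^3"
  \<comment> \<open>Within distance \<open>2 R\<close> the bar \<open>i\<close> lies in a closed box of volume \<open>4 R\<close>.\<close>
  have mem: "x \<in> cbox (?lo i) (?hi i)" if "x \<in> bar i" "\<bar>x $ i\<bar> \<le> 2 * R" for x i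
    using that by (force simp: mem_box_cart bar_def abs_le_iff dest: less_imp_le)
  have ms: "measure lebesgue (cbox (?lo i) (?hi i)) = 4 * R" for i
  proof -
    have "measure lebesgue (cbox (?lo i) (?hi i)) = (\<Prod>k\<in>UNIV. ?hi i $ k - ?lo i $ k)"
      unfolding measure_completion[OF sets_lborel[THEN equalityD2, THEN subsetD, OF borel_closed[OF closed_cbox]]]
      by (rule content_cbox_cart) (use R in \<open>simp add: interval_ne_empty_cart\<close>)
    also have "\<dots> = (\<Prod>k\<in>UNIV. if k = i then 4 * R else 1)" by (rule prod.cong) auto
    finally show ?thesis by simp
  qed
  have "(\<integral>x. (d x)^2 * (u x)^2 \<partial>lebesgue_on U) = (\<integral>x. indicator U x *\<^sub>R ((d x)^2 * (u x)^2) \<partial>lebesgue)"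
    by (rule integral_restrict_space) (use U in simp)
  also have "\<dots> \<le> (\<integral>x. (K / R)^2 * B^2 * (\<Sum>i\<in>UNIV. indicator (cbox (?lo i) (?hi i)) x) \<partial>lebesgue)"
  proof (rule integral_mono_AE)
    show "integrable lebesgue (\<lambda>x. (K / R)^2 * B^2 * (\<Sum>i\<in>UNIV. indicator (cbox (?lo i) (?hi i)) x))"
      by (intro integrable_mult_right Bochner_Integration.integrable_sum integrable_real_indicator) (auto simp: emeasure_lborel_cbox_eq)
    have "sq_int (lebesgue_on U) (\<lambda>x. d x * u x)"
      by (rule sq_int_bounded_mult[OF su continuous_lebesgue_on_measurable[OF d(1)] d(2)])
    then have "integrable (lebesgue_on U) (\<lambda>x. (d x)^2 * (u x)^2)" by (simp add: sq_int_def power_mult_distrib)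
    then show "integrable lebesgue (\<lambda>x. indicator U x *\<^sub>R ((d x)^2 * (u x)^2))"
      by (subst integrable_restrict_space[symmetric]) (use U in simp)+
    show "AE x in lebesgue. indicator U x *\<^sub>R ((d x)^2 * (u x)^2) \<le> (K / R)^2 * B^2 * (\<Sum>i\<in>UNIV. indicator (cbox (?lo i) (?hi i)) x)"
      using B
    proof eventually_elim
      case (elim x)
      have rhs: "0 \<le> (K / R)^2 * B^2 * (\<Sum>i\<in>UNIV. indicator (cbox (?lo i) (?hi i)) x)"
        by (intro mult_nonneg_nonneg sum_nonneg) auto
      show ?case
      proof (cases "x \<in> U \<and> (\<forall>k. \<bar>x $ k\<bar> \<le> 2 * R)")
        case True
        then obtain i where i: "x \<in> bar i" using U(2) by (auto simp: Omega_def)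
        have "indicator (cbox (?lo i) (?hi i)) x = (1::real)" using mem[OF i] True by simp
        moreover have "indicator (cbox (?lo i) (?hi i)) x \<le> (\<Sum>i\<in>UNIV. indicator (cbox (?lo i) (?hi i)) x :: real)"
          by (rule member_le_sum) auto
        ultimately have "1 \<le> (\<Sum>i\<in>UNIV. indicator (cbox (?lo i) (?hi i)) x :: real)" by simp
        then have "(K / R)^2 * B^2 * 1 \<le> (K / R)^2 * B^2 * (\<Sum>i\<in>UNIV. indicator (cbox (?lo i) (?hi i)) x)"
          by (intro mult_left_mono) auto
        moreover have "(d x)^2 * (u x)^2 \<le> (K / R)^2 * B^2"
        proof (intro mult_mono)
          show "(d x)^2 \<le> (K / R)^2" using power_mono[OF d(2)[of x], of 2] by simp
          have "\<bar>u x\<bar> \<le> B" using elim True U(2) by auto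
          from power_mono[OF this, of 2] show "(u x)^2 \<le> B^2" by simp
        qed auto
        ultimately show ?thesis using True by simp
      next
        case False
        then have "indicator U x *\<^sub>R ((d x)^2 * (u x)^2) = 0" using d(3)[of x] by (auto simp: not_le)
        then show ?thesis by (rule ord_eq_le_trans[OF _ rhs])
      qed
    qed
  qed
  also have "\<dots> = (K / R)^2 * B^2 * (\<Sum>i\<in>UNIV. measure lebesgue (cbox (?lo i) (?hi i)))"
    by (subst Bochner_Integration.integral_mult_right_zero, subst Bochner_Integration.integral_sum)
      (auto intro!: integrable_real_indicator simp: emeasure_lborel_cbox_eq)
  also have "\<dots> = 12 * (K^2 * B^2) / R" unfolding ms using R by (simp add: power_divide power2_eq_square)
  finally show ?thesis .
qed

section \<open>Absence of a threshold resonance\<close>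

text \<open>The shift \<open>t\<close> is chosen once and for all radii, so that the mean over the cube vanishes. Letting
  \<open>R\<close> tend to infinity with the bounded piece \<open>\<Omega> \<inter> cball 0 m\<close> fixed forces first \<open>t = 0\<close> and
  then \<open>u = 0\<close> on that piece.\<close>

lemma bounded_solution_part_zero:
  fixes v :: "real^3 \<Rightarrow> complex"
  assumes sol: "dirichlet_solution Omega (2 * pi^2) v" and bd: "ess_bounded_on Omega v"
    and L: "bounded_linear L" "\<And>z. \<bar>L z\<bar> \<le> norm z"
  shows "AE x in lebesgue. x \<in> Omega \<longrightarrow> L (v x) = 0"
proof -
  define u where "u x = L (v x)" for x
  obtain B where "AE x in lebesgue. x \<in> Omega \<longrightarrow> norm (v x) \<le> B" using bd unfolding ess_bounded_on_def by blast
  then have B: "AE x in lebesgue. x \<in> Omega \<longrightarrow> \<bar>u x\<bar> \<le> B"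
    by eventually_elim (use L(2) order_trans in \<open>auto simp: u_def\<close>)
  obtain k C where k: "k > 0" and coer: "\<And>f. trial f \<Longrightarrow> k * (LBINT x. rho x * (f x)^2) \<le> energy f + C * (cubeM f)^2"
    using energy_coercive by blast
  obtain \<phi> where \<phi>: "test_fun Omega \<phi>" "energy \<phi> < 0" using negative_energy by blast
  obtain R0 where R0: "R0 > 1" "\<And>x. norm x \<ge> R0 \<Longrightarrow> \<phi> x = 0" "\<And>h x. norm x \<ge> R0 \<Longrightarrow> dir_deriv h \<phi> x = 0"
    using trial_support[OF test_fun_trial[OF \<phi>(1)]] by metis
  obtain K where K: "K > 0" and cut: "\<And>R. R \<ge> 1 \<Longrightarrow> \<exists>c. cutoff K R c"
    using cutoff_exists by blast
  have cm: "cubeM \<phi> \<noteq> 0"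
  proof
    assume "cubeM \<phi> = 0"
    then have "k * (LBINT x. rho x * (\<phi> x)^2) \<le> energy \<phi>" using coer[OF test_fun_trial[OF \<phi>(1)]] by simp
    moreover have "0 \<le> (LBINT x. rho x * (\<phi> x)^2)"
      by (rule Bochner_Integration.integral_nonneg) (use rho_bounds in \<open>simp add: less_imp_le\<close>)
    ultimately show False using k \<phi>(2) mult_nonneg_nonneg[of k] by fastforce
  qed
  \<comment> \<open>Then \<open>u - t \<phi>\<close> has mean zero over the cube.\<close>
  define t where "t = (\<integral>x. inQ x * u x \<partial>lebesgue) / cubeM \<phi>"
  define A where "A = 36 * (K^2 * B^2)"
  have Os: "Omega \<in> sets lebesgue" using open_Omega by simp
  have main: "integrable lebesgue (\<lambda>x. indicator (Omega \<inter> cball 0 m) x * (rho x * (u x - t * \<phi> x)^2)) \<and>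
     k * (\<integral>x. indicator (Omega \<inter> cball 0 m) x * (rho x * (u x - t * \<phi> x)^2) \<partial>lebesgue) \<le> A / R + t^2 * energy \<phi>"
    if R: "R \<ge> R0" "m \<le> R" for R m
  proof -
    have R1: "R \<ge> 1" using R R0 by simp
    define U where "U = Omega \<inter> ball 0 (7 * R)"
    have oU: "open U" unfolding U_def by (intro open_Int open_Omega) simp
    have bU: "bounded U" unfolding U_def by auto
    have Ul: "U \<in> lmeasurable" using oU bU by (simp add: bounded_set_imp_lmeasurable)
    have Us: "U \<in> sets lebesgue" using Ul by (rule fmeasurableD)
    have Us': "U \<inter> space lebesgue \<in> sets lebesgue" using Us by simp
    obtain c where cR: "cutoff K R c" using cut[OF R1] by blast
    note c = cutoffD[OF cR]
    have \<phi>R: "\<And>x. norm x \<ge> R \<Longrightarrow> \<phi> x = 0" "\<And>x j. norm x \<ge> R \<Longrightarrow> pd j \<phi> x = 0" using R0 R by auto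
    note ci = cutoff_inequality(1)[OF sol L coer R1 U_def cR \<phi>(1) \<phi>R, folded u_def]
      cutoff_inequality(2)[where t=t, OF sol L coer R1 U_def cR \<phi>(1) \<phi>R, folded u_def]
    have su: "sq_int (lebesgue_on U) u" by (rule ci(1))
    have cc: "continuous_on UNIV c" "continuous_on UNIV (pd j c)" for j using C_diff_1D[of c] c(1) by blast+
    have err: "(\<Sum>j\<in>UNIV. \<integral>x. (pd j c x)^2 * (u x)^2 \<partial>lebesgue_on U) \<le> A / R"
    proof -
      have "(\<Sum>j\<in>UNIV. \<integral>x. (pd j c x)^2 * (u x)^2 \<partial>lebesgue_on U) \<le> (\<Sum>j\<in>(UNIV::3 set). 12 * (K^2 * B^2) / R)"
        by (intro sum_mono cutoff_error[OF R1 Us _ B su cc(2) c(5) c(6)]) (simp add: U_def)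
      then show ?thesis by (simp add: A_def)
    qed
    have one: "c x = 1" if "norm x \<le> R" for x using that component_le_norm_cart[of x] by (intro c(2)) (auto intro: order_trans)
    have mean: "(\<integral>x. inQ x * (c x * u x - t * \<phi> x) \<partial>lebesgue_on U) = 0"
    proof -
      have qic: "inQ x * c x = inQ x" for x
      proof (cases "inQ x = 0")
        case False
        then have "\<bar>x $ j\<bar> < 1/2" for j by (auto simp: inQ_def split: if_splits)
        then have "\<bar>x $ j\<bar> \<le> R" for j by (rule order_trans[OF less_imp_le]) (use R1 in simp)
        then show ?thesis using c(2)[of x] by simp
      qed simp
      have qU: "indicator U x * inQ x = inQ x" for x
      proof (cases "inQ x = 0")
        case False
        then have "x \<in> Omega" by (auto simp: inQ_def Omega_def bar_def split: if_splits)
        moreover have "norm x < 7 * R" using norm_le_inQ[OF False] R1 by simp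
        ultimately show ?thesis by (simp add: U_def)
      qed simp
      have sq: "sq_int (lebesgue_on U) inQ" by (rule sq_int_inQ[OF Ul bU])
      have s\<phi>: "sq_int (lebesgue_on U) \<phi>" by (rule sq_int_continuous[OF test_fun_continuous(1)[OF \<phi>(1)] Ul bU])
      have "(\<integral>x. inQ x * (c x * u x - t * \<phi> x) \<partial>lebesgue_on U) = (\<integral>x. inQ x * u x - t * (inQ x * \<phi> x) \<partial>lebesgue_on U)"
      proof (rule Bochner_Integration.integral_cong[OF HOL.refl])
        fix x
        have "inQ x * (c x * u x - t * \<phi> x) = (inQ x * c x) * u x - t * (inQ x * \<phi> x)" by (simp add: algebra_simps)
        then show "inQ x * (c x * u x - t * \<phi> x) = inQ x * u x - t * (inQ x * \<phi> x)" by (simp only: qic)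
      qed
      also have "\<dots> = (\<integral>x. inQ x * u x \<partial>lebesgue_on U) - t * (\<integral>x. inQ x * \<phi> x \<partial>lebesgue_on U)"
        using sq_int_mult_integrable[OF sq su] sq_int_mult_integrable[OF sq s\<phi>] by simp
      also have "(\<integral>x. inQ x * u x \<partial>lebesgue_on U) = (\<integral>x. inQ x * u x \<partial>lebesgue)"
        unfolding integral_restrict_space[OF Us'] by (simp add: mult.assoc[symmetric] qU)
      also have "(\<integral>x. inQ x * \<phi> x \<partial>lebesgue_on U) = cubeM \<phi>"
        unfolding cubeM_def
      proof (rule integral_lborel_restrict[symmetric, OF _ _ Us])
        have [measurable]: "\<phi> \<in> borel_measurable borel"
          by (rule borel_measurable_continuous_onI[OF test_fun_continuous(1)[OF \<phi>(1)]])
        show "(\<lambda>x. inQ x * \<phi> x) \<in> borel_measurable borel" by measurable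
        show "inQ x * \<phi> x = 0" if "x \<notin> U" for x using qU[of x] that by simp
      qed
      finally show ?thesis using cm by (simp add: t_def)
    qed
    let ?S = "Omega \<inter> cball 0 m"
    have SU: "?S \<subseteq> U" using R R1 by (auto simp: U_def)
    have Ss: "?S \<in> sets lebesgue" by (intro sets.Int Os) simp
    let ?W = "\<lambda>x. c x * u x - t * \<phi> x"
    have sW: "sq_int (lebesgue_on U) ?W"
    proof -
      obtain D where "\<And>a. a \<in> U \<Longrightarrow> norm (c a) \<le> D" using continuous_bounded_on[OF cc(1) bU] by blast
      then have "sq_int (lebesgue_on U) (\<lambda>x. c x * u x)"
        by (intro sq_int_bounded_mult[OF su continuous_lebesgue_on_measurable[OF cc(1)]]) (auto simp: space_restrict_space)
      then show ?thesis
        by (intro sq_int_diff sq_int_cmult sq_int_continuous[OF test_fun_continuous(1)[OF \<phi>(1)] Ul bU])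
    qed
    have rm: "rho \<in> borel_measurable (lebesgue_on U)" by (intro measurable_restrict_space1 measurable_completion) simp
    have iW: "integrable (lebesgue_on U) (\<lambda>x. rho x * (?W x)^2)"
      using sW rm by (intro integrable_mult_bounded[where C=1]) (use rho_bounds in \<open>auto simp: sq_int_def abs_of_pos\<close>)
    have iW': "integrable lebesgue (\<lambda>x. indicator U x * (rho x * (?W x)^2))"
      using iW unfolding integrable_restrict_space[OF Us'] by simp
    have eqS: "indicator ?S x * (rho x * (u x - t * \<phi> x)^2) = indicator ?S x * (indicator U x * (rho x * (?W x)^2))" for x
      using SU one[of x] R by (auto simp: indicator_def)
    have i1: "integrable lebesgue (\<lambda>x. indicator ?S x * (rho x * (u x - t * \<phi> x)^2))"
      unfolding eqS by (rule integrable_mult_bounded[OF iW', where C=1]) (use Ss in auto)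
    have "(\<integral>x. indicator ?S x * (rho x * (u x - t * \<phi> x)^2) \<partial>lebesgue) \<le> (\<integral>x. indicator U x * (rho x * (?W x)^2) \<partial>lebesgue)"
    proof (rule integral_mono[OF i1 iW'])
      fix x
      have "0 \<le> indicator U x * (rho x * (?W x)^2)" using rho_bounds(1)[of x] by simp
      then show "indicator ?S x * (rho x * (u x - t * \<phi> x)^2) \<le> indicator U x * (rho x * (?W x)^2)"
        unfolding eqS by (auto simp: indicator_def)
    qed
    also have "\<dots> = (\<integral>x. rho x * (?W x)^2 \<partial>lebesgue_on U)"
      unfolding integral_restrict_space[OF Us'] by simp
    finally have "k * (\<integral>x. indicator ?S x * (rho x * (u x - t * \<phi> x)^2) \<partial>lebesgue) \<le> k * (\<integral>x. rho x * (?W x)^2 \<partial>lebesgue_on U)"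
      using k by simp
    also have "\<dots> \<le> A / R + t^2 * energy \<phi>" using ci(2) err unfolding mean by simp
    finally show ?thesis using i1 by blast
  qed
  have nn: "0 \<le> (\<integral>x. indicator (Omega \<inter> cball 0 m) x * (rho x * (u x - t * \<phi> x)^2) \<partial>lebesgue)" for m
    by (rule Bochner_Integration.integral_nonneg) (use rho_bounds(1) in \<open>simp add: less_imp_le\<close>)
  have lim: "((\<lambda>R. A / R + b) \<longlongrightarrow> b) at_top" for b
    using tendsto_add[OF tendsto_divide_0[OF tendsto_const filterlim_at_top_imp_at_infinity[OF filterlim_ident]] tendsto_const, of A b] by simp
  have "0 \<le> t^2 * energy \<phi>"
  proof (rule tendsto_lowerbound[OF lim])
    show "eventually (\<lambda>R. 0 \<le> A / R + t^2 * energy \<phi>) at_top"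
      using eventually_ge_at_top[of R0]
    proof eventually_elim
      case (elim R)
      then have "0 \<le> R" using R0 by simp
      from conjunct2[OF main[OF elim this]] mult_nonneg_nonneg[OF less_imp_le[OF k] nn[of 0]]
      show ?case by linarith
    qed
  qed simp
  then have t0: "t = 0" using \<phi>(2) mult_pos_neg[of "t^2" "energy \<phi>"] by (cases "t = 0") auto
  have zero: "AE x in lebesgue. x \<in> Omega \<inter> cball 0 m \<longrightarrow> u x = 0" for m
  proof -
    let ?I = "\<integral>x. indicator (Omega \<inter> cball 0 m) x * (rho x * (u x - t * \<phi> x)^2) \<partial>lebesgue"
    have "k * ?I \<le> 0"
    proof (rule tendsto_lowerbound)
      show "((\<lambda>R. A / R + 0) \<longlongrightarrow> 0) at_top" by (rule lim)
      show "eventually (\<lambda>R. k * ?I \<le> A / R + 0) at_top"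
        using eventually_ge_at_top[of "max R0 m"]
      proof eventually_elim
        case (elim R)
        then have "R0 \<le> R" "m \<le> R" by auto
        from conjunct2[OF main[OF this]] show ?case by (simp add: t0)
      qed
    qed simp
    then have "?I = 0" using k nn[of m] by (auto simp: mult_le_0_iff)
    moreover have "integrable lebesgue (\<lambda>x. indicator (Omega \<inter> cball 0 m) x * (rho x * (u x - t * \<phi> x)^2))"
      by (rule conjunct1[OF main[of "max R0 m" m]]) auto
    ultimately have "AE x in lebesgue. indicator (Omega \<inter> cball 0 m) x * (rho x * (u x - t * \<phi> x)^2) = 0"
      using integral_nonneg_eq_0_iff_AE[of lebesgue "\<lambda>x. indicator (Omega \<inter> cball 0 m) x * (rho x * (u x - t * \<phi> x)^2)"]
        rho_bounds(1) by (auto simp: less_imp_le)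
    then show ?thesis
    proof eventually_elim
      case (elim x)
      then show ?case using rho_bounds(1)[of x] by (auto simp: t0 indicator_def)
    qed
  qed
  have "AE x in lebesgue. \<forall>n::nat. x \<in> Omega \<inter> cball 0 (real n) \<longrightarrow> u x = 0"
    unfolding AE_all_countable using zero by blast
  then show ?thesis
  proof eventually_elim
    case (elim x)
    obtain n :: nat where "norm x \<le> real n" using real_arch_simple by blast
    then show ?case using elim by (auto simp: u_def)
  qed
qed

theorem theorem2p3:
  shows "\<not> threshold_resonance Omega (2 * pi\<^sup>2) \<and>
    (\<forall>v :: real^3 \<Rightarrow> complex.
       dirichlet_solution Omega (2 * pi\<^sup>2) v \<and> ess_bounded_on Omega v \<longrightarrow> zero_on Omega v)"
proof -
  have "zero_on Omega v" if "dirichlet_solution Omega (2 * pi\<^sup>2) v" "ess_bounded_on Omega v" for v :: "real^3 \<Rightarrow> complex"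
  proof -
    have "AE x in lebesgue. x \<in> Omega \<longrightarrow> Re (v x) = 0"
      by (rule bounded_solution_part_zero[OF that bounded_linear_Re]) (rule abs_Re_le_cmod)
    moreover have "AE x in lebesgue. x \<in> Omega \<longrightarrow> Im (v x) = 0"
      by (rule bounded_solution_part_zero[OF that bounded_linear_Im]) (rule abs_Im_le_cmod)
    ultimately show ?thesis unfolding zero_on_def by eventually_elim (auto simp: complex_eq_iff)
  qed
  then show ?thesis unfolding threshold_resonance_def by blast
qed

end
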